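(* Let $1<p<\infty$. (1) For each $n\in\mathbb{N}$ there exists a unique solution $v_n\in W^{1,2}_p(\mathcal{D}_T^n)\cap C(\overline{\mathcal{D}_T^n})$ of the double obstacle problem on $\mathcal{D}_T^n$ $$\begin{cases}\partial_\tau v_n-\mathcal{L}v_n=U&\text{where }-\psi_0(\tau)<v_n(\tau,x)<\psi_1(\tau),\\ \partial_\tau v_n-\mathcal{L}v_n\ge U&\text{where }v_n(\tau,x)=-\psi_0(\tau),\\ \partial_\tau v_n-\mathcal{L}v_n\le U&\text{where }v_n(\tau,x)=\psi_1(\tau),\\ -\psi_0\le v_n\le\psi_1\ \text{in }\overline{\mathcal{D}_T^n},\quad v_n(0,x)=0&\text{for all }x\in[-n,n],\\ v_n(\tau,-n)=\rho_0(\tau),\quad v_n(\tau,n)=\rho_1(\tau)&\text{for all }\tau\in[0,T].\end{cases}$$ (2) There exists a unique solution $v\in W^{1,2}_{p,\mathrm{loc}}(\mathcal{D}_T)\cap C(\overline{\mathcal{D}_T})$ of the double obstacle problem on $\mathcal{D}_T$ $$\begin{cases}\partial_\tau v-\mathcal{L}v=U&\text{where }-\psi_0(\tau)<v(\tau,x)<\psi_1(\tau),\\ \partial_\tau v-\mathcal{L}v\ge U&\text{where }v(\tau,x)=-\psi_0(\tau),\\ \partial_\tau v-\mathcal{L}v\le U&\text{where }v(\tau,x)=\psi_1(\tau),\\ -\psi_0\le v\le\psi_1\ \text{in }\overline{\mathcal{D}_T},\quad v(0,x)=0&\text{for all }x\in\mathbb{R}.\end{cases}$$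
   Context: Parameters: $T>0$, $r>0$, $\beta>0$, $\sigma>0$, $\mu\ne r$, $\theta:=(\mu-r)/\sigma$; $\alpha\in(0,1)$, $\gamma>0$, $\gamma\neq1$, $\gamma_1:=1-\alpha(1-\gamma)$; $0\le\varepsilon_1<\varepsilon_0$; $0<L_0<L_1$. Put $A:=\frac{\gamma_1}{1-\gamma_1}\big(L_1^{(\gamma_1-\gamma)/\gamma_1}-L_0^{(\gamma_1-\gamma)/\gamma_1}\big)$ (which is $>0$). It is assumed that $K_1:=r+\frac{\beta-r}{\gamma_1}+\frac{\gamma_1-1}{\gamma_1^2}\frac{\theta^2}{2}>0$. Switching costs: $\phi_0,\phi_1\in C^{1,1}([0,T])$ are positive functions with (i) $\phi_0'(t)-r\phi_0(t)<-\phi_1'(t)+r\phi_1(t)$ for all $t\in[0,T]$; (ii) $\phi_1(0)<(\varepsilon_0-\varepsilon_1)\frac{1-e^{-rT}}{r}$ and $-\phi_1'(t)+r\phi_1(t)<\varepsilon_0-\varepsilon_1$ for all $t\in[0,T]$. Set $\psi_i(\tau):=\phi_i(T-\tau)$, $i=0,1$. Operator and source: $\mathcal{L}:=\frac{\theta^2}{2}\partial_{xx}+(\beta-r+\frac{\theta^2}{2})\partial_x-r$ and $U(x):=(\varepsilon_0-\varepsilon_1)-A e^{-x/\gamma_1}$. Domains: $\mathcal{D}_T:=(0,T)\times\mathbb{R}$ and $\mathcal{D}_T^n:=(0,T)\times(-n,n)$. Lateral data for given $n$: $\mathcal{E}(\tau):=(\varepsilon_0-\varepsilon_1)\frac{1-e^{-r\tau}}{r}$,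 $\mathcal{G}(\tau):=Ae^{n/\gamma_1}\tau$, $\rho_0(\tau):=\max\{-\mathcal{G}(\tau),-\psi_0(\tau)\}$, $\rho_1(\tau):=\min\{\mathcal{E}(\tau),\psi_1(\tau)\}$ for $\tau\in[0,T]$. $W^{1,2}_p(D)$ is the parabolic Sobolev space of functions $u$ with $u,\partial_\tau u,\partial_xu,\partial_{xx}u\in L^p(D)$; $W^{1,2}_{p,\mathrm{loc}}(D)$ consists of functions lying in $W^{1,2}_p$ on compact subsets of $D$. The (in)equalities involving derivatives hold almost everywhere in the indicated sets. *)

theory Defs
  imports "HOL-Analysis.Analysis"
begin

text \<open>Points of the plane are pairs \<open>(\<tau>, x)\<close>: time first, space second.\<close>

definition C11_on :: "real set \<Rightarrow> (real \<Rightarrow> real) \<Rightarrow> (real \<Rightarrow> real) \<Rightarrow> bool" where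
  "C11_on S f f' \<longleftrightarrow>
     (\<forall>t\<in>S. (f has_real_derivative f' t) (at t within S)) \<and> (\<exists>C. C-lipschitz_on S f')"

definition dt :: "(real \<times> real \<Rightarrow> real) \<Rightarrow> real \<times> real \<Rightarrow> real" where
  "dt u = (\<lambda>(\<tau>, x). deriv (\<lambda>s. u (s, x)) \<tau>)"

definition dx :: "(real \<times> real \<Rightarrow> real) \<Rightarrow> real \<times> real \<Rightarrow> real" where
  "dx u = (\<lambda>(\<tau>, x). deriv (\<lambda>y. u (\<tau>, y)) x)"

fun Ck :: "nat \<Rightarrow> (real \<times> real \<Rightarrow> real) \<Rightarrow> bool" where
  "Ck 0 u \<longleftrightarrow> continuous_on UNIV u"
| "Ck (Suc k) u \<longleftrightarrow>
     (\<forall>\<tau> x. (\<lambda>s. u (s, x)) differentiable at \<tau> \<and> (\<lambda>y. u (\<tau>, y)) differentiable at x) \<and>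
     continuous_on UNIV u \<and> Ck k (dt u) \<and> Ck k (dx u)"

definition test_functions :: "(real \<times> real) set \<Rightarrow> (real \<times> real \<Rightarrow> real) set" where
  "test_functions D = {\<eta>. (\<forall>k. Ck k \<eta>) \<and>
     compact (closure {z. \<eta> z \<noteq> 0}) \<and> closure {z. \<eta> z \<noteq> 0} \<subseteq> D}"

definition locally_integrable :: "(real \<times> real) set \<Rightarrow> (real \<times> real \<Rightarrow> real) \<Rightarrow> bool" where
  "locally_integrable D u \<longleftrightarrow> (\<forall>K. compact K \<and> K \<subseteq> D \<longrightarrow> integrable (lebesgue_on K) u)"

definition weak_partial ::
  "nat \<Rightarrow> nat \<Rightarrow> (real \<times> real) set \<Rightarrow> (real \<times> real \<Rightarrow> real) \<Rightarrow> (real \<times> real \<Rightarrow> real) \<Rightarrow> bool" where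
  \<comment> \<open>\<open>g\<close> is the weak derivative of \<open>u\<close> on the open set \<open>D\<close>, of order \<open>i\<close> in time and \<open>j\<close> in space\<close>
  "weak_partial i j D u g \<longleftrightarrow>
     locally_integrable D u \<and> locally_integrable D g \<and>
     (\<forall>\<eta>\<in>test_functions D.
        (LINT z|lebesgue_on D. u z * (dt ^^ i) ((dx ^^ j) \<eta>) z)
        = (- 1) ^ (i + j) * (LINT z|lebesgue_on D. g z * \<eta> z))"

definition Lp :: "real \<Rightarrow> (real \<times> real) set \<Rightarrow> (real \<times> real \<Rightarrow> real) set" where
  "Lp p S = {f. f \<in> borel_measurable (lebesgue_on S) \<and>
     integrable (lebesgue_on S) (\<lambda>z. \<bar>f z\<bar> powr p)}"

text \<open>The parabolic Sobolev spaces are rendered as predicates that also name versions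
  \<open>ut\<close>, \<open>ux\<close>, \<open>uxx\<close> of the weak derivatives, which are determined only almost everywhere.\<close>

definition weak_derivatives ::
  "(real \<times> real) set \<Rightarrow> (real \<times> real \<Rightarrow> real) \<Rightarrow>
   (real \<times> real \<Rightarrow> real) \<Rightarrow> (real \<times> real \<Rightarrow> real) \<Rightarrow> (real \<times> real \<Rightarrow> real) \<Rightarrow> bool" where
  "weak_derivatives D u ut ux uxx \<longleftrightarrow>
     weak_partial 1 0 D u ut \<and> weak_partial 0 1 D u ux \<and> weak_partial 0 2 D u uxx"

definition in_W12 ::
  "real \<Rightarrow> (real \<times> real) set \<Rightarrow> (real \<times> real \<Rightarrow> real) \<Rightarrow>
   (real \<times> real \<Rightarrow> real) \<Rightarrow> (real \<times> real \<Rightarrow> real) \<Rightarrow> (real \<times> real \<Rightarrow> real) \<Rightarrow> bool" where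
  "in_W12 p D u ut ux uxx \<longleftrightarrow> weak_derivatives D u ut ux uxx \<and> {u, ut, ux, uxx} \<subseteq> Lp p D"

definition in_W12_loc ::
  "real \<Rightarrow> (real \<times> real) set \<Rightarrow> (real \<times> real \<Rightarrow> real) \<Rightarrow>
   (real \<times> real \<Rightarrow> real) \<Rightarrow> (real \<times> real \<Rightarrow> real) \<Rightarrow> (real \<times> real \<Rightarrow> real) \<Rightarrow> bool" where
  "in_W12_loc p D u ut ux uxx \<longleftrightarrow> weak_derivatives D u ut ux uxx \<and>
     (\<forall>K. compact K \<and> K \<subseteq> D \<longrightarrow> {u, ut, ux, uxx} \<subseteq> Lp p K)"

definition L_op ::
  "real \<Rightarrow> real \<Rightarrow> real \<Rightarrow> (real \<times> real \<Rightarrow> real) \<Rightarrow> (real \<times> real \<Rightarrow> real) \<Rightarrow>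
   (real \<times> real \<Rightarrow> real) \<Rightarrow> real \<times> real \<Rightarrow> real" where
  \<comment> \<open>the operator \<open>\<L>\<close> applied to \<open>u\<close> with (weak) spatial derivatives \<open>ux\<close> and \<open>uxx\<close>\<close>
  "L_op \<theta> \<beta> r u ux uxx z = \<theta>\<^sup>2 / 2 * uxx z + (\<beta> - r + \<theta>\<^sup>2 / 2) * ux z - r * u z"

definition double_obstacle ::
  "real \<Rightarrow> real \<Rightarrow> real \<Rightarrow> (real \<Rightarrow> real) \<Rightarrow> (real \<Rightarrow> real) \<Rightarrow> (real \<Rightarrow> real) \<Rightarrow> (real \<times> real) set \<Rightarrow>
   (real \<times> real \<Rightarrow> real) \<Rightarrow> (real \<times> real \<Rightarrow> real) \<Rightarrow> (real \<times> real \<Rightarrow> real) \<Rightarrow>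
   (real \<times> real \<Rightarrow> real) \<Rightarrow> bool" where
  "double_obstacle \<theta> \<beta> r U \<psi>0 \<psi>1 D v vt vx vxx \<longleftrightarrow>
     (AE (\<tau>, x) in lebesgue_on D.
        (- \<psi>0 \<tau> < v (\<tau>, x) \<and> v (\<tau>, x) < \<psi>1 \<tau> \<longrightarrow>
           vt (\<tau>, x) - L_op \<theta> \<beta> r v vx vxx (\<tau>, x) = U x) \<and>
        (v (\<tau>, x) = - \<psi>0 \<tau> \<longrightarrow> vt (\<tau>, x) - L_op \<theta> \<beta> r v vx vxx (\<tau>, x) \<ge> U x) \<and>
        (v (\<tau>, x) = \<psi>1 \<tau> \<longrightarrow> vt (\<tau>, x) - L_op \<theta> \<beta> r v vx vxx (\<tau>, x) \<le> U x)) \<and>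
     (\<forall>(\<tau>, x)\<in>closure D. - \<psi>0 \<tau> \<le> v (\<tau>, x) \<and> v (\<tau>, x) \<le> \<psi>1 \<tau>)"

definition dom_T :: "real \<Rightarrow> (real \<times> real) set" where
  "dom_T T = {0<..<T} \<times> UNIV"

definition dom_Tn :: "real \<Rightarrow> nat \<Rightarrow> (real \<times> real) set" where
  "dom_Tn T n = {0<..<T} \<times> {- real n<..<real n}"

definition solves_on_strip ::
  "real \<Rightarrow> real \<Rightarrow> real \<Rightarrow> real \<Rightarrow> real \<Rightarrow> (real \<Rightarrow> real) \<Rightarrow> (real \<Rightarrow> real) \<Rightarrow> (real \<Rightarrow> real) \<Rightarrow>
   (real \<times> real \<Rightarrow> real) \<Rightarrow> bool" where
  "solves_on_strip p T \<theta> \<beta> r U \<psi>0 \<psi>1 v \<longleftrightarrow>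
     continuous_on (closure (dom_T T)) v \<and>
     (\<exists>vt vx vxx. in_W12_loc p (dom_T T) v vt vx vxx \<and>
        double_obstacle \<theta> \<beta> r U \<psi>0 \<psi>1 (dom_T T) v vt vx vxx) \<and>
     (\<forall>x. v (0, x) = 0)"

definition solves_on_rectangle ::
  "real \<Rightarrow> real \<Rightarrow> nat \<Rightarrow> real \<Rightarrow> real \<Rightarrow> real \<Rightarrow> (real \<Rightarrow> real) \<Rightarrow> (real \<Rightarrow> real) \<Rightarrow> (real \<Rightarrow> real) \<Rightarrow>
   (real \<Rightarrow> real) \<Rightarrow> (real \<Rightarrow> real) \<Rightarrow> (real \<times> real \<Rightarrow> real) \<Rightarrow> bool" where
  "solves_on_rectangle p T n \<theta> \<beta> r U \<psi>0 \<psi>1 \<rho>0 \<rho>1 v \<longleftrightarrow>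
     continuous_on (closure (dom_Tn T n)) v \<and>
     (\<exists>vt vx vxx. in_W12 p (dom_Tn T n) v vt vx vxx \<and>
        double_obstacle \<theta> \<beta> r U \<psi>0 \<psi>1 (dom_Tn T n) v vt vx vxx) \<and>
     (\<forall>x\<in>{- real n..real n}. v (0, x) = 0) \<and>
     (\<forall>\<tau>\<in>{0..T}. v (\<tau>, - real n) = \<rho>0 \<tau> \<and> v (\<tau>, real n) = \<rho>1 \<tau>)"

text \<open>Values of a function outside the set carry no information, hence uniqueness is
  uniqueness on the set.\<close>

definition exists_unique_on ::
  "(real \<times> real) set \<Rightarrow> ((real \<times> real \<Rightarrow> real) \<Rightarrow> bool) \<Rightarrow> bool" where
  "exists_unique_on S P \<longleftrightarrow> (\<exists>v. P v \<and> (\<forall>w. P w \<longrightarrow> (\<forall>z\<in>S. w z = v z)))"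

end

theory Submission
  imports Defs "HOL-Complex_Analysis.Great_Picard"
begin

text \<open>
  Existence. The explicit difference scheme that advances by one time step and cuts the result off
  at the obstacles is monotone under a CFL condition. Comparing two consecutive time levels bounds
  the discrete time derivative; together with the obstacle conditions this bounds the discrete
  operator, hence, by a discrete integrating factor, the first and second space differences, all
  locally uniformly in the mesh size. So a subsequence converges pointwise, its difference
  quotients converge weakly-* to the weak derivatives of the limit, and these are locally bounded:
  the solution lies in the space for \<open>p = \<infinity>\<close>, and no \<open>L\<^sup>p\<close> theory is needed. The
  inequalities pass to the limit when the residual of the scheme is tested with indicator functions.

  Uniqueness. The difference \<open>d\<close> of two solutions satisfies \<open>\<partial>\<^sub>\<tau> d - \<L> d \<le> 0\<close> almost everywhere on
  \<open>{d > 0}\<close>. If \<open>d\<close> were positive somewhere, \<open>d\<close> minus a strict smooth supersolution would have an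
  interior maximum; mollifying \<open>d\<close> near it yields a classical subsolution and a contradiction.
\<close>

section \<open>Weak-* compactness of bounded sequences\<close>

text \<open>The obstacles depend on time only. This bounds the discrete operator where the scheme is
  cut off: at a contact point all neighbours lie on the same side of the same number. Elsewhere the
  bound on the time increments and the scheme itself control the operator, so no penalisation is
  involved. The source \<open>U\<close> grows exponentially as the space variable tends to minus
  infinity; hence the weight \<open>1 + exp (- \<kappa> * x)\<close> in the estimate of the time
  increments, and bounds that are uniform in the mesh but only local in space. An explicit step
  reads finitely many neighbours, so the scheme runs on all integers as well as on a bounded index
  set: the strip is handled by the same construction as the rectangles, not by exhaustion. Both
  obstacles are bounded, hence so is the difference of two solutions, and a quadratically growing
  barrier suffices for uniqueness on the strip. The lateral data are Lipschitz in time and vanish at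
  time 0, which keeps the increments of the order of the time step up to the corners.\<close>

lemma borel_countable_Int_stable_generator:
  obtains G :: "'a::second_countable_topology set set"
  where "countable G" "UNIV \<in> G" "Int_stable G" "sets borel = sigma_sets UNIV G"
proof -
  obtain B :: "'a set set" where B: "countable B" "topological_basis B"
    using ex_countable_basis by blast
  \<comment> \<open>Finite intersections of basic open sets: still countable, as the diagonal choice
    of a subsequence requires, and closed under intersection, as the Dynkin induction requires. The
    empty intersection contributes \<open>UNIV\<close>, which handles complements.\<close>
  define G where "G = (\<lambda>F. \<Inter>F) ` {F. F \<subseteq> B \<and> finite F}"
  have "countable G"
    unfolding G_def using countable_Collect_finite_subset[OF B(1)] by (simp add: conj_commute)
  moreover have "UNIV \<in> G" unfolding G_def by (intro image_eqI[where x="{}"]) auto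
  moreover have "Int_stable G"
  proof (rule Int_stableI)
    fix a b assume "a \<in> G" "b \<in> G"
    then obtain E F where "E \<subseteq> B" "finite E" "F \<subseteq> B" "finite F" "a = \<Inter>E" "b = \<Inter>F"
      unfolding G_def by auto
    then show "a \<inter> b \<in> G"
      unfolding G_def by (intro image_eqI[where x="E \<union> F"]) auto
  qed
  moreover have "sets borel = sigma_sets UNIV G"
  proof -
    have op: "open g" if "g \<in> G" for g
      using that topological_basis_open[OF B(2)] unfolding G_def by (auto intro!: open_Inter)
    have sub: "B \<subseteq> G"
    proof
      fix x assume "x \<in> B"
      then show "x \<in> G" unfolding G_def by (intro image_eqI[where x="{x}"]) auto
    qed
    have "sigma_sets UNIV {S::'a set. open S} = sigma_sets UNIV G"
    proof (rule sigma_sets_eqI)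
      fix S :: "'a set" assume "S \<in> {S. open S}"
      then obtain B' where "B' \<subseteq> B" "\<Union>B' = S"
        using B(2) unfolding topological_basis_def by auto
      moreover have "countable B'" using B(1) \<open>B' \<subseteq> B\<close> countable_subset by blast
      moreover have "b \<in> sigma_sets UNIV G" if "b \<in> B'" for b
        using that sub \<open>B' \<subseteq> B\<close> by (auto intro: sigma_sets.Basic)
      ultimately show "S \<in> sigma_sets UNIV G"
        using sigma_sets_UNION[of B'] by blast
    next
      fix g assume "g \<in> G"
      then show "g \<in> sigma_sets UNIV {S. open S}" using op by auto
    qed
    then show ?thesis by (simp add: borel_def)
  qed
  ultimately show ?thesis using that by blast
qed

lemma (in finite_measure) integrable_indicator_mult_bounded:
  fixes u :: "'a \<Rightarrow> real"
  assumes "A \<in> sets M" "u \<in> borel_measurable M" "\<And>x. 0 \<le> u x" "\<And>x. u x \<le> C"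
  shows "integrable M (\<lambda>x. indicator A x * u x)"
  using assms by (intro integrable_const_bound[where B=C])
      (auto simp: indicator_def intro: order_trans[OF assms(3,4)])

lemma (in finite_measure) integral_indicator_mult_bounds:
  fixes u :: "'a \<Rightarrow> real"
  assumes "A \<in> sets M" "u \<in> borel_measurable M" "\<And>x. 0 \<le> u x" "\<And>x. u x \<le> C"
  shows "\<bar>LINT x|M. indicator A x * u x\<bar> \<le> C * measure M A" "0 \<le> (LINT x|M. indicator A x * u x)"
proof -
  show nn: "0 \<le> (LINT x|M. indicator A x * u x)" using assms(3) by (intro integral_nonneg_AE) auto
  have "(LINT x|M. indicator A x * u x) \<le> (LINT x|M. C * indicator A x)"
    using assms integrable_indicator_mult_bounded[OF assms]
    by (intro integral_mono integrable_mult_right integrable_real_indicator)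
       (auto simp: indicator_def less_top[symmetric])
  then show "\<bar>LINT x|M. indicator A x * u x\<bar> \<le> C * measure M A" using assms(1) nn by simp
qed

text \<open>The sets on whose indicators the integrals converge form a Dynkin system; the limits form
  a measure dominated by a multiple of \<open>M\<close>, and its density is the weak limit.\<close>

lemma weak_star_compact_finite:
  fixes u :: "nat \<Rightarrow> 'a::second_countable_topology \<Rightarrow> real"
  assumes fin: "finite_measure M" and setsM: "sets M = sets borel"
    and meas: "\<And>n. u n \<in> borel_measurable M"
    and lb: "\<And>n x. 0 \<le> u n x" and ub: "\<And>n x. u n x \<le> C"
  obtains k g where "strict_mono (k::nat \<Rightarrow> nat)" "g \<in> borel_measurable M" 
    "\<And>x. 0 \<le> g x" "\<And>x. g x \<le> C"
    "\<And>A. A \<in> sets M \<Longrightarrow>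
       (\<lambda>n. LINT x|M. indicator A x * u (k n) x) \<longlonglongrightarrow> (LINT x|M. indicator A x * g x)"
proof -
  interpret finite_measure M by fact
  have C0: "0 \<le> C" using lb ub order_trans by blast
  have spM: "space M = UNIV" using sets_eq_imp_space_eq[OF setsM] by simp
  note int = integrable_indicator_mult_bounded[OF _ meas lb ub]
  note bnd = integral_indicator_mult_bounds(1)[OF _ meas lb ub]
  obtain G :: "'a set set" where G: "countable G" "UNIV \<in> G" "Int_stable G" "sets borel = sigma_sets UNIV G"
    by (rule borel_countable_Int_stable_generator)
  have bnd': "norm (LINT x|M. indicator A x * u n x) \<le> C * measure M UNIV" if "A \<in> sets M" for A n
  proof -
    have "C * measure M A \<le> C * measure M UNIV"
      using C0 finite_measure_mono[of A UNIV] sets.top[of M] spM that by (intro mult_left_mono) auto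
    then show ?thesis using bnd[OF that, of n] by simp
  qed
  have GM: "A \<in> sets M" if "A \<in> G" for A using that G(4) setsM by auto
  \<comment> \<open>A diagonal subsequence along which the integrals over every set of the countable
    generator converge.\<close>
  obtain k where k: "strict_mono (k::nat\<Rightarrow>nat)"
     "\<And>A. A \<in> G \<Longrightarrow> \<exists>l. (\<lambda>n. LINT x|M. indicator A x * u (k n) x) \<longlonglongrightarrow> l"
    by (rule function_convergent_subsequence[OF G(1), where f="\<lambda>n A. LINT x|M. indicator A x * u n x"
          and M="C * measure M UNIV"]) (use bnd' GM in auto)
  define I where "I n A = (LINT x|M. indicator A x * u (k n) x)" for n A
  have sums_I: "(\<lambda>i. I n (A i)) sums I n (\<Union>i. A i)"
    if "disjoint_family A" "range A \<subseteq> sets M" for A n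
  proof -
    have "(\<Sum>i. set_lebesgue_integral M (A i) (u (k n))) = set_lebesgue_integral M (\<Union>i. A i) (u (k n))"
      "summable (\<lambda>i. set_lebesgue_integral M (A i) (u (k n)))"
    proof -
      have si: "set_integrable M (\<Union>i. A i) (u (k n))"
        using int[of "\<Union>i. A i" "k n"] that by (auto simp: set_integrable_def)
      show "(\<Sum>i. set_lebesgue_integral M (A i) (u (k n))) = set_lebesgue_integral M (\<Union>i. A i) (u (k n))"
        using lebesgue_integral_countable_add[of A M "u (k n)"] si that
        by (auto simp: disjoint_family_on_def)
      have "summable (\<lambda>i. C * measure M (A i))"
        using that by (intro summable_mult sums_summable[OF finite_measure_UNION]) auto
      then show "summable (\<lambda>i. set_lebesgue_integral M (A i) (u (k n)))"
        by (rule summable_comparison_test'[where N=0])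
           (use bnd[of "A _" "k n"] that in \<open>auto simp: set_lebesgue_integral_def\<close>)
    qed
    then show ?thesis by (simp add: I_def set_lebesgue_integral_def sums_iff)
  qed
  \<comment> \<open>Tannery's theorem exchanges limit and sum, with the dominating series
    \<open>C * measure M (A i)\<close>. It serves twice: for closure of the Dynkin system under
    disjoint unions and for countable additivity of the limit.\<close>
  have limU: "(\<lambda>n. I n (\<Union>i. A i)) \<longlonglongrightarrow> (\<Sum>i. l i) \<and> summable l"
    if A: "disjoint_family A" "range A \<subseteq> sets M" and l: "\<And>i. (\<lambda>n. I n (A i)) \<longlonglongrightarrow> l i" for A l
  proof -
    have "summable (\<lambda>i. C * measure M (A i))"
      using A by (intro summable_mult sums_summable[OF finite_measure_UNION]) auto
    moreover have "\<forall>\<^sub>F (i, n) in at_top \<times>\<^sub>F sequentially. norm (I n (A i)) \<le> C * measure M (A i)"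
      using bnd A unfolding I_def by (intro always_eventually) auto
    ultimately have t: "summable (\<lambda>i. norm (l i)) \<and>
         ((\<lambda>n. \<Sum>i. I n (A i)) \<longlongrightarrow> suminf l) sequentially"
      using tannerys_theorem[of "\<lambda>i n. I n (A i)" l sequentially "\<lambda>i. C * measure M (A i)"] l by auto
    have "(\<lambda>n. \<Sum>i. I n (A i)) = (\<lambda>n. I n (\<Union>i. A i))"
      using sums_I[OF A] by (auto simp: sums_iff)
    then show ?thesis using t summable_norm_cancel[of l] by auto
  qed
  have conv: "\<exists>l. (\<lambda>n. I n A) \<longlonglongrightarrow> l" if "A \<in> sets M" for A
  proof -
    have "A \<in> sigma_sets UNIV G"
      using that G(4) setsM by auto
    then show ?thesis
    proof (rule sigma_sets_induct_disjoint[where P="\<lambda>A. \<exists>l. (\<lambda>n. I n A) \<longlonglongrightarrow> l", OF G(3) subset_UNIV[of G, folded Pow_UNIV]])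
      fix B assume "B \<in> G" then show "\<exists>l. (\<lambda>n. I n B) \<longlonglongrightarrow> l" using k(2) by (auto simp: I_def)
    next
      show "\<exists>l. (\<lambda>n. I n {}) \<longlonglongrightarrow> l" by (auto simp: I_def)
    next
      fix B assume B: "B \<in> sigma_sets UNIV G" "\<exists>l. (\<lambda>n. I n B) \<longlonglongrightarrow> l"
      then have BM: "B \<in> sets M" using G(4) setsM by simp
      obtain l l' where "(\<lambda>n. I n B) \<longlonglongrightarrow> l" "(\<lambda>n. I n UNIV) \<longlonglongrightarrow> l'"
        using B k(2)[OF G(2)] by (auto simp: I_def)
      then have "(\<lambda>n. I n UNIV - I n B) \<longlonglongrightarrow> l' - l" by (intro tendsto_diff)
      moreover have "I n UNIV - I n B = I n (UNIV - B)" for n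
      proof -
        have "I n UNIV - I n B = (LINT x|M. indicator UNIV x * u (k n) x - indicator B x * u (k n) x)"
          unfolding I_def using int[of UNIV "k n"] int[OF BM, of "k n"] sets.top[of M] spM
          by (intro Bochner_Integration.integral_diff[symmetric]) auto
        also have "\<dots> = I n (UNIV - B)"
          unfolding I_def by (intro Bochner_Integration.integral_cong) (auto simp: indicator_def)
        finally show ?thesis .
      qed
      ultimately show "\<exists>l. (\<lambda>n. I n (UNIV - B)) \<longlonglongrightarrow> l" by auto
    next
      fix B :: "nat \<Rightarrow> 'a set"
      assume B: "disjoint_family B" "range B \<subseteq> sigma_sets UNIV G" "\<And>i. \<exists>l. (\<lambda>n. I n (B i)) \<longlonglongrightarrow> l"
      then obtain l where "\<And>i. (\<lambda>n. I n (B i)) \<longlonglongrightarrow> l i" by metis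
      then show "\<exists>l. (\<lambda>n. I n (\<Union>i. B i)) \<longlonglongrightarrow> l" using limU[of B l] B G(4) setsM by auto
    qed
  qed
  define J where "J A = lim (\<lambda>n. I n A)" for A
  have IJ: "(\<lambda>n. I n A) \<longlonglongrightarrow> J A" if "A \<in> sets M" for A
    using conv[OF that] by (auto simp: J_def limI)
  have J_nn: "0 \<le> J A" if "A \<in> sets M" for A
    using integral_indicator_mult_bounds(2)[OF that meas lb ub]
    by (intro LIMSEQ_le_const[OF IJ[OF that]]) (auto simp: I_def)
  have J_le: "J A \<le> C * measure M A" if "A \<in> sets M" for A
    using bnd[OF that] by (intro LIMSEQ_le_const2[OF IJ[OF that]]) (auto simp: I_def abs_le_iff)
  define N where "N = measure_of UNIV (sets M) (\<lambda>A. ennreal (J A))"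
  have setsN: "sets N = sets M" unfolding N_def using sets.sets_measure_of_eq[of M] spM by simp
  have N: "emeasure N A = ennreal (J A)" if "A \<in> sets M" for A
    unfolding N_def
  proof (rule emeasure_measure_of_sigma[OF _ _ _ that])
    show "sigma_algebra UNIV (sets M)" using sets.sigma_algebra_axioms[of M] spM by simp
    show "positive (sets M) (\<lambda>A. ennreal (J A))"
      using tendsto_unique[OF _ IJ[of "{}"], of 0] by (auto simp: positive_def I_def)
    show "countably_additive (sets M) (\<lambda>A. ennreal (J A))"
    proof (rule countably_additiveI)
      fix A :: "nat \<Rightarrow> 'a set" assume A: "range A \<subseteq> sets M" "disjoint_family A" "(\<Union>i. A i) \<in> sets M"
      have *: "(\<lambda>n. I n (\<Union>i. A i)) \<longlonglongrightarrow> (\<Sum>i. J (A i))" "summable (\<lambda>i. J (A i))"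
        using limU[OF A(2,1), of "\<lambda>i. J (A i)"] IJ A(1) by auto
      then have "J (\<Union>i. A i) = (\<Sum>i. J (A i))"
        using IJ[OF A(3)] LIMSEQ_unique by blast
      then show "(\<Sum>i. ennreal (J (A i))) = ennreal (J (\<Union>i. A i))"
        using J_nn A(1) *(2) by (simp add: suminf_ennreal2 range_subsetD)
    qed
  qed
  have "absolutely_continuous M N"
    unfolding absolutely_continuous_def
  proof
    fix A assume A: "A \<in> null_sets M"
    then have "J A \<le> 0" using J_le[of A] by (auto simp: null_sets_def measure_def)
    then show "A \<in> null_sets N" using A N[of A] setsN by (auto simp: null_sets_def ennreal_neg)
  qed
  then obtain f where f: "f \<in> borel_measurable M" "density M f = N"
    using Radon_Nikodym[of N] setsN by auto
  have f_int: "(\<integral>\<^sup>+x. f x * indicator A x \<partial>M) = ennreal (J A)" if "A \<in> sets M" for A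
    using emeasure_density[OF f(1) that] f(2) N[OF that] by simp
  have AEf: "AE x in M. f x \<le> ennreal C"
  proof -
    \<comment> \<open>On the set where the density exceeds \<open>C\<close>, its integral is at most
      \<open>C * measure M A\<close>; so the integral of the excess vanishes and the set is
      null.\<close>
    define A where "A = {x. f x > ennreal C}"
    have A: "A \<in> sets M" using f(1) spM unfolding A_def using borel_measurable_less[of "\<lambda>_. ennreal C" M f] by simp
    have "(\<integral>\<^sup>+x. (f x - ennreal C) * indicator A x \<partial>M) + (\<integral>\<^sup>+x. ennreal C * indicator A x \<partial>M) =
       (\<integral>\<^sup>+x. (f x - ennreal C) * indicator A x + ennreal C * indicator A x \<partial>M)"
      using f(1) A by (intro nn_integral_add[symmetric]) auto
    also have "\<dots> = (\<integral>\<^sup>+x. f x * indicator A x \<partial>M)"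
      by (intro nn_integral_cong) (auto simp: indicator_def A_def diff_add_cancel_ennreal)
    also have "\<dots> \<le> ennreal (C * measure M A)" using f_int[OF A] J_le[OF A] by (simp add: ennreal_leI)
    also have "\<dots> = (\<integral>\<^sup>+x. ennreal C * indicator A x \<partial>M)"
      using A C0 by (simp add: nn_integral_cmult_indicator emeasure_eq_measure ennreal_mult)
    finally have "(\<integral>\<^sup>+x. ennreal C * indicator A x \<partial>M) + (\<integral>\<^sup>+x. (f x - ennreal C) * indicator A x \<partial>M)
        \<le> (\<integral>\<^sup>+x. ennreal C * indicator A x \<partial>M) + 0" by (simp add: add.commute)
    moreover have "(\<integral>\<^sup>+x. ennreal C * indicator A x \<partial>M) \<noteq> \<infinity>"
      using A C0 by (simp add: nn_integral_cmult_indicator emeasure_eq_measure flip: ennreal_mult)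
    ultimately have "(\<integral>\<^sup>+x. (f x - ennreal C) * indicator A x \<partial>M) = 0"
      unfolding ennreal_add_left_cancel_le by simp
    then have "AE x in M. (f x - ennreal C) * indicator A x = 0"
      using f(1) A by (subst (asm) nn_integral_0_iff_AE) auto
    then show ?thesis by eventually_elim (auto simp: A_def indicator_def diff_eq_0_iff_ennreal split: if_splits)
  qed
  \<comment> \<open>The truncation changes the density on a null set only and makes the bound by
    \<open>C\<close> hold everywhere.\<close>
  define g where "g x = enn2real (min (f x) (ennreal C))" for x
  have eg: "ennreal (g x) = min (f x) (ennreal C)" for x
    unfolding g_def by (intro ennreal_enn2real) (auto simp: min_def less_top[symmetric] top_unique)
  show ?thesis
  proof (rule that[of k g])
    show gm: "g \<in> borel_measurable M" unfolding g_def using f(1) by measurable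
    show g0: "0 \<le> g x" for x by (simp add: g_def)
    show gC: "g x \<le> C" for x using eg[of x] C0 by (metis ennreal_le_iff min.cobounded2)
    fix A assume A: "A \<in> sets M"
    have "ennreal (LINT x|M. indicator A x * g x) = (\<integral>\<^sup>+x. ennreal (indicator A x * g x) \<partial>M)"
      using integrable_indicator_mult_bounded[OF A gm g0 gC] g0
      by (intro nn_integral_eq_integral[symmetric]) auto
    also have "\<dots> = (\<integral>\<^sup>+x. f x * indicator A x \<partial>M)"
      by (intro nn_integral_cong_AE, use AEf in eventually_elim) (auto simp: eg indicator_def min_def)
    also have "\<dots> = ennreal (J A)" by (rule f_int[OF A])
    finally have "(LINT x|M. indicator A x * g x) = J A"
      using integral_indicator_mult_bounds(2)[OF A gm g0 gC] J_nn[OF A] by simp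
    then show "(\<lambda>n. LINT x|M. indicator A x * u (k n) x) \<longlonglongrightarrow> (LINT x|M. indicator A x * g x)"
      using IJ[OF A] by (simp add: I_def)
  qed (rule k(1))
qed

text \<open>Because the \<open>u n\<close> are uniformly bounded, integration against them is an
  equicontinuous family of functionals on the integrable functions; convergence therefore passes
  from indicators to linear combinations and then to limits in mean.\<close>

lemma tendsto_integral_mult_of_indicator:
  fixes u :: "nat \<Rightarrow> 'a \<Rightarrow> real"
  assumes meas: "\<And>n. u n \<in> borel_measurable M" "g \<in> borel_measurable M"
    and bd: "\<And>n x. \<bar>u n x\<bar> \<le> C" "\<And>x. \<bar>g x\<bar> \<le> C"
    and lim: "\<And>A. A \<in> sets M \<Longrightarrow> emeasure M A < \<infinity> \<Longrightarrow>
       (\<lambda>n. LINT x|M. indicator A x * u n x) \<longlonglongrightarrow> (LINT x|M. indicator A x * g x)"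
    and f: "integrable M f"
  shows "(\<lambda>n. LINT x|M. f x * u n x) \<longlonglongrightarrow> (LINT x|M. f x * g x)"
proof -
  have C0: "0 \<le> C" using bd order_trans abs_ge_zero by blast
  have int: "integrable M (\<lambda>x. h x * v x)" 
    if "integrable M h" "v \<in> borel_measurable M" "\<And>x. \<bar>v x\<bar> \<le> C" for h v :: "'a \<Rightarrow> real"
    using that(1) by (rule Bochner_Integration.integrable_bound[OF integrable_mult_left[of C M h]])
      (use that C0 in \<open>auto simp: abs_mult intro!: mult_left_mono\<close>)
  show ?thesis using f
  proof (induction f rule: integrable_induct)
    case (base A c)
    have "(\<lambda>n. c * (LINT x|M. indicator A x * u n x)) \<longlonglongrightarrow> c * (LINT x|M. indicator A x * g x)"
      by (intro tendsto_mult_left lim base)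
    then show ?case by (simp add: ac_simps flip: integral_mult_right_zero)
  next
    case (add f h)
    then show ?case using meas bd
      by (simp add: distrib_right int tendsto_add)
  next
    case (lim f s)
    \<comment> \<open>\<open>integrable_induct\<close> supplies
      \<open>\<bar>s i x\<bar> \<le> 2 * \<bar>f x\<bar>\<close>, whence the factor 3 in the
      majorant.\<close>
    have dom: "(\<lambda>i. LINT x|M. \<bar>s i x - f x\<bar>) \<longlonglongrightarrow> (LINT x|M. 0)"
    proof (rule integral_dominated_convergence[where w="\<lambda>x. 3 * \<bar>f x\<bar>"])
      show "AE x in M. (\<lambda>i. \<bar>s i x - f x\<bar>) \<longlonglongrightarrow> 0"
        using lim.hyps(2) by (intro AE_I2 tendsto_rabs_zero LIM_zero) auto
      show "AE x in M. norm \<bar>s i x - f x\<bar> \<le> 3 * \<bar>f x\<bar>" for i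
      proof (rule AE_I2)
        fix x assume "x \<in> space M"
        from lim.hyps(3)[OF this, of i] show "norm \<bar>s i x - f x\<bar> \<le> 3 * \<bar>f x\<bar>" by simp
      qed
    qed (use lim in \<open>auto\<close>)
    have close: "\<bar>(LINT x|M. s i x * v x) - (LINT x|M. f x * v x)\<bar> \<le> C * (LINT x|M. \<bar>s i x - f x\<bar>)"
      if "v \<in> borel_measurable M" "\<And>x. \<bar>v x\<bar> \<le> C" for v :: "'a \<Rightarrow> real" and i
    proof -
      have "(LINT x|M. s i x * v x) - (LINT x|M. f x * v x) = (LINT x|M. (s i x - f x) * v x)"
        using lim int that by (simp add: left_diff_distrib)
      also have "\<bar>\<dots>\<bar> \<le> (LINT x|M. \<bar>(s i x - f x) * v x\<bar>)" by (rule integral_abs_bound)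
      also have "\<dots> \<le> (LINT x|M. C * \<bar>s i x - f x\<bar>)"
        using lim int that C0 by (intro integral_mono)
          (auto simp: abs_mult mult.commute[of C] intro!: mult_left_mono integrable_abs integrable_mult_right)
      finally show ?thesis by simp
    qed
    show ?case
    proof (rule LIMSEQ_I)
      fix e :: real assume e: "e > 0"
      have "(\<lambda>i. C * (LINT x|M. \<bar>s i x - f x\<bar>)) \<longlonglongrightarrow> C * 0"
        using dom by (intro tendsto_mult_left) simp
      from LIMSEQ_D[OF this, of "e/3"] e
      obtain i where "\<forall>j\<ge>i. norm (C * (LINT x|M. \<bar>s j x - f x\<bar>) - C * 0) < e/3" by auto
      then have i: "C * (LINT x|M. \<bar>s i x - f x\<bar>) < e/3"
        by (drule_tac spec[of _ i]) (simp add: abs_less_iff)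
      obtain n0 where n0: "\<And>n. n \<ge> n0 \<Longrightarrow> \<bar>(LINT x|M. s i x * u n x) - (LINT x|M. s i x * g x)\<bar> < e/3"
        using LIMSEQ_D[OF lim.IH[of i], of "e/3"] e by auto
      show "\<exists>no. \<forall>n\<ge>no. norm ((LINT x|M. f x * u n x) - (LINT x|M. f x * g x)) < e"
      proof (intro exI[of _ n0] allI impI)
        fix n assume "n \<ge> n0"
        then show "norm ((LINT x|M. f x * u n x) - (LINT x|M. f x * g x)) < e"
          using i n0[of n] close[of "u n" i, OF meas(1) bd(1)] close[of g i, OF meas(2) bd(2)]
          unfolding real_norm_def by linarith
      qed
    qed
  qed
qed

text \<open>Lebesgue measure is infinite and the bound \<open>w\<close> varies, so the finite case
  is applied to the measure with a positive integrable density \<open>f\<close> and to the functions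
  \<open>u n / w + 1\<close>, which take values in \<open>[0, 2]\<close>. A test function
  \<open>\<eta>\<close> becomes \<open>w * \<eta> / f\<close>.\<close>

lemma weak_star_compact:
  fixes u :: "nat \<Rightarrow> 'a::euclidean_space \<Rightarrow> real"
  assumes u: "\<And>n. u n \<in> borel_measurable borel" and w: "w \<in> borel_measurable borel"
    and w0: "\<And>x. 0 < w x" and uw: "\<And>n x. \<bar>u n x\<bar> \<le> w x"
  obtains k g where "strict_mono (k::nat \<Rightarrow> nat)" "g \<in> borel_measurable borel" "\<And>x. \<bar>g x\<bar> \<le> w x"
    "\<And>\<eta>. \<eta> \<in> borel_measurable borel \<Longrightarrow> integrable lborel (\<lambda>x. w x * \<eta> x) \<Longrightarrow>
       (\<lambda>n. LINT x|lborel. u (k n) x * \<eta> x) \<longlonglongrightarrow> (LINT x|lborel. g x * \<eta> x)"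
proof -
  obtain f :: "'a \<Rightarrow> real" where f: "f \<in> borel_measurable lborel" "\<And>x. f x > 0" "integrable lborel f"
    by (rule sigma_finite_measure.obtain_positive_integrable_function[OF sigma_finite_lborel]) blast
  define M where "M = density lborel f"
  have fin: "finite_measure M"
  proof (rule finite_measureI)
    have "emeasure M (space M) = (\<integral>\<^sup>+x. ennreal (f x) \<partial>lborel)"
      unfolding M_def using f(1) by (simp add: emeasure_density)
    also have "\<dots> = ennreal (LINT x|lborel. f x)"
      using f(2,3) by (intro nn_integral_eq_integral) (auto intro: less_imp_le)
    finally show "emeasure M (space M) \<noteq> \<infinity>" by simp
  qed
  have setsM: "sets M = sets borel" by (simp add: M_def)
  have measM: "borel_measurable M = (borel_measurable borel :: ('a \<Rightarrow> real) set)"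
    by (intro measurable_cong_sets setsM) simp
  define u' where "u' n x = u n x / w x + 1" for n x
  have u'_bd: "0 \<le> u' n x" "u' n x \<le> 2" for n x
    using uw[of n x] w0[of x] by (auto simp: u'_def field_simps abs_le_iff)
  have u'_meas: "u' n \<in> borel_measurable M" for n
    unfolding measM u'_def using u[of n] w by measurable
  obtain k g where kg: "strict_mono (k::nat \<Rightarrow> nat)" "g \<in> borel_measurable M" "\<And>x. 0 \<le> g x" "\<And>x. g x \<le> 2"
    "\<And>A. A \<in> sets M \<Longrightarrow>
       (\<lambda>n. LINT x|M. indicator A x * u' (k n) x) \<longlonglongrightarrow> (LINT x|M. indicator A x * g x)"
    by (rule weak_star_compact_finite[of M u' 2, OF fin setsM u'_meas u'_bd]) blast
  have gb: "g \<in> borel_measurable borel" using kg(2) measM by simp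
  show ?thesis
  proof (rule that[of k "\<lambda>x. (g x - 1) * w x"])
    show "(\<lambda>x. (g x - 1) * w x) \<in> borel_measurable borel" using gb w by measurable
    show "\<bar>(g x - 1) * w x\<bar> \<le> w x" for x
      using kg(3,4)[of x] w0[of x] mult_right_mono[of "\<bar>g x - 1\<bar>" 1 "w x"] by (auto simp: abs_mult)
    fix \<eta> :: "'a \<Rightarrow> real"
    assume \<eta>: "\<eta> \<in> borel_measurable borel" and int: "integrable lborel (\<lambda>x. w x * \<eta> x)"
    define \<xi> where "\<xi> x = w x * \<eta> x / f x" for x
    have \<xi>m: "\<xi> \<in> borel_measurable borel"
      unfolding \<xi>_def using f(1) by (intro borel_measurable_divide borel_measurable_times w \<eta>) simp
    have f\<xi>: "f x * \<xi> x = w x * \<eta> x" for x using f(2)[of x] by (simp add: \<xi>_def)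
    have "integrable M \<xi> \<longleftrightarrow> integrable lborel (\<lambda>x. f x *\<^sub>R \<xi> x)"
      unfolding M_def using f \<xi>m by (intro integrable_density) (auto intro: less_imp_le)
    then have intM: "integrable M \<xi>" using int by (simp add: f\<xi>)
    have lim: "(\<lambda>n. LINT x|M. \<xi> x * u' (k n) x) \<longlonglongrightarrow> (LINT x|M. \<xi> x * g x)"
    proof (rule tendsto_integral_mult_of_indicator[where C=2])
      show "\<bar>u' (k n) x\<bar> \<le> 2" "\<bar>g x\<bar> \<le> 2" for n x
        using u'_bd[where n="k n" and x=x] kg(3,4)[of x] by (auto simp only: abs_of_nonneg)
    qed (use kg(2,5) u'_meas intM in blast)+
    \<comment> \<open>Undoing the shift by 1 leaves the fixed integral of \<open>w * \<eta>\<close>,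
      which is subtracted from both sides at the end.\<close>
    have tr: "(LINT x|M. \<xi> x * v x) = (LINT x|lborel. (v x - 1) * w x * \<eta> x) + (LINT x|lborel. w x * \<eta> x)"
      if v: "v \<in> borel_measurable borel" "\<And>x. 0 \<le> v x" "\<And>x. v x \<le> 2" for v
    proof -
      have "(LINT x|M. \<xi> x * v x) = (LINT x|lborel. f x * (\<xi> x * v x))"
        unfolding M_def using f \<xi>m v integral_density[of "\<lambda>x. \<xi> x * v x" lborel f] by (simp add: less_imp_le)
      also have "\<dots> = (LINT x|lborel. (v x - 1) * w x * \<eta> x + w x * \<eta> x)"
      proof (intro Bochner_Integration.integral_cong refl)
        fix x
        have "f x * (\<xi> x * v x) = (f x * \<xi> x) * v x" by simp
        also have "\<dots> = (v x - 1) * w x * \<eta> x + w x * \<eta> x" unfolding f\<xi> by (simp add: algebra_simps)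
        finally show "f x * (\<xi> x * v x) = (v x - 1) * w x * \<eta> x + w x * \<eta> x" .
      qed
      also have "\<dots> = (LINT x|lborel. (v x - 1) * w x * \<eta> x) + (LINT x|lborel. w x * \<eta> x)"
      proof (rule Bochner_Integration.integral_add[OF _ int])
        show "integrable lborel (\<lambda>x. (v x - 1) * w x * \<eta> x)"
        proof (rule Bochner_Integration.integrable_bound[OF int])
          show "(\<lambda>x. (v x - 1) * w x * \<eta> x) \<in> borel_measurable lborel" using v w \<eta> by simp
          have "\<bar>v x - 1\<bar> * \<bar>w x * \<eta> x\<bar> \<le> 1 * \<bar>w x * \<eta> x\<bar>" for x
            using v(2,3)[of x] by (intro mult_right_mono) auto
          then show "AE x in lborel. norm ((v x - 1) * w x * \<eta> x) \<le> norm (w x * \<eta> x)"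
            by (simp add: abs_mult mult.assoc)
        qed
      qed
      finally show ?thesis .
    qed
    have "(u' n x - 1) * w x = u n x" for n x using w0[of x] by (simp add: u'_def)
    then have "(LINT x|M. \<xi> x * u' (k n) x) - (LINT x|lborel. w x * \<eta> x) = (LINT x|lborel. u (k n) x * \<eta> x)" for n
      using tr[OF u'_meas[unfolded measM] u'_bd, of "k n"] by simp
    with tendsto_diff[OF lim tendsto_const, of "LINT x|lborel. w x * \<eta> x"]
    show "(\<lambda>n. LINT x|lborel. u (k n) x * \<eta> x) \<longlonglongrightarrow> (LINT x|lborel. (g x - 1) * w x * \<eta> x)"
      unfolding tr[OF gb kg(3,4)] by simp
  qed (rule kg(1))
qed

section \<open>Test functions and their difference quotients\<close>

text \<open>The derivative is quantified existentially instead of being fixed as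
  \<open>deriv\<close>, so sums, products and compositions can exhibit it in closed form during the
  induction.\<close>

fun smooth_upto :: "nat \<Rightarrow> (real \<Rightarrow> real) \<Rightarrow> bool" where
  "smooth_upto 0 f \<longleftrightarrow> continuous_on UNIV f"
| "smooth_upto (Suc k) f \<longleftrightarrow>
     (\<exists>f'. (\<forall>t. (f has_real_derivative f' t) (at t)) \<and> smooth_upto k f')"

lemma smooth_upto_SucI:
  "(\<And>t. (f has_real_derivative f' t) (at t)) \<Longrightarrow> smooth_upto k f' \<Longrightarrow> smooth_upto (Suc k) f"
  by auto

lemma smooth_upto_continuous: "smooth_upto k f \<Longrightarrow> continuous_on UNIV f"
  by (cases k) (auto intro: continuous_at_imp_continuous_on DERIV_isCont)

lemma smooth_upto_Suc: "smooth_upto (Suc k) f \<Longrightarrow> smooth_upto k f"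
proof (induction k arbitrary: f)
  case 0
  then show ?case using smooth_upto_continuous[of "Suc 0" f] by simp
next
  case (Suc k)
  then show ?case using smooth_upto.simps(2) by metis
qed

lemma smooth_upto_add: "smooth_upto k f \<Longrightarrow> smooth_upto k g \<Longrightarrow> smooth_upto k (\<lambda>t. f t + g t)"
proof (induction k arbitrary: f g)
  case 0
  then show ?case by (auto intro: continuous_on_add)
next
  case (Suc k)
  from Suc.prems obtain f' g' where *: "\<And>t. (f has_real_derivative f' t) (at t)" "smooth_upto k f'"
    "\<And>t. (g has_real_derivative g' t) (at t)" "smooth_upto k g'" by auto
  have "smooth_upto k (\<lambda>t. f' t + g' t)" using Suc.IH * by blast
  then show ?case using * by (auto intro!: exI[of _ "\<lambda>t. f' t + g' t"] DERIV_add)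
qed

lemma smooth_upto_mult: "smooth_upto k f \<Longrightarrow> smooth_upto k g \<Longrightarrow> smooth_upto k (\<lambda>t. f t * g t)"
proof (induction k arbitrary: f g)
  case 0
  then show ?case by (auto intro: continuous_on_mult)
next
  case (Suc k)
  from Suc.prems obtain f' g' where *: "\<And>t. (f has_real_derivative f' t) (at t)" "smooth_upto k f'"
    "\<And>t. (g has_real_derivative g' t) (at t)" "smooth_upto k g'" by auto
  have "smooth_upto k (\<lambda>t. f' t * g t + g' t * f t)" 
    using Suc.IH * Suc.prems smooth_upto_Suc by (intro smooth_upto_add) blast+
  moreover have "((\<lambda>t. f t * g t) has_real_derivative (f' t * g t + g' t * f t)) (at t)" for t
    by (rule DERIV_mult[OF *(1,3)])
  ultimately show ?case by (intro smooth_upto_SucI)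
qed

lemma smooth_upto_const: "smooth_upto k (\<lambda>t. c)"
  by (induction k arbitrary: c) (auto intro!: exI[of _ "\<lambda>_. 0"])

lemma smooth_upto_affine: "smooth_upto k f \<Longrightarrow> smooth_upto k (\<lambda>t. f (c * t + d))"
proof (induction k arbitrary: f)
  case 0
  then have "continuous_on UNIV f" by simp
  then show ?case by (auto intro!: continuous_intros continuous_on_compose2[of UNIV f])
next
  case (Suc k)
  from Suc.prems obtain f' where *: "\<And>t. (f has_real_derivative f' t) (at t)" "smooth_upto k f'" by auto
  have "smooth_upto k (\<lambda>t. c * f' (c * t + d))" 
    by (intro smooth_upto_mult smooth_upto_const Suc.IH *)
  moreover have "((\<lambda>t. f (c * t + d)) has_real_derivative (c * f' (c * t + d))) (at t)" for t
  proof -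
    have "((\<lambda>t. c * t + d) has_real_derivative c) (at t)" by (auto intro!: derivative_eq_intros)
    from DERIV_chain2[OF *(1) this] show ?thesis by (simp add: mult.commute)
  qed
  ultimately show ?case by (intro smooth_upto_SucI)
qed

text \<open>Partial derivatives of a product of one-variable functions are again such products, so
  \<open>Ck\<close> reduces to smoothness in one variable.\<close>

lemma Ck_tensor:
  "smooth_upto k f \<Longrightarrow> smooth_upto k g \<Longrightarrow> Ck k (\<lambda>(\<tau>, x). f \<tau> * g x)"
proof (induction k arbitrary: f g)
  case 0
  then have "continuous_on UNIV f" "continuous_on UNIV g" by auto
  then show ?case
    by (auto simp: case_prod_beta intro!: continuous_intros continuous_on_compose2[of UNIV f] continuous_on_compose2[of UNIV g])
next
  case (Suc k)
  from Suc.prems obtain f' g' where *: "\<And>t. (f has_real_derivative f' t) (at t)" "smooth_upto k f'"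
    "\<And>t. (g has_real_derivative g' t) (at t)" "smooth_upto k g'" by auto
  have cont: "continuous_on UNIV f" "continuous_on UNIV g"
    using Suc.prems smooth_upto_continuous by blast+
  have dt: "dt (\<lambda>(\<tau>, x). f \<tau> * g x) = (\<lambda>(\<tau>, x). f' \<tau> * g x)"
    unfolding dt_def by (auto simp: fun_eq_iff intro!: DERIV_imp_deriv DERIV_cmult_right *)
  have dx: "dx (\<lambda>(\<tau>, x). f \<tau> * g x) = (\<lambda>(\<tau>, x). f \<tau> * g' x)"
    unfolding dx_def by (auto simp: fun_eq_iff intro!: DERIV_imp_deriv DERIV_cmult *)
  have "(\<lambda>s. f s * g x) differentiable at \<tau>" "(\<lambda>y. f \<tau> * g y) differentiable at x" for \<tau> x
    unfolding real_differentiable_def using DERIV_cmult_right[OF *(1)] DERIV_cmult[OF *(3)] by blast+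
  moreover have "continuous_on UNIV (\<lambda>(\<tau>, x). f \<tau> * g x)"
    using cont by (auto simp: case_prod_beta intro!: continuous_intros continuous_on_compose2[of UNIV f] continuous_on_compose2[of UNIV g])
  moreover have "Ck k (\<lambda>(\<tau>, x). f' \<tau> * g x)" "Ck k (\<lambda>(\<tau>, x). f \<tau> * g' x)"
    using Suc.IH * Suc.prems smooth_upto_Suc by blast+
  ultimately show ?case by (simp add: dt dx)
qed

text \<open>The parameter \<open>m\<close> is there because the derivative is a combination of
  members with larger \<open>m\<close>: smoothness becomes an induction over the whole family, with
  \<open>exp (- 1 / t)\<close> as the member \<open>m = 0\<close>.\<close>

definition flat_exp :: "nat \<Rightarrow> real \<Rightarrow> real" where
  "flat_exp m t = (if t > 0 then inverse t ^ m / exp (inverse t) else 0)"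

lemma flat_exp_has_derivative:
  "(flat_exp m has_real_derivative (flat_exp (m + 2) t - m * flat_exp (m + 1) t)) (at t)"
proof (cases "t = 0")
  case True
  have "((\<lambda>h. (flat_exp m h - flat_exp m 0) / h) \<longlongrightarrow> 0) (at 0)"
  proof (rule filterlim_split_at)
    show "((\<lambda>h. (flat_exp m h - flat_exp m 0) / h) \<longlongrightarrow> 0) (at_left 0)"
      by (rule tendsto_eventually) (auto simp: eventually_at_filter flat_exp_def)
    \<comment> \<open>At 0 the right difference quotient of \<open>flat_exp m\<close> is
      \<open>flat_exp (m + 1)\<close>, and the exponential beats every power.\<close>
    have "((\<lambda>h. inverse h ^ (m + 1) / exp (inverse h)) \<longlongrightarrow> (0::real)) (at_right 0)"
      by (rule filterlim_compose[OF tendsto_power_div_exp_0 filterlim_inverse_at_top_right])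
    then show "((\<lambda>h. (flat_exp m h - flat_exp m 0) / h) \<longlongrightarrow> 0) (at_right 0)"
      by (rule Lim_transform_eventually)
        (auto simp: eventually_at_filter flat_exp_def field_simps)
  qed
  then show ?thesis using True by (simp add: DERIV_def flat_exp_def)
next
  case False
  then consider "t > 0" | "t < 0" by linarith
  then show ?thesis
  proof cases
    case 1
    have "((\<lambda>t. inverse t ^ m / exp (inverse t)) has_real_derivative
        (flat_exp (m + 2) t - m * flat_exp (m + 1) t)) (at t)"
    proof -
      have "((\<lambda>t. inverse t ^ m * exp (- inverse t)) has_real_derivative
         (inverse t ^ (m + 2) * exp (- inverse t) - m * inverse t ^ (m + 1) * exp (- inverse t))) (at t)"
      proof -
        have i: "(inverse has_real_derivative - (inverse t ^ 2)) (at t)"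
          using 1 DERIV_inverse[of t] by (simp add: numeral_2_eq_2)
        have "((\<lambda>t. inverse t ^ m) has_real_derivative (of_nat m * (- (inverse t ^ 2) * inverse t ^ (m - Suc 0)))) (at t)"
          by (rule DERIV_power[OF i])
        moreover have "((\<lambda>t. exp (- inverse t)) has_real_derivative exp (- inverse t) * inverse t ^ 2) (at t)"
          using DERIV_fun_exp[OF DERIV_minus[OF i]] by simp
        ultimately have "((\<lambda>t. inverse t ^ m * exp (- inverse t)) has_real_derivative
            of_nat m * (- (inverse t ^ 2) * inverse t ^ (m - Suc 0)) * exp (- inverse t)
              + exp (- inverse t) * inverse t ^ 2 * inverse t ^ m) (at t)"
          by (rule DERIV_mult)
        moreover have "of_nat m * (inverse t ^ 2 * inverse t ^ (m - Suc 0)) = m * inverse t ^ (m + 1)"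
          by (cases m) (auto simp: power2_eq_square)
        ultimately show ?thesis by (cases m) (auto simp: algebra_simps power2_eq_square)
      qed
      then show ?thesis using 1 by (simp add: flat_exp_def exp_minus field_simps)
    qed
    then show ?thesis
      by (rule has_field_derivative_transform_within_open[where S="{0<..}"]) (use 1 in \<open>auto simp: flat_exp_def\<close>)
  next
    case 2
    have "((\<lambda>t. 0) has_real_derivative (flat_exp (m + 2) t - m * flat_exp (m + 1) t)) (at t)"
      using 2 by (simp add: flat_exp_def)
    then show ?thesis
      by (rule has_field_derivative_transform_within_open[where S="{..<0}"]) (use 2 in \<open>auto simp: flat_exp_def\<close>)
  qed
qed

lemma smooth_upto_flat_exp: "smooth_upto k (flat_exp m)"
proof (induction k arbitrary: m)
  case 0
  then show ?case by (auto intro!: continuous_at_imp_continuous_on DERIV_isCont flat_exp_has_derivative)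
next
  case (Suc k)
  have "smooth_upto k (\<lambda>t. flat_exp (m + 2) t + (- real m) * flat_exp (m + 1) t)"
    by (intro smooth_upto_add smooth_upto_mult smooth_upto_const Suc.IH)
  then show ?case
    using flat_exp_has_derivative[of m] by (intro smooth_upto_SucI) auto
qed

definition bump :: "real \<Rightarrow> real" where
  "bump t = flat_exp 0 (1 + t) * flat_exp 0 (1 - t)"

lemma smooth_upto_bump: "smooth_upto k bump"
  using smooth_upto_mult[OF smooth_upto_affine[OF smooth_upto_flat_exp, of k 0 1 1] 
      smooth_upto_affine[OF smooth_upto_flat_exp, of k 0 "-1" 1]]
  by (simp add: bump_def[abs_def] add.commute)

lemma bump_nonneg: "0 \<le> bump t" by (simp add: bump_def flat_exp_def)
lemma bump_pos: "\<bar>t\<bar> < 1 \<Longrightarrow> 0 < bump t" by (simp add: bump_def flat_exp_def)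
lemma bump_zero: "1 \<le> \<bar>t\<bar> \<Longrightarrow> bump t = 0" by (auto simp: bump_def flat_exp_def)

text \<open>Not normalised: the integral depends on \<open>\<epsilon>\<close> but not on the centre
  \<open>z\<close>, and the comparison argument carries it along as a positive factor. The support
  lies in the square of half-side \<open>\<epsilon>\<close> around \<open>z\<close>.\<close>

definition mollifier :: "real \<Rightarrow> real \<times> real \<Rightarrow> real \<times> real \<Rightarrow> real" where
  "mollifier \<epsilon> z = (\<lambda>(s, y). bump ((s - fst z) / \<epsilon>) * bump ((y - snd z) / \<epsilon>))"

lemma Ck_mollifier: "Ck k (mollifier \<epsilon> z)"
proof -
  have "smooth_upto k (\<lambda>s. bump ((s - c) / \<epsilon>))" for c
    using smooth_upto_affine[OF smooth_upto_bump, of k "1 / \<epsilon>" "- c / \<epsilon>"]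
    by (simp add: diff_divide_distrib)
  then show ?thesis unfolding mollifier_def by (intro Ck_tensor)
qed

lemma mollifier_nonneg: "0 \<le> mollifier \<epsilon> z y"
  by (auto simp: mollifier_def bump_nonneg split: prod.split)

lemma mollifier_nonzero_dist:
  assumes "\<epsilon> > 0" "mollifier \<epsilon> z y \<noteq> 0"
  shows "y \<in> box (z - (\<epsilon>, \<epsilon>)) (z + (\<epsilon>, \<epsilon>))"
proof -
  have "bump ((fst y - fst z) / \<epsilon>) \<noteq> 0" "bump ((snd y - snd z) / \<epsilon>) \<noteq> 0"
    using assms by (auto simp: mollifier_def case_prod_beta)
  then have "\<bar>(fst y - fst z) / \<epsilon>\<bar> < 1" "\<bar>(snd y - snd z) / \<epsilon>\<bar> < 1"
    using bump_zero by (meson not_le)+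
  then show ?thesis using assms(1)
    by (auto simp: box_def Basis_prod_def inner_prod_def abs_less_iff field_simps)
qed

lemma mollifier_test_function:
  assumes "\<epsilon> > 0" "cbox (z - (\<epsilon>, \<epsilon>)) (z + (\<epsilon>, \<epsilon>)) \<subseteq> D"
  shows "mollifier \<epsilon> z \<in> test_functions D"
proof -
  have "{y. mollifier \<epsilon> z y \<noteq> 0} \<subseteq> cbox (z - (\<epsilon>, \<epsilon>)) (z + (\<epsilon>, \<epsilon>))"
    using mollifier_nonzero_dist[OF assms(1)] box_subset_cbox by blast
  moreover from this have "closure {y. mollifier \<epsilon> z y \<noteq> 0} \<subseteq> cbox (z - (\<epsilon>, \<epsilon>)) (z + (\<epsilon>, \<epsilon>))"
    by (intro closure_minimal closed_cbox)
  moreover have "bounded {y. mollifier \<epsilon> z y \<noteq> 0}"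
    by (rule bounded_subset[OF bounded_cbox]) fact
  ultimately show ?thesis using assms(2) Ck_mollifier unfolding test_functions_def
    by (auto simp: compact_closure)
qed


section \<open>Regularity and support of test functions\<close>

lemma
  assumes "\<eta> \<in> test_functions D"
  shows test_function_continuous: "continuous_on UNIV \<eta>"
    and test_function_dt: "\<And>\<tau> x. ((\<lambda>s. \<eta> (s, x)) has_real_derivative dt \<eta> (\<tau>, x)) (at \<tau>)"
    and test_function_dx: "\<And>\<tau> x. ((\<lambda>y. \<eta> (\<tau>, y)) has_real_derivative dx \<eta> (\<tau>, x)) (at x)"
    and test_function_Ck: "Ck k \<eta>"
proof -
  have C: "Ck k \<eta>" for k using assms by (auto simp: test_functions_def)
  then show "Ck k \<eta>" .
  show "continuous_on UNIV \<eta>" using C[of 0] by simp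
  have "(\<lambda>s. \<eta> (s, x)) differentiable at \<tau>" "(\<lambda>y. \<eta> (\<tau>, y)) differentiable at x" for \<tau> x
    using C[of "Suc 0"] by auto
  then show "((\<lambda>s. \<eta> (s, x)) has_real_derivative dt \<eta> (\<tau>, x)) (at \<tau>)"
    "((\<lambda>y. \<eta> (\<tau>, y)) has_real_derivative dx \<eta> (\<tau>, x)) (at x)" for \<tau> x
    by (auto simp: dt_def dx_def DERIV_deriv_iff_real_differentiable)
qed

lemma dt_zero_outside:
  assumes "open S" "z \<in> S" "\<And>z. z \<in> S \<Longrightarrow> \<eta> z = 0"
  shows "dt \<eta> z = 0"
proof -
  obtain \<tau> x where z: "z = (\<tau>, x)" by fastforce
  have "open ((\<lambda>s. (s, x)) -` S)" using assms(1) by (intro open_vimage continuous_intros)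
  then have "((\<lambda>s. \<eta> (s, x)) has_real_derivative 0) (at \<tau>)"
    using assms z by (intro has_field_derivative_transform_within_open[OF DERIV_const]) auto
  then show ?thesis by (simp add: dt_def z DERIV_imp_deriv)
qed

lemma dx_zero_outside:
  assumes "open S" "z \<in> S" "\<And>z. z \<in> S \<Longrightarrow> \<eta> z = 0"
  shows "dx \<eta> z = 0"
proof -
  obtain \<tau> x where z: "z = (\<tau>, x)" by fastforce
  have "open ((\<lambda>y. (\<tau>, y)) -` S)" using assms(1) by (intro open_vimage continuous_intros)
  then have "((\<lambda>y. \<eta> (\<tau>, y)) has_real_derivative 0) (at x)"
    using assms z by (intro has_field_derivative_transform_within_open[OF DERIV_const]) auto
  then show ?thesis by (simp add: dx_def z DERIV_imp_deriv)
qed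

lemma test_function_support:
  assumes "\<eta> \<in> test_functions D"
  obtains K where "compact K" "K \<subseteq> D" 
    "\<And>z. z \<notin> K \<Longrightarrow> \<eta> z = 0 \<and> dt \<eta> z = 0 \<and> dx \<eta> z = 0 \<and> dx (dx \<eta>) z = 0"
proof -
  define K where "K = closure {z. \<eta> z \<noteq> 0}"
  have K: "compact K" "K \<subseteq> D" using assms by (auto simp: test_functions_def K_def)
  have op: "open (- K)" unfolding K_def by (rule open_Compl) simp
  have 0: "\<eta> z = 0" if "z \<in> - K" for z
    using that closure_subset[of "{z. \<eta> z \<noteq> 0}"] by (auto simp: K_def)
  have dx: "dx \<eta> z = 0" if "z \<in> - K" for z using dx_zero_outside[OF op that] 0 by blast
  have "dt \<eta> z = 0" if "z \<in> - K" for z using dt_zero_outside[OF op that] 0 by blast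
  moreover have "dx (dx \<eta>) z = 0" if "z \<in> - K" for z using dx_zero_outside[OF op that] dx by blast
  ultimately show ?thesis using that K 0 dx by (meson ComplI)
qed

lemma continuous_compact_support_bounded:
  fixes f :: "'a::topological_space \<Rightarrow> real"
  assumes "continuous_on UNIV f" "compact K" "\<And>z. z \<notin> K \<Longrightarrow> f z = 0"
  obtains Q where "0 < Q" "\<And>z. \<bar>f z\<bar> \<le> Q"
proof -
  have "compact (f ` K)" using assms by (intro compact_continuous_image) (auto intro: continuous_on_subset)
  then obtain Q where "0 < Q" "\<And>z. z \<in> K \<Longrightarrow> \<bar>f z\<bar> \<le> Q"
    using compact_imp_bounded bounded_pos by (metis image_eqI real_norm_def)
  then show ?thesis using that[of Q] assms(3) by (metis abs_zero less_imp_le)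
qed

text \<open>Taylor's formula at \<open>x + k\<close> and at \<open>x - k\<close>; the first-order
  terms cancel. The two intermediate points are kept apart, which spares an intermediate value
  argument for \<open>f2\<close>.\<close>

lemma symmetric_second_difference_bound:
  fixes f :: "real \<Rightarrow> real"
  assumes "\<And>t. (f has_real_derivative f1 t) (at t)" "\<And>t. (f1 has_real_derivative f2 t) (at t)"
  shows "\<exists>s s'. \<bar>s - x\<bar> \<le> \<bar>k\<bar> \<and> \<bar>s' - x\<bar> \<le> \<bar>k\<bar> \<and> f (x + k) - 2 * f x + f (x - k) = k\<^sup>2 / 2 * (f2 s + f2 s')"
proof -
  have one: "\<exists>s. \<bar>s - x\<bar> \<le> \<bar>k\<bar> \<and> f (x + k) = f x + k * f1 x + k\<^sup>2 / 2 * f2 s" for k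
  proof (cases "k = 0")
    case False
    define d where "d = (\<lambda>m::nat. if m = 0 then f else if m = 1 then f1 else f2)"
    have "\<exists>t. (if x + k < x then x + k < t \<and> t < x else x < t \<and> t < x + k) \<and>
        f (x + k) = (\<Sum>m<2. (d m x / fact m) * (x + k - x) ^ m) + (d 2 t / fact 2) * (x + k - x) ^ 2"
      using assms False
      by (intro Taylor[of 2 d f "x - \<bar>k\<bar>" "x + \<bar>k\<bar>"]) (auto simp: d_def less_2_cases_iff)
    then obtain t where t: "if x + k < x then x + k < t \<and> t < x else x < t \<and> t < x + k"
        "f (x + k) = (\<Sum>m<2. (d m x / fact m) * (x + k - x) ^ m) + (d 2 t / fact 2) * (x + k - x) ^ 2" by blast
    then show ?thesis by (intro exI[of _ t]) (auto simp: d_def numeral_2_eq_2 algebra_simps split: if_splits)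
  qed auto
  obtain s s' where "\<bar>s - x\<bar> \<le> \<bar>k\<bar>" "f (x + k) = f x + k * f1 x + k\<^sup>2 / 2 * f2 s"
     "\<bar>s' - x\<bar> \<le> \<bar>- k\<bar>" "f (x + - k) = f x + - k * f1 x + (- k)\<^sup>2 / 2 * f2 s'"
    using one by metis
  then show ?thesis by (intro exI[of _ s] exI[of _ s']) (auto simp: algebra_simps)
qed

text \<open>A discrete derivative \<open>q n\<close> of a test function, tested against bounded functions that
  converge only on the support.\<close>

lemma tendsto_integral_mult_quotient:
  fixes v :: "nat \<Rightarrow> real \<times> real \<Rightarrow> real"
  assumes v: "\<And>n. v n \<in> borel_measurable borel" "w \<in> borel_measurable borel"
    and vM: "\<And>n z. \<bar>v n z\<bar> \<le> M" and lim: "\<And>z. z \<in> K \<Longrightarrow> (\<lambda>n. v n z) \<longlonglongrightarrow> w z"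
    and q: "\<And>n. q n \<in> borel_measurable borel" "q' \<in> borel_measurable borel"
    and qQ: "\<And>n z. \<bar>q n z\<bar> \<le> Q * indicator (cbox c d) z" and qlim: "\<And>z. (\<lambda>n. q n z) \<longlonglongrightarrow> q' z"
    and q'0: "\<And>z. z \<notin> K \<Longrightarrow> q' z = 0"
  shows "(\<lambda>n. LINT z|lborel. v n z * q n z) \<longlonglongrightarrow> (LINT z|lborel. w z * q' z)"
proof (rule integral_dominated_convergence[where w="\<lambda>z. M * Q * indicator (cbox c d) z"])
  show "integrable lborel (\<lambda>z. M * Q * indicator (cbox c d) z)"
    using emeasure_lborel_cbox_finite[of c d] by (intro integrable_mult_right integrable_real_indicator) auto
  show "AE z in lborel. norm (v n z * q n z) \<le> M * Q * indicator (cbox c d) z" for n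
  proof (rule AE_I2)
    fix z
    have "\<bar>v n z\<bar> * \<bar>q n z\<bar> \<le> M * (Q * indicator (cbox c d) z)"
      using vM[of n z] qQ[of n z] by (intro mult_mono) auto
    then show "norm (v n z * q n z) \<le> M * Q * indicator (cbox c d) z" by (simp add: abs_mult mult.assoc)
  qed
  show "AE z in lborel. (\<lambda>n. v n z * q n z) \<longlonglongrightarrow> w z * q' z"
  proof (rule AE_I2)
    fix z
    show "(\<lambda>n. v n z * q n z) \<longlonglongrightarrow> w z * q' z"
    proof (cases "z \<in> K")
      case True
      then show ?thesis by (intro tendsto_mult lim qlim)
    next
      case False
      \<comment> \<open>Off \<open>K\<close> the sequence \<open>v n z\<close> may fail to converge;
        boundedness suffices there since \<open>q n z\<close> tends to 0.\<close>
      have "(\<lambda>n. v n z * q n z) \<longlonglongrightarrow> 0"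
      proof (rule Lim_null_comparison)
        show "\<forall>\<^sub>F n in sequentially. norm (v n z * q n z) \<le> M * \<bar>q n z\<bar>"
          using mult_right_mono[OF vM[of _ z] abs_ge_zero] by (intro always_eventually) (simp add: abs_mult)
        show "(\<lambda>n. M * \<bar>q n z\<bar>) \<longlonglongrightarrow> 0"
          using tendsto_mult_left[OF tendsto_rabs[OF qlim[of z]], of M] q'0[OF False] by simp
      qed
      then show ?thesis using q'0[OF False] by simp
    qed
  qed
qed (use v q in auto)

text \<open>With steps of length at most 1, the difference quotients of a test function are
  supported in one box for all \<open>n\<close>; this yields the integrable majorant.\<close>

lemma cbox_enlarge:
  fixes K :: "(real \<times> real) set"
  assumes "compact K"
  obtains c d where "\<And>z s y. z \<in> K \<Longrightarrow> \<bar>s\<bar> \<le> 1 \<Longrightarrow> \<bar>y\<bar> \<le> 1 \<Longrightarrow> z + (s, y) \<in> cbox c d"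
proof -
  obtain c d where "K \<subseteq> cbox c d" using bounded_subset_cbox_symmetric[OF compact_imp_bounded[OF assms]] by metis
  then have "z + (s, y) \<in> cbox (c - (1, 1)) (d + (1, 1))" if "z \<in> K" "\<bar>s\<bar> \<le> 1" "\<bar>y\<bar> \<le> 1" for z s y
    using that by (force simp: cbox_def Basis_prod_def inner_prod_def abs_le_iff)
  then show ?thesis using that by blast
qed

lemma tendsto_sequence_quotient:
  fixes f :: "real \<Rightarrow> real"
  assumes "(f has_real_derivative D) (at x)" "h \<longlonglongrightarrow> 0" "\<And>n::nat. h n \<noteq> 0"
  shows "(\<lambda>n. (f (x + h n) - f x) / h n) \<longlonglongrightarrow> D"
  using assms by (intro filterlim_compose[OF assms(1)[unfolded DERIV_def]]) (auto simp: filterlim_at)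

lemma quotient_bound:
  fixes f :: "real \<Rightarrow> real"
  assumes "\<And>t. (f has_real_derivative f' t) (at t)" "\<And>t. \<bar>f' t\<bar> \<le> Q"
  shows "\<bar>(f (x + h) - f x) / h\<bar> \<le> Q"
proof -
  have "norm (f (x + h) - f x) \<le> Q * norm (x + h - x)"
    using assms by (intro field_differentiable_bound[of UNIV f f']) auto
  then show ?thesis using assms(2)[of x] by (cases "h = 0") (auto simp: field_simps)
qed

text \<open>The steps may have either sign: summation by parts turns a forward quotient of the
  approximations into a backward quotient of the test function.\<close>

lemma test_quotient_dt:
  assumes \<eta>: "\<eta> \<in> test_functions D"
    and v: "\<And>n. v n \<in> borel_measurable borel" "w \<in> borel_measurable borel"
    and vM: "\<And>n z. \<bar>v n z\<bar> \<le> M" and lim: "\<And>z. z \<in> D \<Longrightarrow> (\<lambda>n. v n z) \<longlonglongrightarrow> w z"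
    and h: "h \<longlonglongrightarrow> 0" "\<And>n::nat. h n \<noteq> 0" "\<And>n. \<bar>h n\<bar> \<le> 1"
  shows "(\<lambda>n. LINT z|lborel. v n z * ((\<eta> (z + (h n, 0)) - \<eta> z) / h n)) \<longlonglongrightarrow> (LINT z|lborel. w z * dt \<eta> z)"
proof -
  obtain K where K: "compact K" "K \<subseteq> D" 
    "\<And>z. z \<notin> K \<Longrightarrow> \<eta> z = 0 \<and> dt \<eta> z = 0 \<and> dx \<eta> z = 0 \<and> dx (dx \<eta>) z = 0"
    using test_function_support[OF \<eta>] by blast
  obtain c d where cd: "\<And>z s y. z \<in> K \<Longrightarrow> \<bar>s\<bar> \<le> 1 \<Longrightarrow> \<bar>y\<bar> \<le> 1 \<Longrightarrow> z + (s, y) \<in> cbox c d"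
    using cbox_enlarge[OF K(1)] by metis
  have co: "continuous_on UNIV \<eta>" "continuous_on UNIV (dt \<eta>)"
    using test_function_Ck[OF \<eta>, of "Suc 0"] by auto
  obtain Q where Q: "0 < Q" "\<And>z. \<bar>dt \<eta> z\<bar> \<le> Q"
    using continuous_compact_support_bounded[OF co(2) K(1)] K(3) by metis
  have b: "\<eta> \<in> borel_measurable borel" "dt \<eta> \<in> borel_measurable borel"
    using co by (auto intro: borel_measurable_continuous_onI)
  show ?thesis
  proof (rule tendsto_integral_mult_quotient[where K=K, OF v vM, where Q=Q and c=c and d=d])
    fix n z
    have "\<bar>(\<eta> (z + (h n, 0)) - \<eta> z) / h n\<bar> \<le> Q"
      using quotient_bound[OF test_function_dt[OF \<eta>], of "snd z" Q "fst z" "h n"] Q by (cases z) auto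
    moreover have "\<eta> (z + (h n, 0)) = 0 \<and> \<eta> z = 0" if "z \<notin> cbox c d"
      using cd[of z 0 0] cd[of "z + (h n, 0)" "- h n" 0] h(3)[of n] that K(3) by (cases z) auto
    ultimately show "\<bar>(\<eta> (z + (h n, 0)) - \<eta> z) / h n\<bar> \<le> Q * indicator (cbox c d) z"
      by (auto simp: indicator_def)
  next
    fix z
    show "(\<lambda>n. (\<eta> (z + (h n, 0)) - \<eta> z) / h n) \<longlonglongrightarrow> dt \<eta> z"
      using tendsto_sequence_quotient[OF test_function_dt[OF \<eta>] h(1,2), of "fst z" "snd z"] by (cases z) auto
  qed (use K lim b in auto)
qed

lemma test_quotient_dx:
  assumes \<eta>: "\<eta> \<in> test_functions D"
    and v: "\<And>n. v n \<in> borel_measurable borel" "w \<in> borel_measurable borel"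
    and vM: "\<And>n z. \<bar>v n z\<bar> \<le> M" and lim: "\<And>z. z \<in> D \<Longrightarrow> (\<lambda>n. v n z) \<longlonglongrightarrow> w z"
    and h: "h \<longlonglongrightarrow> 0" "\<And>n::nat. h n \<noteq> 0" "\<And>n. \<bar>h n\<bar> \<le> 1"
  shows "(\<lambda>n. LINT z|lborel. v n z * ((\<eta> (z + (0, h n)) - \<eta> z) / h n)) \<longlonglongrightarrow> (LINT z|lborel. w z * dx \<eta> z)"
proof -
  obtain K where K: "compact K" "K \<subseteq> D" 
    "\<And>z. z \<notin> K \<Longrightarrow> \<eta> z = 0 \<and> dt \<eta> z = 0 \<and> dx \<eta> z = 0 \<and> dx (dx \<eta>) z = 0"
    using test_function_support[OF \<eta>] by blast
  obtain c d where cd: "\<And>z s y. z \<in> K \<Longrightarrow> \<bar>s\<bar> \<le> 1 \<Longrightarrow> \<bar>y\<bar> \<le> 1 \<Longrightarrow> z + (s, y) \<in> cbox c d"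
    using cbox_enlarge[OF K(1)] by metis
  have co: "continuous_on UNIV \<eta>" "continuous_on UNIV (dx \<eta>)"
    using test_function_Ck[OF \<eta>, of "Suc 0"] by auto
  obtain Q where Q: "0 < Q" "\<And>z. \<bar>dx \<eta> z\<bar> \<le> Q"
    using continuous_compact_support_bounded[OF co(2) K(1)] K(3) by metis
  have b: "\<eta> \<in> borel_measurable borel" "dx \<eta> \<in> borel_measurable borel"
    using co by (auto intro: borel_measurable_continuous_onI)
  show ?thesis
  proof (rule tendsto_integral_mult_quotient[where K=K, OF v vM, where Q=Q and c=c and d=d])
    fix n z
    have "\<bar>(\<eta> (z + (0, h n)) - \<eta> z) / h n\<bar> \<le> Q"
      using quotient_bound[OF test_function_dx[OF \<eta>], of "fst z" Q "snd z" "h n"] Q by (cases z) auto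
    moreover have "\<eta> (z + (0, h n)) = 0 \<and> \<eta> z = 0" if "z \<notin> cbox c d"
      using cd[of z 0 0] cd[of "z + (0, h n)" 0 "- h n"] h(3)[of n] that K(3) by (cases z) auto
    ultimately show "\<bar>(\<eta> (z + (0, h n)) - \<eta> z) / h n\<bar> \<le> Q * indicator (cbox c d) z"
      by (auto simp: indicator_def)
  next
    fix z
    show "(\<lambda>n. (\<eta> (z + (0, h n)) - \<eta> z) / h n) \<longlonglongrightarrow> dx \<eta> z"
      using tendsto_sequence_quotient[OF test_function_dx[OF \<eta>] h(1,2), of "fst z" "snd z"] by (cases z) auto
  qed (use K lim b in auto)
qed

lemma test_quotient_dxx:
  assumes \<eta>: "\<eta> \<in> test_functions D"
    and v: "\<And>n. v n \<in> borel_measurable borel" "w \<in> borel_measurable borel"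
    and vM: "\<And>n z. \<bar>v n z\<bar> \<le> M" and lim: "\<And>z. z \<in> D \<Longrightarrow> (\<lambda>n. v n z) \<longlonglongrightarrow> w z"
    and h: "h \<longlonglongrightarrow> 0" "\<And>n::nat. h n \<noteq> 0" "\<And>n. \<bar>h n\<bar> \<le> 1"
  shows "(\<lambda>n. LINT z|lborel. v n z * ((\<eta> (z + (0, h n)) - 2 * \<eta> z + \<eta> (z - (0, h n))) / (h n)\<^sup>2))
    \<longlonglongrightarrow> (LINT z|lborel. w z * dx (dx \<eta>) z)"
proof -
  obtain K where K: "compact K" "K \<subseteq> D" 
    "\<And>z. z \<notin> K \<Longrightarrow> \<eta> z = 0 \<and> dt \<eta> z = 0 \<and> dx \<eta> z = 0 \<and> dx (dx \<eta>) z = 0"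
    using test_function_support[OF \<eta>] by blast
  obtain c d where cd: "\<And>z s y. z \<in> K \<Longrightarrow> \<bar>s\<bar> \<le> 1 \<Longrightarrow> \<bar>y\<bar> \<le> 1 \<Longrightarrow> z + (s, y) \<in> cbox c d"
    using cbox_enlarge[OF K(1)] by metis
  have co: "continuous_on UNIV \<eta>" "continuous_on UNIV (dx (dx \<eta>))"
    and d2: "((\<lambda>y. dx \<eta> (\<tau>, y)) has_real_derivative dx (dx \<eta>) (\<tau>, x)) (at x)" for \<tau> x
    using test_function_Ck[OF \<eta>, of "Suc (Suc 0)"]
    by (auto simp: dx_def DERIV_deriv_iff_real_differentiable)
  note second = symmetric_second_difference_bound[OF test_function_dx[OF \<eta>] d2]
  obtain Q where Q: "0 < Q" "\<And>z. \<bar>dx (dx \<eta>) z\<bar> \<le> Q"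
    using continuous_compact_support_bounded[OF co(2) K(1)] K(3) by metis
  have b: "\<eta> \<in> borel_measurable borel" "dx (dx \<eta>) \<in> borel_measurable borel"
    using co by (auto intro: borel_measurable_continuous_onI)
  \<comment> \<open>\<open>P\<close> records the two Taylor points of the second difference, so that
    they can be chosen for all \<open>n\<close> and \<open>z\<close> at once; both converge to
    \<open>snd z\<close>.\<close>
  define P where "P n z s s' \<longleftrightarrow> \<bar>s - snd z\<bar> \<le> \<bar>h n\<bar> \<and> \<bar>s' - snd z\<bar> \<le> \<bar>h n\<bar> \<and>
     (\<eta> (z + (0, h n)) - 2 * \<eta> z + \<eta> (z - (0, h n))) / (h n)\<^sup>2 = (dx (dx \<eta>) (fst z, s) + dx (dx \<eta>) (fst z, s')) / 2" for n z s s'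
  have "\<exists>s s'. P n z s s'" for n z
  proof -
    obtain s s' where "\<bar>s - snd z\<bar> \<le> \<bar>h n\<bar>" "\<bar>s' - snd z\<bar> \<le> \<bar>h n\<bar>"
      "\<eta> (fst z, snd z + h n) - 2 * \<eta> (fst z, snd z) + \<eta> (fst z, snd z - h n) =
       (h n)\<^sup>2 / 2 * (dx (dx \<eta>) (fst z, s) + dx (dx \<eta>) (fst z, s'))"
      using second[of "snd z" "h n" "fst z"] by blast
    then show ?thesis using h(2)[of n] unfolding P_def by (intro exI[of _ s] exI[of _ s']) (cases z, auto)
  qed
  then obtain s s' where "\<And>n z. P n z (s n z) (s' n z)" by metis
  then have s: "\<And>n z. \<bar>s n z - snd z\<bar> \<le> \<bar>h n\<bar>" "\<And>n z. \<bar>s' n z - snd z\<bar> \<le> \<bar>h n\<bar>"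
    "\<And>n z. (\<eta> (z + (0, h n)) - 2 * \<eta> z + \<eta> (z - (0, h n))) / (h n)\<^sup>2
       = (dx (dx \<eta>) (fst z, s n z) + dx (dx \<eta>) (fst z, s' n z)) / 2" unfolding P_def by blast+
  show ?thesis
  proof (rule tendsto_integral_mult_quotient[where K=K, OF v vM, where Q=Q and c=c and d=d])
    fix n z
    have "\<bar>(\<eta> (z + (0, h n)) - 2 * \<eta> z + \<eta> (z - (0, h n))) / (h n)\<^sup>2\<bar> \<le> Q"
      unfolding s(3) using Q(2)[of "(fst z, s n z)"] Q(2)[of "(fst z, s' n z)"] by (auto simp: abs_le_iff)
    moreover have "\<eta> (z + (0, h n)) = 0 \<and> \<eta> z = 0 \<and> \<eta> (z - (0, h n)) = 0" if "z \<notin> cbox c d"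
      using cd[of z 0 0] cd[of "z + (0, h n)" 0 "- h n"] cd[of "z - (0, h n)" 0 "h n"] h(3)[of n] that K(3)
      by (cases z) auto
    ultimately show "\<bar>(\<eta> (z + (0, h n)) - 2 * \<eta> z + \<eta> (z - (0, h n))) / (h n)\<^sup>2\<bar> \<le> Q * indicator (cbox c d) z"
      by (auto simp: indicator_def)
  next
    fix z
    have at: "isCont (dx (dx \<eta>)) (fst z, snd z)"
      using co(2) continuous_on_eq_continuous_at[OF open_UNIV] by blast
    have "(\<lambda>n. s n z) \<longlonglongrightarrow> snd z" "(\<lambda>n. s' n z) \<longlonglongrightarrow> snd z"
      by (rule LIM_zero_cancel, rule Lim_null_comparison[OF always_eventually tendsto_rabs_zero[OF h(1)]],
          use s in simp)+
    then have "(\<lambda>n. (fst z, s n z)) \<longlonglongrightarrow> (fst z, snd z)" "(\<lambda>n. (fst z, s' n z)) \<longlonglongrightarrow> (fst z, snd z)"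
      using tendsto_Pair[OF tendsto_const] by blast+
    note this[THEN isCont_tendsto_compose[OF at]]
    from tendsto_divide[OF tendsto_add[OF this] tendsto_const, of 2]
    show "(\<lambda>n. (\<eta> (z + (0, h n)) - 2 * \<eta> z + \<eta> (z - (0, h n))) / (h n)\<^sup>2) \<longlonglongrightarrow> dx (dx \<eta>) z"
      by (simp add: s(3))
  qed (use K lim b in auto)
qed

section \<open>The explicit obstacle scheme\<close>

text \<open>\<open>pp\<close> and \<open>pm\<close> are the weights of the right and the left
  neighbour, \<open>h\<close> is the time step, and outside \<open>I\<close> the values are
  prescribed by \<open>B\<close>. Under \<open>cfl\<close> one free step is, apart from the source,
  a combination of three old values with nonnegative coefficients of sum \<open>1 - h * r\<close>;
  hence it is monotone and nonexpansive in the supremum norm.\<close>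

locale obstacle_scheme =
  fixes h pp pm r :: real and I :: "int set" and U :: "int \<Rightarrow> real"
    and lo hi :: "nat \<Rightarrow> real" and B :: "nat \<Rightarrow> int \<Rightarrow> real"
  assumes h: "0 < h" and pp: "0 \<le> pp" and pm: "0 \<le> pm" and r: "0 \<le> r"
    and cfl: "h * (pp + pm + r) \<le> 1"
    and lo0: "\<And>m. lo m \<le> 0" and hi0: "\<And>m. 0 \<le> hi m"
    and B_bounds: "\<And>m j. lo m \<le> B m j \<and> B m j \<le> hi m" and B0: "\<And>j. B 0 j = 0"
begin

definition lap :: "(int \<Rightarrow> real) \<Rightarrow> int \<Rightarrow> real" where
  "lap v j = pp * (v (j + 1) - v j) + pm * (v (j - 1) - v j)"

definition free :: "(int \<Rightarrow> real) \<Rightarrow> int \<Rightarrow> real" where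
  "free v j = v j + h * (lap v j - r * v j + U j)"

fun V :: "nat \<Rightarrow> int \<Rightarrow> real" where
  "V 0 j = 0"
| "V (Suc m) j = (if j \<in> I then max (lo (Suc m)) (min (hi (Suc m)) (free (V m) j)) else B (Suc m) j)"

lemma V_bounds: "lo m \<le> V m j" "V m j \<le> hi m"
  using lo0 hi0 B_bounds order_trans[OF lo0 hi0] by (cases m; auto)+

lemma free_diff:
  "free v j - free w j = (1 - h * (pp + pm + r)) * (v j - w j)
     + h * pp * (v (j + 1) - w (j + 1)) + h * pm * (v (j - 1) - w (j - 1))"
  by (simp add: free_def lap_def algebra_simps)

lemma max_min_diff_le:
  fixes x y :: real
  assumes "\<bar>x - y\<bar> \<le> c" "\<bar>a - a'\<bar> \<le> c" "\<bar>b - b'\<bar> \<le> c"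
  shows "\<bar>max a (min b x) - max a' (min b' y)\<bar> \<le> c"
  using assms by (auto simp: max_def min_def abs_if split: if_splits)

text \<open>Consecutive levels obey the same scheme, and the free step and the cut-off are both
  nonexpansive, so the increments satisfy a linear recursion with nonnegative coefficients. The
  weight \<open>w\<close> is a discrete supersolution up to the rate \<open>\<mu>\<close>, so a
  bound of the form \<open>h * C * w\<close> grows by a factor of at most
  \<open>1 + \<mu> * h\<close> per step.\<close>

lemma V_increment:
  assumes w: "\<And>j. 1 \<le> w j" "\<And>j. lap w j \<le> \<mu> * w j" "0 \<le> \<mu>" "0 \<le> C"
    and U: "\<And>j. \<bar>U j\<bar> \<le> C * w j"
    and lip: "\<And>m. \<bar>lo (Suc m) - lo m\<bar> \<le> h * C" "\<And>m. \<bar>hi (Suc m) - hi m\<bar> \<le> h * C"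
      "\<And>m j. \<bar>B (Suc m) j - B m j\<bar> \<le> h * C"
  shows "\<bar>V (Suc m) j - V m j\<bar> \<le> h * C * (1 + \<mu> * h) ^ m * w j"
proof (induction m arbitrary: j)
  case 0
  show ?case
  proof (cases "j \<in> I")
    case True
    have "\<bar>V (Suc 0) j\<bar> \<le> \<bar>h * U j\<bar>"
      using True lo0[of "Suc 0"] hi0[of "Suc 0"] by (auto simp: free_def lap_def)
    also have "\<dots> \<le> h * (C * w j)" using U[of j] h by (simp add: abs_mult)
    finally show ?thesis by (simp add: mult.assoc)
  next
    case False
    then have "\<bar>V (Suc 0) j\<bar> \<le> h * C * 1" using lip(3)[of 0 j] B0[of j] by simp
    also have "\<dots> \<le> h * C * w j" using h w by (intro mult_left_mono) auto
    finally show ?thesis by simp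
  qed
next
  case (Suc m)
  define \<Lambda> where "\<Lambda> = h * C * (1 + \<mu> * h) ^ m"
  have \<Lambda>0: "0 \<le> \<Lambda>" and step: "h * C * (1 + \<mu> * h) ^ Suc m = \<Lambda> * (1 + \<mu> * h)"
    using h w by (auto simp: \<Lambda>_def)
  \<comment> \<open>Obstacles and boundary values move by at most \<open>h * C\<close> at every
    level, which stays below the growing bound because \<open>w\<close> is at least 1.\<close>
  have "h * C * 1 \<le> h * C * (1 + \<mu> * h) ^ Suc m"
    using h w by (intro mult_left_mono one_le_power) auto
  also have "\<dots> \<le> h * C * (1 + \<mu> * h) ^ Suc m * w j"
    using mult_left_mono[OF w(1)[of j], of "h * C * (1 + \<mu> * h) ^ Suc m"] h w by simp
  finally have hC: "h * C \<le> \<Lambda> * (1 + \<mu> * h) * w j" unfolding step mult_1_right .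
  show ?case
  proof (cases "j \<in> I")
    case False
    then show ?thesis unfolding step using lip(3)[of "Suc m" j] hC by simp
  next
    case True
    have "\<bar>free (V (Suc m)) j - free (V m) j\<bar> \<le> (1 - h * (pp + pm + r)) * \<bar>V (Suc m) j - V m j\<bar>
       + h * pp * \<bar>V (Suc m) (j + 1) - V m (j + 1)\<bar> + h * pm * \<bar>V (Suc m) (j - 1) - V m (j - 1)\<bar>"
      unfolding free_diff
      using cfl h pp pm by (intro order_trans[OF abs_triangle_ineq] add_mono) (auto simp: abs_mult)
    also have "\<dots> \<le> (1 - h * (pp + pm + r)) * (\<Lambda> * w j) + h * pp * (\<Lambda> * w (j + 1)) + h * pm * (\<Lambda> * w (j - 1))"
      using cfl h pp pm Suc.IH unfolding \<Lambda>_def[symmetric] by (intro add_mono mult_left_mono) auto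
    also have "\<dots> = \<Lambda> * (w j + h * lap w j) - \<Lambda> * h * r * w j"
      by (simp add: lap_def algebra_simps)
    \<comment> \<open>The discount term has the favourable sign and is dropped.\<close>
    also have "\<dots> \<le> \<Lambda> * (w j + h * (\<mu> * w j))"
    proof -
      have "\<Lambda> * (w j + h * lap w j) \<le> \<Lambda> * (w j + h * (\<mu> * w j))"
        using \<Lambda>0 h w by (intro mult_left_mono add_left_mono) auto
      moreover have "0 \<le> \<Lambda> * h * r * w j" using \<Lambda>0 h r w(1)[of j] by simp
      ultimately show ?thesis by linarith
    qed
    also have "\<dots> = \<Lambda> * (1 + \<mu> * h) * w j" by (simp add: algebra_simps)
    finally have "\<bar>max (lo (Suc (Suc m))) (min (hi (Suc (Suc m))) (free (V (Suc m)) j))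
        - max (lo (Suc m)) (min (hi (Suc m)) (free (V m) j))\<bar> \<le> \<Lambda> * (1 + \<mu> * h) * w j"
      using hC lip(1,2)[of "Suc m"] by (intro max_min_diff_le) linarith+
    then show ?thesis unfolding step using True by simp
  qed
qed

text \<open>At an index where the new value is cut off, the old values of all neighbours lie on one
  side of the obstacle, up to \<open>O(h)\<close>; this bounds the discrete operator on the contact set.\<close>

lemma lap_V_bound:
  assumes j: "j \<in> I" and inc: "\<bar>V (Suc m) j - V m j\<bar> \<le> h * C" and U: "\<bar>U j\<bar> \<le> C"
    and lip: "\<bar>lo (Suc m) - lo m\<bar> \<le> h * C" "\<bar>hi (Suc m) - hi m\<bar> \<le> h * C"
    and M: "\<And>m. - M \<le> lo m" "\<And>m. hi m \<le> M"
  shows "\<bar>lap (V m) j\<bar> \<le> 2 * C + r * M"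
proof -
  have C0: "0 \<le> C" using U by linarith
  have VM: "\<bar>V m j\<bar> \<le> M" using V_bounds[of m j] M[of m] by (auto simp: abs_le_iff)
  have rV: "\<bar>r * V m j\<bar> \<le> r * M" using VM r by (simp add: abs_mult mult_left_mono)
  \<comment> \<open>By \<open>cfl\<close> the neighbour weights add up to at most
    \<open>1 / h\<close>, so differences of order \<open>h\<close> between neighbours contribute
    only a bounded amount.\<close>
  have small: "(pp + pm) * (2 * h * C) \<le> 2 * C"
  proof -
    have "0 \<le> h * r" using h r by simp
    then have "h * (pp + pm) \<le> 1" using cfl distrib_left[of h "pp + pm" r] by linarith
    then have "(h * (pp + pm)) * (2 * C) \<le> 1 * (2 * C)" using C0 by (intro mult_right_mono) auto
    then show ?thesis by (simp add: algebra_simps)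
  qed
  have inc_le: "x * h \<le> V (Suc m) j - V m j \<Longrightarrow> x \<le> C" "V (Suc m) j - V m j \<le> x * h \<Longrightarrow> - C \<le> x" for x
  proof -
    assume "x * h \<le> V (Suc m) j - V m j"
    then have "x * h \<le> C * h" using inc by (simp add: abs_le_iff mult.commute)
    then show "x \<le> C" using h by simp
  next
    assume "V (Suc m) j - V m j \<le> x * h"
    then have "- C * h \<le> x * h" using inc by (simp add: abs_le_iff mult.commute)
    then show "- C \<le> x" using h mult_le_cancel_right_pos by blast
  qed
  have upper: "lap (V m) j \<le> 2 * C + r * M"
  proof (cases "free (V m) j \<le> V (Suc m) j")
    case True
    then have "(lap (V m) j - r * V m j + U j) * h \<le> V (Suc m) j - V m j"
      by (simp add: free_def mult.commute)
    from inc_le(1)[OF this] show ?thesis using rV U by linarith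
  next
    case False
    then have "V (Suc m) j \<ge> hi (Suc m)"
      using j by (auto simp: max_def min_def split: if_splits)
    \<comment> \<open>One \<open>h * C\<close> comes from the increment of \<open>V\<close>, the
      other from the motion of the obstacle; the upper obstacle then caps every neighbour at level
      \<open>m\<close>.\<close>
    then have "hi m - V m j \<le> 2 * h * C" using inc lip(2) by linarith
    then have *: "V m i - V m j \<le> 2 * h * C" for i using V_bounds(2)[of m i] by linarith
    have "lap (V m) j \<le> pp * (2 * h * C) + pm * (2 * h * C)"
      unfolding lap_def using pp pm * by (intro add_mono mult_left_mono) auto
    also have "\<dots> \<le> 2 * C" using small by (simp add: algebra_simps)
    finally show ?thesis using r VM mult_nonneg_nonneg[of r M] by linarith
  qed
  have lower: "- (2 * C + r * M) \<le> lap (V m) j"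
  proof (cases "V (Suc m) j \<le> free (V m) j")
    case True
    then have "V (Suc m) j - V m j \<le> (lap (V m) j - r * V m j + U j) * h"
      by (simp add: free_def mult.commute)
    from inc_le(2)[OF this] show ?thesis using rV U by linarith
  next
    case False
    then have "V (Suc m) j \<le> lo (Suc m)"
      using j lo0 hi0 order_trans[OF lo0 hi0] by (auto simp: max_def min_def split: if_splits)
    then have "V m j - lo m \<le> 2 * h * C" using inc lip(1) by linarith
    then have *: "- (2 * h * C) \<le> V m i - V m j" for i using V_bounds(1)[of m i] by linarith
    have "pp * - (2 * h * C) + pm * - (2 * h * C) \<le> lap (V m) j"
      unfolding lap_def using pp pm * by (intro add_mono mult_left_mono) auto
    then have "- (2 * C) \<le> lap (V m) j" using small by (simp add: algebra_simps)
    then show ?thesis using r VM mult_nonneg_nonneg[of r M] by linarith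
  qed
  show ?thesis using upper lower by (simp add: abs_le_iff)
qed

text \<open>Only the lower obstacle lifts a value above the free step, so strictly above it the
  residual cannot be positive. With its mirror image \<open>residual_ge\<close> this is the discrete
  form of the complementarity conditions.\<close>

lemma residual_le:
  assumes "j \<in> I" "lo (Suc m) < V (Suc m) j"
  shows "(V (Suc m) j - V m j) / h - lap (V m) j + r * V m j - U j \<le> 0"
proof -
  have "V (Suc m) j \<le> free (V m) j"
    using assms by (auto simp: max_def min_def split: if_splits)
  then show ?thesis using h by (simp add: free_def field_simps)
qed

lemma residual_ge:
  assumes "j \<in> I" "V (Suc m) j < hi (Suc m)"
  shows "0 \<le> (V (Suc m) j - V m j) / h - lap (V m) j + r * V m j - U j"
proof -
  have "free (V m) j \<le> V (Suc m) j"
    using assms by (auto simp: max_def min_def split: if_splits)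
  then show ?thesis using h by (simp add: free_def field_simps)
qed

end

text \<open>Multiplying by powers of \<open>\<rho> = \<alpha> / \<beta>\<close>, the discrete integrating factor, turns the recurrence into
  a bound for the increments of \<open>z i = \<rho> ^ i * g i\<close>, while the partial sums of \<open>g\<close> force
  \<open>z\<close> to be small somewhere from above and somewhere from below.\<close>

lemma discrete_gradient_bound:
  fixes g :: "nat \<Rightarrow> real"
  assumes n: "0 < n" and pos: "0 < \<alpha>" "0 < \<beta>" "0 < k" "0 \<le> K"
    and rec: "\<And>i. Suc i < n \<Longrightarrow> \<bar>\<alpha> * g (Suc i) - \<beta> * g i\<bar> \<le> K * k"
    and sum: "\<bar>\<Sum>i<n. k * g i\<bar> \<le> M"
    and P: "\<And>i. i \<le> n \<Longrightarrow> (\<alpha> / \<beta>) ^ i \<le> P" "\<And>i. i \<le> n \<Longrightarrow> (\<beta> / \<alpha>) ^ i \<le> P"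
    and i: "i < n"
  shows "\<bar>g i\<bar> \<le> P * (P * M / (n * k) + n * k * (K * P / \<beta>))"
proof -
  define \<rho> where "\<rho> = \<alpha> / \<beta>"
  have \<rho>: "0 < \<rho>" using pos by (simp add: \<rho>_def)
  have inv: "(1 / \<rho>) ^ i = (\<beta> / \<alpha>) ^ i" for i by (simp add: \<rho>_def)
  have \<rho>P: "\<rho> ^ i \<le> P" "(1 / \<rho>) ^ i \<le> P" if "i \<le> n" for i using P[OF that] inv by (auto simp: \<rho>_def)
  have P1: "1 \<le> P" using \<rho>P(1)[of 0] by simp
  define z where "z i = \<rho> ^ i * g i" for i
  have gz: "g i = (1 / \<rho>) ^ i * z i" for i using \<rho> by (simp add: z_def power_divide)
  have dz: "\<bar>z (Suc i) - z i\<bar> \<le> k * (K * P / \<beta>)" if "Suc i < n" for i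
  proof -
    have "z (Suc i) - z i = \<rho> ^ i / \<beta> * (\<alpha> * g (Suc i) - \<beta> * g i)"
      using pos by (simp add: z_def \<rho>_def field_simps)
    then have "\<bar>z (Suc i) - z i\<bar> = \<rho> ^ i / \<beta> * \<bar>\<alpha> * g (Suc i) - \<beta> * g i\<bar>"
      using \<rho> pos by (simp add: abs_mult)
    also have "\<dots> \<le> P / \<beta> * (K * k)"
      using that rec \<rho>P(1)[of i] pos P1 \<rho> by (intro mult_mono divide_right_mono) auto
    finally show ?thesis by (simp add: mult_ac)
  qed
  define E where "E = k * (K * P / \<beta>)"
  have E0: "0 \<le> E" using pos P1 by (simp add: E_def)
  have osc: "\<bar>z (i + d) - z i\<bar> \<le> d * E" if "i + d < n" for i d
    using that
  proof (induction d)
    case (Suc d)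
    have "\<bar>z (i + Suc d) - z (i + d)\<bar> \<le> E" using dz[of "i + d"] Suc.prems by (simp add: E_def)
    then have "\<bar>z (i + Suc d) - z i\<bar> \<le> E + d * E" using Suc by linarith
    then show ?case by (simp add: distrib_right)
  qed simp
  have osc': "\<bar>z i - z j\<bar> \<le> n * E" if "i < n" "j < n" for i j
  proof -
    have "\<bar>z i - z j\<bar> \<le> (if j \<le> i then real (i - j) else real (j - i)) * E"
      using osc[of j "i - j"] osc[of i "j - i"] that by (auto simp: abs_minus_commute)
    also have "\<dots> \<le> n * E" using that E0 by (intro mult_right_mono) auto
    finally show ?thesis .
  qed
  \<comment> \<open>If all \<open>z i\<close> exceeded \<open>X\<close>, each \<open>g i\<close>
    would exceed \<open>X / P\<close> and the sum of the \<open>k * g i\<close> would exceed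
    \<open>M\<close>. So \<open>z\<close> is at most \<open>X\<close> at one index and at least
    \<open>- X\<close> at another, and \<open>n * E\<close> bounds its oscillation.\<close>
  define X where "X = P * M / (n * k)"
  have M0: "0 \<le> M" using sum by linarith
  have nk: "0 < n * k" using n pos by simp
  have X0: "0 \<le> X" using P1 M0 nk by (simp add: X_def)
  have lowb: "1 / P \<le> (1 / \<rho>) ^ i" if "i \<le> n" for i
    using \<rho>P(1)[OF that] \<rho> P1 by (simp add: power_divide frac_le)
  have "\<exists>i<n. z i \<le> X"
  proof (rule ccontr)
    assume "\<not> (\<exists>i<n. z i \<le> X)"
    then have *: "X < z i" if "i < n" for i using that by auto
    have "M = (\<Sum>i<n. k * (1 / P * X))" using n pos P1 by (simp add: X_def)
    also have "\<dots> < (\<Sum>i<n. k * g i)"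
    proof (rule sum_strict_mono)
      fix i assume "i \<in> {..<n}"
      then have "1 / P * X < (1 / P) * z i" using *[of i] P1 by (intro mult_strict_left_mono) auto
      also have "\<dots> \<le> (1 / \<rho>) ^ i * z i"
        using lowb[of i] *[of i] X0 \<open>i \<in> {..<n}\<close> by (intro mult_right_mono) auto
      finally show "k * (1 / P * X) < k * g i" unfolding gz[of i] using pos by (intro mult_strict_left_mono)
    qed (use n in auto)
    finally show False using sum by linarith
  qed
  then obtain i1 where i1: "i1 < n" "z i1 \<le> X" by blast
  have "\<exists>i<n. - X \<le> z i"
  proof (rule ccontr)
    assume "\<not> (\<exists>i<n. - X \<le> z i)"
    then have *: "X < - z i" if "i < n" for i using that by auto
    have "M = (\<Sum>i<n. k * (1 / P * X))" using n pos P1 by (simp add: X_def)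
    also have "\<dots> < (\<Sum>i<n. k * - g i)"
    proof (rule sum_strict_mono)
      fix i assume "i \<in> {..<n}"
      then have "1 / P * X < (1 / P) * - z i" using *[of i] P1 by (intro mult_strict_left_mono) auto
      also have "\<dots> \<le> (1 / \<rho>) ^ i * - z i"
        using lowb[of i] *[of i] X0 \<open>i \<in> {..<n}\<close> by (intro mult_right_mono) auto
      finally have "1 / P * X < - g i" using gz[of i] by simp
      then show "k * (1 / P * X) < k * - g i" using pos by (intro mult_strict_left_mono)
    qed (use n in auto)
    finally show False using sum by (simp add: sum_negf)
  qed
  then obtain i2 where i2: "i2 < n" "- X \<le> z i2" by blast
  have "\<bar>z i\<bar> \<le> X + n * E" using osc'[OF i i1(1)] osc'[OF i i2(1)] i1(2) i2(2) by linarith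
  then have "\<bar>g i\<bar> \<le> P * (X + n * E)"
    unfolding gz[of i] abs_mult using \<rho>P(2)[of i] i \<rho> P1 by (intro mult_mono) auto
  then show ?thesis by (simp add: X_def E_def mult.assoc)
qed

section \<open>Uniform bounds\<close>

text \<open>The powers of \<open>s\<close> match the divisors \<open>(k n)\<^sup>2\<close> and
  \<open>2 * k n\<close> of the difference quotients, so the operator acts on the exponential weight
  with a factor bounded uniformly in the mesh. Both estimates come from
  \<open>1 - s \<le> exp (- s)\<close>.\<close>

lemma exp_second_difference_bound:
  fixes s :: real
  assumes "0 \<le> s"
  shows "exp s + exp (- s) - 2 \<le> s\<^sup>2 * exp s" "exp s - exp (- s) \<le> 2 * s * exp s"
proof -
  have 1: "exp s - 1 \<le> s * exp s"
  proof -
    have "(1 - s) * exp s \<le> exp (- s) * exp s" using exp_ge_add_one_self[of "- s"] by (intro mult_right_mono) auto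
    then show ?thesis by (simp add: left_diff_distrib flip: exp_add)
  qed
  have "exp s + exp (- s) - 2 = exp (- s) * (exp s - 1)\<^sup>2"
    by (simp add: power2_eq_square algebra_simps flip: exp_add)
  also have "\<dots> \<le> exp (- s) * (s * exp s)\<^sup>2"
    using 1 assms by (intro mult_left_mono power_mono) auto
  also have "\<dots> = s\<^sup>2 * exp s"
    by (simp add: power2_eq_square algebra_simps flip: exp_add)
  finally show "exp s + exp (- s) - 2 \<le> s\<^sup>2 * exp s" .
  have "(1 - 2 * s) * exp s \<le> exp (- (2 * s)) * exp s"
    using exp_ge_add_one_self[of "- (2 * s)"] by (intro mult_right_mono) auto
  then show "exp s - exp (- s) \<le> 2 * s * exp s"
    by (simp add: left_diff_distrib flip: exp_add)
qed

text \<open>The space variable ranges over \<open>]-l, l[\<close> (\<open>W = {1}\<close>) or over the whole line (\<open>W = {1..}\<close>);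
  all estimates are uniform in the mesh size on the windows \<open>[- R * l, R * l]\<close> with \<open>R \<in> W\<close>.\<close>

locale obstacle_data =
  fixes a b r T l \<kappa> C M :: real and W :: "nat set" and U lo hi bl br :: "real \<Rightarrow> real"
  assumes a: "0 < a" and r: "0 < r" and T: "0 < T" and l: "0 < l" and \<kappa>: "0 \<le> \<kappa>" and C: "0 \<le> C"
    and W: "W = {1} \<or> W = {1..}"
    and lo: "\<And>t. lo t \<le> 0" "\<And>t. - M \<le> lo t" "\<And>s t. \<bar>lo s - lo t\<bar> \<le> C * \<bar>s - t\<bar>"
    and hi: "\<And>t. 0 \<le> hi t" "\<And>t. hi t \<le> M" "\<And>s t. \<bar>hi s - hi t\<bar> \<le> C * \<bar>s - t\<bar>"
    and bl: "\<And>t. lo t \<le> bl t" "\<And>t. bl t \<le> hi t" "\<And>s t. \<bar>bl s - bl t\<bar> \<le> C * \<bar>s - t\<bar>" "bl 0 = 0"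
    and br: "\<And>t. lo t \<le> br t" "\<And>t. br t \<le> hi t" "\<And>s t. \<bar>br s - br t\<bar> \<le> C * \<bar>s - t\<bar>" "br 0 = 0"
    and U: "\<And>x. \<bar>U x\<bar> \<le> C * (1 + exp (- \<kappa> * x))" and U_cont: "continuous_on UNIV U"
begin

lemma M0: "0 \<le> M" using hi(1,2) order_trans by blast

text \<open>Enough cells on a length \<open>l\<close> that the mesh width is at most 1 and
  \<open>k n * \<bar>b\<bar> \<le> a\<close>; the latter keeps both neighbour weights nonnegative
  although the drift is differenced centrally.\<close>

definition N0 :: nat where "N0 = (SOME n::nat. Suc 0 \<le> n \<and> l \<le> n \<and> l * \<bar>b\<bar> \<le> a * n)"

lemma N0: "Suc 0 \<le> N0" "l \<le> N0" "l * \<bar>b\<bar> \<le> a * N0"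
proof -
  obtain n where n: "max 1 (max l (l * \<bar>b\<bar> / a)) \<le> real n" using real_arch_simple by blast
  then have "Suc 0 \<le> n \<and> l \<le> n \<and> l * \<bar>b\<bar> \<le> a * n" using a by (auto simp: field_simps)
  then have "Suc 0 \<le> N0 \<and> l \<le> N0 \<and> l * \<bar>b\<bar> \<le> a * N0" unfolding N0_def by (rule someI)
  then show "Suc 0 \<le> N0" "l \<le> N0" "l * \<bar>b\<bar> \<le> a * N0" by auto
qed

definition N :: "nat \<Rightarrow> nat" where "N n = n + N0"
text \<open>The mesh width divides \<open>l\<close> exactly, so the window ends \<open>R * l\<close>
  are grid points and the lateral data sit on the boundary itself.\<close>

definition k :: "nat \<Rightarrow> real" where "k n = l / N n"
text \<open>Parabolic scaling; the denominator leaves room for \<open>r\<close> in the condition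
  \<open>cfl\<close>, given \<open>k n \<le> 1\<close>.\<close>

definition h :: "nat \<Rightarrow> real" where "h n = (k n)\<^sup>2 / (2 * a + r + 1)"
definition pp :: "nat \<Rightarrow> real" where "pp n = a / (k n)\<^sup>2 + b / (2 * k n)"
definition pm :: "nat \<Rightarrow> real" where "pm n = a / (k n)\<^sup>2 - b / (2 * k n)"
text \<open>The inequalities are strict: for \<open>W = {1}\<close> the indices of the end points
  are left to \<open>B\<close>, whereas for \<open>W = {1..}\<close> the union consists of all
  integers.\<close>

definition I :: "nat \<Rightarrow> int set" where "I n = (\<Union>R\<in>W. {- int (R * N n)<..<int (R * N n)})"
definition B :: "nat \<Rightarrow> nat \<Rightarrow> int \<Rightarrow> real" where
  "B n m j = (if j < 0 then bl (m * h n) else br (m * h n))"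

section \<open>Elementary bounds for the mesh and the coefficients\<close>

lemma Npos: "0 < N n" and N_ge: "N0 \<le> N n" using N0 by (auto simp: N_def)

lemma kpos: "0 < k n" using l Npos by (simp add: k_def)

lemma Nk: "N n * k n = l" using Npos[of n] by (simp add: k_def)

lemma k_le_1: "k n \<le> 1"
  using N0(2) N_ge[of n] Npos[of n] by (simp add: k_def divide_le_eq)

lemma kb: "k n * \<bar>b\<bar> \<le> a"
proof -
  have "l * \<bar>b\<bar> \<le> a * N0" by (rule N0)
  also have "\<dots> \<le> a * N n" using a N_ge[of n] by simp
  finally show ?thesis using Npos[of n] by (simp add: k_def field_simps)
qed

lemma hpos: "0 < h n" using kpos[of n] a r by (simp add: h_def)

lemma k_lim: "k \<longlonglongrightarrow> 0"
proof -
  have "(\<lambda>n. l / real (n + N0)) \<longlonglongrightarrow> 0"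
    using LIMSEQ_ignore_initial_segment[OF lim_const_over_n[of l]] by simp
  then show ?thesis by (simp add: k_def[abs_def] N_def)
qed

lemma h_le_1: "h n \<le> 1"
proof -
  have "(k n)\<^sup>2 \<le> 1" using k_le_1[of n] kpos[of n] by (simp add: power_le_one)
  then have "(k n)\<^sup>2 \<le> 2 * a + r + 1" using a r by linarith
  then show ?thesis using a r by (simp add: h_def divide_le_eq)
qed

lemma h_lim: "h \<longlonglongrightarrow> 0"
  using tendsto_divide[OF tendsto_power[OF k_lim, of 2] tendsto_const, of "2 * a + r + 1"] a r
  by (simp add: h_def[abs_def])

lemma alpha_beta: "pp n * (k n)\<^sup>2 = a + b * k n / 2" "pm n * (k n)\<^sup>2 = a - b * k n / 2"
  "a / 2 \<le> a + b * k n / 2" "a / 2 \<le> a - b * k n / 2"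
proof -
  show "pp n * (k n)\<^sup>2 = a + b * k n / 2" "pm n * (k n)\<^sup>2 = a - b * k n / 2"
    using kpos[of n] by (auto simp: pp_def pm_def field_simps power2_eq_square)
  have "\<bar>b * k n\<bar> \<le> a" using kb[of n] kpos[of n] by (simp add: abs_mult mult.commute)
  then show "a / 2 \<le> a + b * k n / 2" "a / 2 \<le> a - b * k n / 2" by (auto simp: abs_le_iff)
qed

lemma pp_nonneg: "0 \<le> pp n" and pm_nonneg: "0 \<le> pm n"
proof -
  have "0 \<le> pp n * (k n)\<^sup>2" "0 \<le> pm n * (k n)\<^sup>2"
    using alpha_beta[of n] a by auto
  then show "0 \<le> pp n" "0 \<le> pm n"
    using kpos[of n] by (simp_all add: zero_le_mult_iff)
qed

lemma cfl: "h n * (pp n + pm n + r) \<le> 1"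
proof -
  have "h n * (pp n + pm n + r) = (2 * a + r * (k n)\<^sup>2) / (2 * a + r + 1)"
  proof -
    have "pp n + pm n = 2 * a / (k n)\<^sup>2" by (simp add: pp_def pm_def)
    then have "(k n)\<^sup>2 * (pp n + pm n + r) = 2 * a + r * (k n)\<^sup>2"
      using kpos[of n] by (simp add: distrib_left mult.commute)
    then show ?thesis by (simp add: h_def)
  qed
  also have "\<dots> \<le> 1"
  proof -
    have "(k n)\<^sup>2 \<le> 1" using k_le_1[of n] kpos[of n] by (simp add: power_le_one)
    then have "r * (k n)\<^sup>2 \<le> r" using r by (simp add: mult_left_le)
    then have "2 * a + r * (k n)\<^sup>2 \<le> 2 * a + r + 1" by linarith
    then show ?thesis using a r by simp
  qed
  finally show ?thesis .
qed

sublocale scheme: obstacle_scheme "h n" "pp n" "pm n" r "I n" "\<lambda>j. U (j * k n)"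
  "\<lambda>m. lo (m * h n)" "\<lambda>m. hi (m * h n)" "B n" for n
  by unfold_locales (use hpos pp_nonneg pm_nonneg r cfl lo hi bl br in \<open>auto simp: B_def\<close>)

abbreviation V :: "nat \<Rightarrow> nat \<Rightarrow> int \<Rightarrow> real" where "V \<equiv> scheme.V"

text \<open>In order: the growth rate of the weight under the scheme; then, on the window of index
  \<open>R\<close>, bounds for the time quotient, the discrete operator, the powers of the discrete
  integrating factor, and the first and second space quotients. None of them depends on the
  mesh.\<close>

definition \<mu> :: real where "\<mu> = exp \<kappa> * (a * \<kappa>\<^sup>2 + \<bar>b\<bar> * \<kappa>)"
definition Ct :: "nat \<Rightarrow> real" where "Ct R = C * exp (\<mu> * T) * (1 + exp (\<kappa> * (R * l)))"
definition K :: "nat \<Rightarrow> real" where "K R = 2 * Ct R + r * M"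
definition P :: "nat \<Rightarrow> real" where "P R = exp (4 * \<bar>b\<bar> * (R * l) / a)"
text \<open>The bound of \<open>discrete_gradient_bound\<close> for window length
  \<open>2 * (R * l)\<close>, with end values that differ by at most \<open>2 * M\<close> and with
  \<open>a / 2\<close> as a lower bound for the coefficient in the denominator.\<close>

definition Cx :: "nat \<Rightarrow> real" where
  "Cx R = P R * (P R * (2 * M) / (2 * (R * l)) + 2 * (R * l) * (K R * P R / (a / 2)))"
definition Cxx :: "nat \<Rightarrow> real" where "Cxx R = (K R + \<bar>b\<bar> * Cx R) / a"

section \<open>Bounds for the scheme that are uniform in the mesh\<close>

lemma \<mu>0: "0 \<le> \<mu>" using a \<kappa> by (simp add: \<mu>_def)
lemma Ct0: "0 \<le> Ct R" using C by (simp add: Ct_def add_nonneg_nonneg)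
lemma K0: "0 \<le> K R" using Ct0 r M0 by (simp add: K_def)

lemma W_pos: "R \<in> W \<Longrightarrow> 1 \<le> R" using W by auto

text \<open>A shift by one index multiplies the exponential by \<open>exp s\<close> or
  \<open>exp (- s)\<close>, so the operator acts on it by a factor; it annihilates the constant
  1.\<close>

lemma weight_lap:
  "scheme.lap n (\<lambda>j. 1 + exp (- \<kappa> * (j * k n))) j \<le> \<mu> * (1 + exp (- \<kappa> * (j * k n)))"
proof -
  define s where "s = \<kappa> * k n"
  define y where "y = exp (- \<kappa> * (j * k n))"
  have s0: "0 \<le> s" using \<kappa> kpos[of n] by (simp add: s_def)
  have "s \<le> \<kappa>" using \<kappa> k_le_1[of n] kpos[of n] by (simp add: s_def mult_left_le)
  then have es: "exp s \<le> exp \<kappa>" by simp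
  have y1: "exp (- \<kappa> * ((j + 1) * k n)) = y * exp (- s)" "exp (- \<kappa> * ((j - 1) * k n)) = y * exp s"
    by (auto simp: y_def s_def algebra_simps simp flip: exp_add)
  have y0: "0 < y" by (simp add: y_def)
  have "scheme.lap n (\<lambda>j. 1 + exp (- \<kappa> * (j * k n))) j
      = pp n * (y * exp (- s) - y) + pm n * (y * exp s - y)"
    using y1 by (simp add: scheme.lap_def y_def)
  also have "\<dots> = y * (a * ((exp s + exp (- s) - 2) / (k n)\<^sup>2) - b * ((exp s - exp (- s)) / (2 * k n)))"
    by (simp add: pp_def pm_def algebra_simps diff_divide_distrib add_divide_distrib)
  also have "\<dots> \<le> y * (a * (\<kappa>\<^sup>2 * exp s) + \<bar>b\<bar> * (\<kappa> * exp s))"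
  proof -
    have "(exp s + exp (- s) - 2) / (k n)\<^sup>2 \<le> \<kappa>\<^sup>2 * exp s"
      using exp_second_difference_bound(1)[OF s0] kpos[of n]
      by (simp add: s_def power_mult_distrib divide_le_eq algebra_simps)
    moreover have "- b * ((exp s - exp (- s)) / (2 * k n)) \<le> \<bar>b\<bar> * (\<kappa> * exp s)"
    proof (rule mult_mono)
      show "(exp s - exp (- s)) / (2 * k n) \<le> \<kappa> * exp s"
        using exp_second_difference_bound(2)[OF s0] kpos[of n]
        by (simp add: s_def divide_le_eq algebra_simps)
      show "0 \<le> (exp s - exp (- s)) / (2 * k n)" using s0 kpos[of n] by simp
    qed auto
    ultimately have "a * ((exp s + exp (- s) - 2) / (k n)\<^sup>2) - b * ((exp s - exp (- s)) / (2 * k n))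
      \<le> a * (\<kappa>\<^sup>2 * exp s) + \<bar>b\<bar> * (\<kappa> * exp s)"
      using a by (smt (verit) mult_left_mono mult_minus_left)
    then show ?thesis using y0 by (intro mult_left_mono) auto
  qed
  also have "\<dots> = y * (exp s * (a * \<kappa>\<^sup>2 + \<bar>b\<bar> * \<kappa>))" by (simp add: algebra_simps)
  also have "\<dots> \<le> y * \<mu>" unfolding \<mu>_def using es y0 a \<kappa> by (intro mult_left_mono mult_right_mono) auto
  also have "\<dots> \<le> \<mu> * (1 + y)" using \<mu>0 by (simp add: algebra_simps)
  finally show ?thesis by (simp add: y_def)
qed

lemma weight_le: "- real (R * N n) \<le> j \<Longrightarrow> 1 + exp (- \<kappa> * (j * k n)) \<le> 1 + exp (\<kappa> * (R * l))"
proof -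
  assume "- real (R * N n) \<le> j"
  then have "- real (R * N n) * k n \<le> j * k n" using kpos[of n] by (intro mult_right_mono) auto
  then have "- (j * k n) \<le> R * l" using Nk[of n] by (simp add: mult.assoc)
  then have "\<kappa> * - (j * k n) \<le> \<kappa> * (R * l)" using \<kappa> by (rule mult_left_mono)
  then show ?thesis by simp
qed

lemma C_le_Ct: "C \<le> Ct R" "C * (1 + exp (\<kappa> * (R * l))) \<le> Ct R"
proof -
  have "1 \<le> exp (\<mu> * T)" using \<mu>0 T by simp
  then have "1 * (1 + exp (\<kappa> * (R * l))) \<le> exp (\<mu> * T) * (1 + exp (\<kappa> * (R * l)))"
    by (intro mult_right_mono) (auto simp: add_nonneg_nonneg)
  then show 2: "C * (1 + exp (\<kappa> * (R * l))) \<le> Ct R"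
    unfolding Ct_def mult.assoc using C by (intro mult_left_mono) auto
  have "C * 1 \<le> C * (1 + exp (\<kappa> * (R * l)))" using C by (intro mult_left_mono) auto
  then show "C \<le> Ct R" using 2 by simp
qed

text \<open>Only a lower bound on \<open>j\<close> enters because the weight decreases in space. Up
  to time \<open>T\<close> the growth compounds to at most \<open>exp (\<mu> * T)\<close>.\<close>

lemma V_increment:
  assumes "m * h n \<le> T" "- int (R * N n) \<le> j"
  shows "\<bar>V n (Suc m) j - V n m j\<bar> \<le> h n * Ct R"
proof -
  have "\<bar>V n (Suc m) j - V n m j\<bar> \<le> h n * C * (1 + \<mu> * h n) ^ m * (1 + exp (- \<kappa> * (j * k n)))"
  proof (rule scheme.V_increment[where w="\<lambda>j. 1 + exp (- \<kappa> * (j * k n))"])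
    have eq: "\<bar>real (Suc m) * h n - real m * h n\<bar> = h n" for m
      using hpos[of n] by (simp add: algebra_simps)
    show "\<bar>lo (real (Suc m) * h n) - lo (real m * h n)\<bar> \<le> h n * C" for m
      using lo(3)[of "real (Suc m) * h n" "real m * h n"] by (simp only: eq mult.commute)
    show "\<bar>hi (real (Suc m) * h n) - hi (real m * h n)\<bar> \<le> h n * C" for m
      using hi(3)[of "real (Suc m) * h n" "real m * h n"] by (simp only: eq mult.commute)
    show "\<bar>B n (Suc m) j - B n m j\<bar> \<le> h n * C" for m j
      using bl(3)[of "real (Suc m) * h n" "real m * h n"] br(3)[of "real (Suc m) * h n" "real m * h n"]
      unfolding B_def by (simp only: eq mult.commute split: if_split) auto
  qed (use weight_lap \<mu>0 C U in auto)
  also have "\<dots> \<le> h n * C * exp (\<mu> * T) * (1 + exp (\<kappa> * (R * l)))"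
  proof -
    have "(1 + \<mu> * h n) ^ m \<le> exp (\<mu> * h n) ^ m"
      using \<mu>0 hpos[of n] by (intro power_mono exp_ge_add_one_self) (auto simp: add_nonneg_nonneg)
    also have "\<dots> = exp (\<mu> * (m * h n))" by (simp add: exp_of_nat_mult[symmetric] ac_simps)
    also have "\<dots> \<le> exp (\<mu> * T)" using assms(1) \<mu>0 by (simp add: mult_left_mono)
    finally have "(1 + \<mu> * h n) ^ m \<le> exp (\<mu> * T)" .
    moreover have "1 + exp (- \<kappa> * (j * k n)) \<le> 1 + exp (\<kappa> * (R * l))"
    proof (rule weight_le)
      show "- real (R * N n) \<le> j" using assms(2) by (metis of_int_le_iff of_int_minus of_int_of_nat_eq)
    qed
    moreover have "0 \<le> (1 + \<mu> * h n) ^ m" using \<mu>0 hpos[of n] by simp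
    ultimately show ?thesis using hpos[of n] C by (intro mult_mono) (auto simp: add_nonneg_nonneg less_imp_le)
  qed
  finally show ?thesis by (simp add: Ct_def mult.assoc)
qed

lemma lap_bound:
  assumes "m * h n \<le> T" "- int (R * N n) \<le> j" "j \<in> I n"
  shows "\<bar>scheme.lap n (V n m) j\<bar> \<le> K R"
  unfolding K_def
proof (rule scheme.lap_V_bound[OF assms(3)])
  show "\<bar>V n (Suc m) j - V n m j\<bar> \<le> h n * Ct R" by (rule V_increment[OF assms(1,2)])
  have "- real (R * N n) \<le> j" using assms(2) by (metis of_int_le_iff of_int_minus of_int_of_nat_eq)
  from mult_left_mono[OF weight_le[OF this] C] show "\<bar>U (j * k n)\<bar> \<le> Ct R"
    using U[of "j * k n"] C_le_Ct(2)[of R] by linarith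
  have eq: "\<bar>real (Suc m) * h n - real m * h n\<bar> = h n"
    using hpos[of n] by (simp add: algebra_simps)
  have "C * h n \<le> h n * Ct R" using C_le_Ct(1)[of R] hpos[of n] by (simp add: mult.commute)
  then show "\<bar>lo (real (Suc m) * h n) - lo (real m * h n)\<bar> \<le> h n * Ct R"
    "\<bar>hi (real (Suc m) * h n) - hi (real m * h n)\<bar> \<le> h n * Ct R"
    using lo(3)[of "real (Suc m) * h n" "real m * h n"] hi(3)[of "real (Suc m) * h n" "real m * h n"]
    unfolding eq by linarith+
qed (use lo hi in auto)

lemma V_abs_le: "\<bar>V n m j\<bar> \<le> M"
  using scheme.V_bounds[where n=n and m=m and j=j] lo(2)[of "m * h n"] hi(2)[of "m * h n"] by (auto simp: abs_le_iff)

lemma window_subset_I: "R \<in> W \<Longrightarrow> {- int (R * N n)<..<int (R * N n)} \<subseteq> I n"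
  by (auto simp: I_def)

text \<open>In terms of the forward quotient \<open>g\<close>, the operator times the mesh width is
  \<open>\<alpha> * g (Suc i) - \<beta> * g i\<close>: a first-order recurrence whose right-hand
  side is controlled by \<open>lap_bound\<close>. The sum over the window telescopes and is at most
  \<open>2 * M\<close>.\<close>

lemma gradient_bound:
  assumes m: "m * h n \<le> T" and R: "R \<in> W" and j: "- int (R * N n) \<le> j" "j < int (R * N n)"
  shows "\<bar>V n m (j + 1) - V n m j\<bar> \<le> k n * Cx R"
proof -
  define L where "L = R * N n"
  define g where "g i = (V n m (int i - L + 1) - V n m (int i - L)) / k n" for i :: nat
  define i0 where "i0 = nat (j + L)"
  have jL: "- int L \<le> j" "j < int L" using j by (simp_all add: L_def)
  have L0: "0 < L" using Npos[of n] W_pos[OF R] by (simp add: L_def)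
  have Lk: "real (2 * L) * k n = 2 * (R * l)" using Nk[of n] by (simp add: L_def mult.assoc)
  define \<alpha> \<beta> where "\<alpha> = a + b * k n / 2" and "\<beta> = a - b * k n / 2"
  have ab: "0 < \<alpha>" "0 < \<beta>" "a / 2 \<le> \<alpha>" "a / 2 \<le> \<beta>" using alpha_beta[of n] a by (auto simp: \<alpha>_def \<beta>_def)
  have "\<bar>g i0\<bar> \<le> P R * (P R * (2 * M) / (real (2 * L) * k n) + real (2 * L) * k n * (K R * P R / \<beta>))"
  proof (rule discrete_gradient_bound)
    show "0 < 2 * L" "0 < \<alpha>" "0 < \<beta>" "0 < k n" "0 \<le> K R" using L0 ab kpos K0 by auto
    show "i0 < 2 * L" using jL by (simp add: i0_def nat_less_iff)
    show "\<bar>\<alpha> * g (Suc i) - \<beta> * g i\<bar> \<le> K R * k n" if i: "Suc i < 2 * L" for i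
    proof -
      let ?j = "int (Suc i) - L"
      have "\<bar>scheme.lap n (V n m) ?j\<bar> \<le> K R"
      proof (rule lap_bound[OF m])
        show "- int (R * N n) \<le> ?j" by (simp add: L_def)
        show "?j \<in> I n" using i window_subset_I[OF R, of n, folded L_def] by auto
      qed
      moreover have "\<alpha> * g (Suc i) - \<beta> * g i = scheme.lap n (V n m) ?j * k n"
      proof -
        have e: "int (Suc i) - L - 1 = int i - L" "int i - L + 1 = int (Suc i) - L" by auto
        have "scheme.lap n (V n m) ?j * k n
          = (pp n * (k n)\<^sup>2 * (V n m (?j + 1) - V n m ?j) - pm n * (k n)\<^sup>2 * (V n m ?j - V n m (?j - 1))) / k n"
          using kpos[of n] by (simp add: scheme.lap_def field_simps power2_eq_square)
        then show ?thesis
          unfolding alpha_beta g_def \<alpha>_def \<beta>_def e using kpos[of n]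
            by (simp add: diff_divide_distrib right_diff_distrib)
      qed
      ultimately show ?thesis using kpos[of n] by (simp add: abs_mult)
    qed
    have kg: "k n * g i = V n m (int (Suc i) - L) - V n m (int i - L)" for i
      using kpos[of n] by (simp add: g_def add.commute add_diff_eq)
    have "(\<Sum>i<q. k n * g i) = V n m (int q - L) - V n m (- int L)" for q
      unfolding kg by (induction q) auto
    then have "(\<Sum>i<2 * L. k n * g i) = V n m (int (2 * L) - L) - V n m (- int L)" .
    then show "\<bar>\<Sum>i<2 * L. k n * g i\<bar> \<le> 2 * M"
      using V_abs_le[of n m "int (2 * L) - L"] V_abs_le[of n m "- int L"] by linarith
    \<comment> \<open>One factor exceeds 1 by at most \<open>2 * \<bar>b\<bar> * k n / a\<close>;
      there are at most \<open>2 * L\<close> of them, and \<open>2 * L * k n\<close> is the window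
      length, which explains the exponent in \<open>P R\<close>.\<close>
    have ratio: "(x / y) ^ i \<le> P R" if "0 < x" "a / 2 \<le> y" "x - y \<le> \<bar>b\<bar> * k n" "i \<le> 2 * L" for x y i
    proof -
      have y: "0 < y" using that(2) a by linarith
      have "x / y = 1 + (x - y) / y" using y by (simp add: field_simps)
      also have "\<dots> \<le> 1 + \<bar>b\<bar> * k n / (a / 2)"
      proof -
        have "(x - y) / y \<le> \<bar>b\<bar> * k n / y" using that(3) y by (intro divide_right_mono) auto
        also have "\<dots> \<le> \<bar>b\<bar> * k n / (a / 2)" using that(2) a y kpos[of n] by (intro divide_left_mono) auto
        finally show ?thesis by simp
      qed
      also have "\<dots> \<le> exp (\<bar>b\<bar> * k n / (a / 2))" by (rule exp_ge_add_one_self)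
      finally have "(x / y) ^ i \<le> exp (\<bar>b\<bar> * k n / (a / 2)) ^ i"
        using y that(1) by (intro power_mono) auto
      also have "\<dots> = exp (i * (\<bar>b\<bar> * k n / (a / 2)))" by (rule exp_of_nat_mult[symmetric])
      also have "\<dots> \<le> exp (real (2 * L) * (\<bar>b\<bar> * k n / (a / 2)))"
        using that(4) a kpos[of n] by (subst exp_le_cancel_iff, intro mult_right_mono) auto
      also have "real (2 * L) * (\<bar>b\<bar> * k n / (a / 2)) = (real (2 * L) * k n) * \<bar>b\<bar> / (a / 2)" by simp
      finally show ?thesis unfolding Lk P_def by (simp add: mult_ac)
    qed
    have bk: "b * k n \<le> \<bar>b\<bar> * k n" "- b * k n \<le> \<bar>b\<bar> * k n"
      using kpos[of n] by (intro mult_right_mono; auto)+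
    show "(\<alpha> / \<beta>) ^ i \<le> P R" "(\<beta> / \<alpha>) ^ i \<le> P R" if "i \<le> 2 * L" for i
      using ratio[of \<alpha> \<beta> i] ratio[of \<beta> \<alpha> i] that ab bk by (auto simp: \<alpha>_def \<beta>_def)
  qed
  also have "\<dots> \<le> Cx R"
    unfolding Cx_def Lk using ab a K0[of R] l
    by (intro mult_left_mono add_left_mono divide_left_mono) (auto simp: P_def)
  finally have g: "\<bar>g i0\<bar> \<le> Cx R" .
  have "int i0 - L = j" using jL by (simp add: i0_def)
  then have "V n m (j + 1) - V n m j = k n * g i0" using kpos[of n] by (simp add: g_def)
  then show ?thesis using g kpos[of n] by (simp add: abs_mult)
qed

lemma lap_eq: "scheme.lap n v j =
    a * ((v (j + 1) - 2 * v j + v (j - 1)) / (k n)\<^sup>2) + b * ((v (j + 1) - v (j - 1)) / (2 * k n))"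
  unfolding scheme.lap_def by (simp add: pp_def pm_def algebra_simps diff_divide_distrib add_divide_distrib)

text \<open>The second quotient is what remains of the bounded operator once the bounded first-order
  part is removed; \<open>a\<close> is positive.\<close>

lemma central_bounds:
  assumes m: "m * h n \<le> T" and R: "R \<in> W" and j: "- int (R * N n) < j" "j < int (R * N n)"
  shows "\<bar>(V n m (j + 1) - V n m (j - 1)) / (2 * k n)\<bar> \<le> Cx R"
    "\<bar>(V n m (j + 1) - 2 * V n m j + V n m (j - 1)) / (k n)\<^sup>2\<bar> \<le> Cxx R"
proof -
  have "\<bar>V n m (j + 1) - V n m j\<bar> \<le> k n * Cx R" "\<bar>V n m j - V n m (j - 1)\<bar> \<le> k n * Cx R"
    using gradient_bound[OF m R, of j] gradient_bound[OF m R, of "j - 1"] j by auto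
  then have "\<bar>V n m (j + 1) - V n m (j - 1)\<bar> \<le> 2 * k n * Cx R" by linarith
  then show 1: "\<bar>(V n m (j + 1) - V n m (j - 1)) / (2 * k n)\<bar> \<le> Cx R"
    using kpos[of n] by (simp add: divide_le_eq mult_ac)
  have "\<bar>scheme.lap n (V n m) j\<bar> \<le> K R"
    using j window_subset_I[OF R, of n] by (intro lap_bound[OF m]) auto
  moreover have "\<bar>b * ((V n m (j + 1) - V n m (j - 1)) / (2 * k n))\<bar> \<le> \<bar>b\<bar> * Cx R"
    unfolding abs_mult[of b] by (intro mult_left_mono 1) auto
  ultimately have "\<bar>a * ((V n m (j + 1) - 2 * V n m j + V n m (j - 1)) / (k n)\<^sup>2)\<bar> \<le> K R + \<bar>b\<bar> * Cx R"
    unfolding lap_eq by linarith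
  then show "\<bar>(V n m (j + 1) - 2 * V n m j + V n m (j - 1)) / (k n)\<^sup>2\<bar> \<le> Cxx R"
    using a unfolding Cxx_def abs_mult by (simp add: pos_le_divide_eq mult.commute)
qed

end

section \<open>Pointwise limit\<close>

context obstacle_data
begin

definition lev :: "nat \<Rightarrow> real \<Rightarrow> nat" where "lev n \<tau> = nat \<lfloor>\<tau> / h n\<rfloor>"
definition idx :: "nat \<Rightarrow> real \<Rightarrow> int" where "idx n x = \<lfloor>x / k n\<rfloor>"
text \<open>A step function on the mesh cells. At nonnegative times, translation by
  \<open>h n\<close> in time or by \<open>k n\<close> in space shifts the index by exactly one, so
  difference quotients of \<open>vn\<close> are those of the scheme.\<close>

definition vn :: "nat \<Rightarrow> real \<times> real \<Rightarrow> real" where "vn n z = V n (lev n (fst z)) (idx n (snd z))"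
definition Xc :: "real set" where "Xc = (\<Union>R\<in>W. {- (R * l)..R * l})"
definition Xo :: "real set" where "Xo = (\<Union>R\<in>W. {- (R * l)<..<R * l})"
definition D :: "(real \<times> real) set" where "D = {0<..<T} \<times> Xo"
definition Cl :: "(real \<times> real) set" where "Cl = {0..T} \<times> Xc"
text \<open>The next larger window, if there is one: central quotients at the edge of a window reach
  one index beyond it. In the same way \<open>rx x\<close> selects a window with the point
  \<open>x\<close> of \<open>Xo\<close> in its interior.\<close>

definition nxt :: "nat \<Rightarrow> nat" where "nxt R = (if W = {1} then 1 else Suc R)"
definition rx :: "real \<Rightarrow> nat" where "rx x = (if W = {1} then 1 else nat \<lfloor>\<bar>x\<bar> / l\<rfloor> + 1)"

section \<open>Rounding to the grid and equicontinuity of the step functions\<close>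

lemma idx_shift: "idx n (x + k n) = idx n x + 1" "idx n (x - k n) = idx n x - 1"
proof -
  have "(x + k n) / k n = x / k n + 1" "(x - k n) / k n = x / k n - 1"
    using kpos[of n] by (auto simp: field_simps)
  then show "idx n (x + k n) = idx n x + 1" "idx n (x - k n) = idx n x - 1"
    by (simp_all add: idx_def)
qed

lemma lev_shift: "0 \<le> \<tau> \<Longrightarrow> lev n (\<tau> + h n) = Suc (lev n \<tau>)"
proof -
  assume "0 \<le> \<tau>"
  have "(\<tau> + h n) / h n = \<tau> / h n + 1" using hpos[of n] by (auto simp: field_simps)
  then show ?thesis using hpos[of n] \<open>0 \<le> \<tau>\<close> by (simp add: lev_def nat_add_distrib)
qed

lemma lev_bounds: assumes "0 \<le> \<tau>" shows "lev n \<tau> * h n \<le> \<tau>" "\<tau> < lev n \<tau> * h n + h n"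
proof -
  have q: "0 \<le> \<tau> / h n" using assms hpos[of n] by simp
  have e: "real (lev n \<tau>) = of_int \<lfloor>\<tau> / h n\<rfloor>" unfolding lev_def using q by simp
  show "lev n \<tau> * h n \<le> \<tau>"
    using of_int_floor_le[of "\<tau> / h n"] unfolding e by (simp only: pos_le_divide_eq[OF hpos])
  have "\<tau> / h n < of_int \<lfloor>\<tau> / h n\<rfloor> + 1" by linarith
  then show "\<tau> < lev n \<tau> * h n + h n"
    unfolding e by (simp only: pos_divide_less_eq[OF hpos] distrib_right mult_1_left)
qed

lemma idx_bounds: "idx n x * k n \<le> x" "x < idx n x * k n + k n"
proof -
  show "idx n x * k n \<le> x"
    using of_int_floor_le[of "x / k n"] unfolding idx_def by (simp only: pos_le_divide_eq[OF kpos])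
  have "x / k n < of_int \<lfloor>x / k n\<rfloor> + 1" by linarith
  then show "x < idx n x * k n + k n"
    unfolding idx_def by (simp only: pos_divide_less_eq[OF kpos] distrib_right mult_1_left)
qed

lemma grid_eq: "real (R * N n) * k n = R * l"
  using Nk[of n] by (simp add: mult.assoc)

text \<open>The floor moves a point to the left by less than one cell, so the strict inequality at
  the left end asks for the margin \<open>k n\<close>.\<close>

lemma idx_window:
  shows "- (R * l) \<le> x \<Longrightarrow> - int (R * N n) \<le> idx n x"
    and "x \<le> R * l \<Longrightarrow> idx n x \<le> int (R * N n)"
    and "x < R * l \<Longrightarrow> idx n x < int (R * N n)"
    and "- (R * l) + k n \<le> x \<Longrightarrow> - int (R * N n) < idx n x"
proof -
  have e: "x / k n \<le> y \<longleftrightarrow> x \<le> y * k n" "y \<le> x / k n \<longleftrightarrow> y * k n \<le> x" "x / k n < y \<longleftrightarrow> x < y * k n" for y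
    using kpos[of n] by (auto simp: field_simps)
  have g: "real_of_int (int (R * N n)) * k n = R * l" "real_of_int (- int (R * N n)) * k n = - (R * l)"
     "real_of_int (- int (R * N n) + 1) * k n = - (R * l) + k n"
    using grid_eq[of R n] by (auto simp: algebra_simps)
  show "- int (R * N n) \<le> idx n x" if "- (R * l) \<le> x"
    unfolding idx_def le_floor_iff e g using that .
  show "idx n x \<le> int (R * N n)" if "x \<le> R * l"
  proof -
    have "x / k n \<le> real_of_int (int (R * N n))" unfolding e g using that .
    then show ?thesis unfolding idx_def by linarith
  qed
  show "idx n x < int (R * N n)" if "x < R * l"
    unfolding idx_def floor_less_iff e g using that .
  show "- int (R * N n) < idx n x" if "- (R * l) + k n \<le> x"
  proof -
    have "- int (R * N n) + 1 \<le> idx n x" unfolding idx_def le_floor_iff e g using that .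
    then show ?thesis by linarith
  qed
qed

lemma vn_measurable [measurable]: "vn n \<in> borel_measurable borel"
proof -
  have [measurable]: "(\<lambda>z::real\<times>real. lev n (fst z)) \<in> borel \<rightarrow>\<^sub>M count_space UNIV"
    "(\<lambda>z::real\<times>real. idx n (snd z)) \<in> borel \<rightarrow>\<^sub>M count_space UNIV"
  proof -
    have [measurable]: "fst \<in> borel_measurable (borel :: (real \<times> real) measure)"
      "snd \<in> borel_measurable (borel :: (real \<times> real) measure)"
      by (intro borel_measurable_continuous_onI continuous_intros)+
    show "(\<lambda>z::real\<times>real. lev n (fst z)) \<in> borel \<rightarrow>\<^sub>M count_space UNIV"
      unfolding lev_def by measurable
    show "(\<lambda>z::real\<times>real. idx n (snd z)) \<in> borel \<rightarrow>\<^sub>M count_space UNIV"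
      unfolding idx_def by (rule measurable_compose[OF _ measurable_real_floor]) measurable
  qed
  have "(\<lambda>z::real\<times>real. V n m (idx n (snd z))) \<in> borel_measurable borel" for m :: nat
    by measurable
  from measurable_compose_countable[OF this, of "\<lambda>z. lev n (fst z)"]
  show ?thesis unfolding vn_def[abs_def] by measurable
qed

lemma vn_abs_le: "\<bar>vn n z\<bar> \<le> M" by (simp add: vn_def V_abs_le)

lemma V_time:
  assumes "m \<le> m'" "m' * h n \<le> T" "- int (R * N n) \<le> j"
  shows "\<bar>V n m' j - V n m j\<bar> \<le> (m' * h n - m * h n) * Ct R"
  using assms
proof (induction m' rule: dec_induct)
  case (step i)
  have "i * h n \<le> T" using step.prems(1) hpos[of n] by (simp add: algebra_simps)
  then have "\<bar>V n (Suc i) j - V n i j\<bar> \<le> h n * Ct R" "\<bar>V n i j - V n m j\<bar> \<le> (i * h n - m * h n) * Ct R"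
    using step V_increment by auto
  then have "\<bar>V n (Suc i) j - V n m j\<bar> \<le> h n * Ct R + (i * h n - m * h n) * Ct R" by linarith
  also have "\<dots> = (real (Suc i) * h n - m * h n) * Ct R" by (simp add: algebra_simps)
  finally show ?case .
qed simp

lemma V_space:
  assumes "m * h n \<le> T" "R \<in> W" "- int (R * N n) \<le> j" "j + int d \<le> int (R * N n)"
  shows "\<bar>V n m (j + int d) - V n m j\<bar> \<le> d * k n * Cx R"
  using assms(4)
proof (induction d)
  case (Suc d)
  have "\<bar>V n m (j + int d + 1) - V n m (j + int d)\<bar> \<le> k n * Cx R"
    using Suc.prems assms by (intro gradient_bound) auto
  moreover have "j + int d + 1 = j + int (Suc d)" by simp
  moreover have "\<bar>V n m (j + int d) - V n m j\<bar> \<le> d * k n * Cx R" using Suc by simp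
  ultimately have "\<bar>V n m (j + int (Suc d)) - V n m j\<bar> \<le> k n * Cx R + d * k n * Cx R" by (smt (verit))
  also have "\<dots> = real (Suc d) * k n * Cx R" by (simp add: algebra_simps)
  finally show ?case .
qed simp

lemma Cx0: assumes "R \<in> W" shows "0 \<le> Cx R"
proof -
  have "0 * real 0 \<le> T" using T by simp
  then have "\<bar>V 0 0 (0 + 1) - V 0 0 0\<bar> \<le> k 0 * Cx R"
    using assms W_pos[OF assms] Npos[of 0] T by (intro gradient_bound) auto
  then have "0 \<le> k 0 * Cx R" by linarith
  then show ?thesis using kpos[of 0] by (simp add: zero_le_mult_iff)
qed

text \<open>Rounding to the grid moves a point by less than one cell in each variable; the term
  \<open>h n + k n\<close> accounts for the resulting jumps.\<close>

lemma vn_lipschitz: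
  assumes R: "R \<in> W" and z: "z \<in> {0..T} \<times> {- (R * l)..R * l}" "z' \<in> {0..T} \<times> {- (R * l)..R * l}"
  shows "\<bar>vn n z - vn n z'\<bar> \<le> (Ct R + Cx R) * (\<bar>fst z - fst z'\<bar> + \<bar>snd z - snd z'\<bar> + h n + k n)"
proof -
  have time: "\<bar>V n (lev n \<tau>') j - V n (lev n \<tau>) j\<bar> \<le> Ct R * (\<bar>\<tau> - \<tau>'\<bar> + h n)"
    if "0 \<le> \<tau>" "\<tau> \<le> \<tau>'" "\<tau>' \<le> T" "- int (R * N n) \<le> j" for \<tau> \<tau>' j
  proof -
    have "lev n \<tau> \<le> lev n \<tau>'" unfolding lev_def
      using that hpos[of n] by (intro nat_mono floor_mono divide_right_mono) auto
    then have "\<bar>V n (lev n \<tau>') j - V n (lev n \<tau>) j\<bar> \<le> (lev n \<tau>' * h n - lev n \<tau> * h n) * Ct R"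
      using lev_bounds[of \<tau>' n] that by (intro V_time) auto
    also have "\<dots> \<le> (\<bar>\<tau> - \<tau>'\<bar> + h n) * Ct R"
      using lev_bounds[of \<tau> n] lev_bounds[of \<tau>' n] that Ct0 by (intro mult_right_mono) auto
    finally show ?thesis by (simp add: mult.commute)
  qed
  have space: "\<bar>V n m (idx n x') - V n m (idx n x)\<bar> \<le> Cx R * (\<bar>x - x'\<bar> + k n)"
    if "- (R * l) \<le> x" "x \<le> x'" "x' \<le> R * l" "m * h n \<le> T" for x x' m
  proof -
    define d where "d = nat (idx n x' - idx n x)"
    have "idx n x \<le> idx n x'" unfolding idx_def
      using that kpos[of n] by (intro floor_mono divide_right_mono) auto
    then have e: "idx n x' = idx n x + int d" by (simp add: d_def)
    have "\<bar>V n m (idx n x') - V n m (idx n x)\<bar> \<le> d * k n * Cx R"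
      unfolding e using that R idx_window[where R=R and x=x and n=n] idx_window[where R=R and x=x' and n=n] e by (intro V_space) auto
    also have "d * k n = idx n x' * k n - idx n x * k n" by (simp add: e algebra_simps)
    also have "\<dots> * Cx R \<le> (\<bar>x - x'\<bar> + k n) * Cx R"
      using idx_bounds[where n=n and x=x] idx_bounds[where n=n and x=x'] Cx0[OF R] by (intro mult_right_mono) auto
    finally show ?thesis by (simp add: mult.commute)
  qed
  obtain \<tau> x \<tau>' x' where zz: "z = (\<tau>, x)" "z' = (\<tau>', x')" by fastforce
  have b: "0 \<le> \<tau>" "\<tau> \<le> T" "0 \<le> \<tau>'" "\<tau>' \<le> T" "- (R * l) \<le> x" "x \<le> R * l" "- (R * l) \<le> x'" "x' \<le> R * l"
    using z by (auto simp: zz)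
  have "\<bar>V n (lev n \<tau>) (idx n x) - V n (lev n \<tau>') (idx n x)\<bar> \<le> Ct R * (\<bar>\<tau> - \<tau>'\<bar> + h n)"
    using time[of \<tau> \<tau>' "idx n x"] time[of \<tau>' \<tau> "idx n x"] b idx_window(1)[where R=R and x=x and n=n]
    by (cases "\<tau> \<le> \<tau>'") (auto simp: abs_minus_commute)
  moreover have "lev n \<tau>' * h n \<le> T" using lev_bounds[of \<tau>' n] b by simp
  then have "\<bar>V n (lev n \<tau>') (idx n x) - V n (lev n \<tau>') (idx n x')\<bar> \<le> Cx R * (\<bar>x - x'\<bar> + k n)"
    using space[of x x' "lev n \<tau>'"] space[of x' x "lev n \<tau>'"] b
    by (cases "x \<le> x'") (auto simp: abs_minus_commute)
  moreover have "Ct R * (\<bar>\<tau> - \<tau>'\<bar> + h n) \<le> Ct R * (\<bar>\<tau> - \<tau>'\<bar> + \<bar>x - x'\<bar> + h n + k n)"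
    "Cx R * (\<bar>x - x'\<bar> + k n) \<le> Cx R * (\<bar>\<tau> - \<tau>'\<bar> + \<bar>x - x'\<bar> + h n + k n)"
    using Ct0 Cx0[OF R] hpos[of n] kpos[of n] by (auto intro!: mult_left_mono)
  ultimately show ?thesis unfolding vn_def zz fst_conv snd_conv distrib_right[of "Ct R" "Cx R"] by linarith
qed

lemma in_window: "x \<in> Xc \<Longrightarrow> \<exists>R\<in>W. - (R * l) \<le> x \<and> x \<le> R * l" by (auto simp: Xc_def)

lemma nxt_W: "R \<in> W \<Longrightarrow> nxt R \<in> W" using W by (auto simp: nxt_def)

lemma near_window:
  assumes "R \<in> W" "- (R * l) \<le> x" "x \<le> R * l" "x' \<in> Xc" "\<bar>x - x'\<bar> \<le> l"
  shows "- (nxt R * l) \<le> x' \<and> x' \<le> nxt R * l" "- (nxt R * l) \<le> x \<and> x \<le> nxt R * l"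
  using assms W l by (auto simp: nxt_def Xc_def algebra_simps)

lemma vn_local_lipschitz:
  assumes "z \<in> Cl"
  obtains c where "0 \<le> c" "\<And>z' n. z' \<in> Cl \<Longrightarrow> \<bar>snd z - snd z'\<bar> \<le> l \<Longrightarrow>
     \<bar>vn n z - vn n z'\<bar> \<le> c * (\<bar>fst z - fst z'\<bar> + \<bar>snd z - snd z'\<bar> + h n + k n)"
proof -
  obtain R where R: "R \<in> W" "- (R * l) \<le> snd z" "snd z \<le> R * l"
    using assms in_window[of "snd z"] by (auto simp: Cl_def)
  show ?thesis
  proof (rule that[of "Ct (nxt R) + Cx (nxt R)"])
    show "0 \<le> Ct (nxt R) + Cx (nxt R)" using Ct0 Cx0 nxt_W[OF R(1)] by (simp add: add_nonneg_nonneg)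
    fix z' n assume "z' \<in> Cl" "\<bar>snd z - snd z'\<bar> \<le> l"
    then show "\<bar>vn n z - vn n z'\<bar> \<le> (Ct (nxt R) + Cx (nxt R)) * (\<bar>fst z - fst z'\<bar> + \<bar>snd z - snd z'\<bar> + h n + k n)"
      using near_window[OF R, of "snd z'"] assms
      by (intro vn_lipschitz nxt_W R) (auto simp: Cl_def)
  qed
qed

lemma hk_lim: "(\<lambda>n. h n + k n) \<longlonglongrightarrow> 0" using tendsto_add[OF h_lim k_lim] by simp

lemma closed_Cl: "closed Cl"
proof -
  have "closed Xc"
    using W
  proof
    assume "W = {1..}"
    have "x \<in> Xc" for x
    proof -
      obtain n where "\<bar>x\<bar> / l \<le> real n" using real_arch_simple by blast
      then have "\<bar>x\<bar> \<le> real (Suc n) * l" using l by (simp add: divide_le_eq algebra_simps)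
      then show ?thesis using \<open>W = {1..}\<close> unfolding Xc_def by (intro UN_I[of "Suc n"]) auto
    qed
    then have "Xc = UNIV" by auto
    then show ?thesis by simp
  next
    assume "W = {1}"
    have "Xc = (\<Union>R\<in>W. {- (R * l)..R * l})" by (rule Xc_def)
    also have "\<dots> = {- l..l}" using \<open>W = {1}\<close> by simp
    finally show ?thesis by simp
  qed
  then show ?thesis unfolding Cl_def by (intro closed_Times) auto
qed

text \<open>The argument of Arzela and Ascoli for step functions: convergence on a countable dense
  set spreads to \<open>Cl\<close> because the \<open>vn\<close> are equicontinuous up to an error
  of order \<open>h n + k n\<close>. This error disappears in the limit, which is therefore
  continuous.\<close>

lemma pointwise_limit:
  obtains s v where "strict_mono (s :: nat \<Rightarrow> nat)" "v \<in> borel_measurable borel"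
    "\<And>z. z \<in> Cl \<Longrightarrow> (\<lambda>n. vn (s n) z) \<longlonglongrightarrow> v z" "\<And>z. \<bar>v z\<bar> \<le> M" "continuous_on Cl v"
proof -
  obtain Q where Q: "countable Q" "Q \<subseteq> Cl" "Cl \<subseteq> closure Q" using separable[of Cl] by auto
  obtain s :: "nat \<Rightarrow> nat" where s: "strict_mono s" "\<And>z. z \<in> Q \<Longrightarrow> \<exists>c. (\<lambda>n. vn (s n) z) \<longlonglongrightarrow> c"
    by (rule function_convergent_subsequence[OF Q(1), of vn M]) (auto simp: vn_abs_le)
  have hks: "(\<lambda>n. h (s n) + k (s n)) \<longlonglongrightarrow> 0" by (rule LIMSEQ_subseq_LIMSEQ[OF hk_lim s(1), unfolded o_def])
  have conv: "convergent (\<lambda>n. vn (s n) z)" if z: "z \<in> Cl" for z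
  proof -
    obtain c where c: "0 \<le> c" "\<And>z' n. z' \<in> Cl \<Longrightarrow> \<bar>snd z - snd z'\<bar> \<le> l \<Longrightarrow>
       \<bar>vn n z - vn n z'\<bar> \<le> c * (\<bar>fst z - fst z'\<bar> + \<bar>snd z - snd z'\<bar> + h n + k n)"
      using vn_local_lipschitz[OF z] by metis
    have "Cauchy (\<lambda>n. vn (s n) z)"
    proof (rule CauchyI)
      fix e :: real assume e: "0 < e"
      \<comment> \<open>The \<open>+ 1\<close> guards against \<open>c = 0\<close>. The two passages
        to the dense point cost \<open>3 * e / 8\<close> each, and the Cauchy property there costs
        \<open>e / 8\<close>.\<close>
      define d where "d = min l (e / (8 * (c + 1)))"
      have d: "0 < d" "d \<le> l" "c * (2 * d) \<le> e / 4"
      proof -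
        show "0 < d" "d \<le> l" using l e c by (auto simp: d_def)
        have "c * (2 * d) \<le> (c + 1) * (2 * (e / (8 * (c + 1))))"
          using c e l by (intro mult_mono) (auto simp: d_def)
        also have "\<dots> = e / 4" using c(1) by (auto simp: field_simps)
        finally show "c * (2 * d) \<le> e / 4" .
      qed
      obtain q where q: "q \<in> Q" "dist q z < d" using closure_approachable[of z Q] Q(3) z d by blast
      have fs: "\<bar>fst z - fst q\<bar> \<le> d" "\<bar>snd z - snd q\<bar> \<le> d"
        using q(2) dist_fst_le[of q z] dist_snd_le[of q z] by (auto simp: dist_real_def)
      obtain n0 where n0: "\<And>n. n \<ge> n0 \<Longrightarrow> \<bar>h (s n) + k (s n)\<bar> < e / (8 * (c + 1))"
        using LIMSEQ_D[OF hks, of "e / (8 * (c + 1))"] e c by auto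
      obtain n1 where n1: "\<And>m n. m \<ge> n1 \<Longrightarrow> n \<ge> n1 \<Longrightarrow> \<bar>vn (s m) q - vn (s n) q\<bar> < e / 8"
        using s(2)[OF q(1)] LIMSEQ_imp_Cauchy[of "\<lambda>n. vn (s n) q"] CauchyD[of "\<lambda>n. vn (s n) q" "e / 8"] e
        by fastforce
      have near: "\<bar>vn (s n) z - vn (s n) q\<bar> \<le> 3 * e / 8" if "n \<ge> n0" for n
      proof -
        have "\<bar>vn (s n) z - vn (s n) q\<bar> \<le> c * (\<bar>fst z - fst q\<bar> + \<bar>snd z - snd q\<bar> + h (s n) + k (s n))"
          using c(2)[of q "s n"] q(1) Q(2) fs d by auto
        also have "\<dots> \<le> c * (2 * d + e / (8 * (c + 1)))"
          using fs n0[OF that] c(1) by (intro mult_left_mono) auto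
        also have "\<dots> = c * (2 * d) + c * (e / (8 * (c + 1)))" by (rule distrib_left)
        also have "c * (e / (8 * (c + 1))) \<le> e / 8" using c(1) e by (simp add: field_simps)
        finally show ?thesis using d by simp
      qed
      show "\<exists>K. \<forall>m\<ge>K. \<forall>n\<ge>K. norm (vn (s m) z - vn (s n) z) < e"
      proof (intro exI[of _ "max n0 n1"] allI impI)
        fix m n assume "max n0 n1 \<le> m" "max n0 n1 \<le> n"
        then show "norm (vn (s m) z - vn (s n) z) < e"
          using near[of m] near[of n] n1[of m n] unfolding real_norm_def by linarith
      qed
    qed
    then show ?thesis by (rule Cauchy_convergent)
  qed
  \<comment> \<open>The value 0 outside \<open>Cl\<close> makes \<open>v\<close> measurable and
    bounded on the whole plane, where the integrals are taken.\<close>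
  define v where "v z = (if z \<in> Cl then lim (\<lambda>n. vn (s n) z) else 0)" for z
  have lim: "(\<lambda>n. vn (s n) z) \<longlonglongrightarrow> v z" if "z \<in> Cl" for z
    using conv[OF that] that by (simp add: v_def convergent_LIMSEQ_iff)
  have [measurable]: "Cl \<in> sets borel" using closed_Cl by auto
  show ?thesis
  proof (rule that[OF s(1) _ lim])
    show "v \<in> borel_measurable borel"
    proof (rule borel_measurable_LIMSEQ_real)
      show "(\<lambda>n. if z \<in> Cl then vn (s n) z else 0) \<longlonglongrightarrow> v z" for z
        using lim by (auto simp: v_def)
      show "(\<lambda>z. if z \<in> Cl then vn (s n) z else 0) \<in> borel_measurable borel" for n by measurable
    qed
    show "\<bar>v z\<bar> \<le> M" for z
    proof (cases "z \<in> Cl")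
      case True
      show ?thesis by (rule LIMSEQ_le_const2[OF tendsto_rabs[OF lim[OF True]]]) (auto simp: vn_abs_le)
    qed (simp add: v_def M0)
    show "continuous_on Cl v"
      unfolding continuous_on_iff
    proof safe
      fix \<tau> x :: real and e :: real assume z: "(\<tau>, x) \<in> Cl" and e: "0 < e"
      let ?z = "(\<tau>, x)"
      obtain c where c: "0 \<le> c" "\<And>z' n. z' \<in> Cl \<Longrightarrow> \<bar>snd ?z - snd z'\<bar> \<le> l \<Longrightarrow>
         \<bar>vn n ?z - vn n z'\<bar> \<le> c * (\<bar>fst ?z - fst z'\<bar> + \<bar>snd ?z - snd z'\<bar> + h n + k n)"
        using vn_local_lipschitz[OF z] by metis
      define d where "d = min l (e / (4 * (c + 1)))"
      have d: "0 < d" using l e c by (auto simp: d_def)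
      show "\<exists>d>0. \<forall>z'\<in>Cl. dist z' ?z < d \<longrightarrow> dist (v z') (v ?z) < e"
      proof (intro exI[of _ d] conjI d ballI impI)
        fix z' assume z': "z' \<in> Cl" "dist z' ?z < d"
        have fs: "\<bar>fst ?z - fst z'\<bar> \<le> d" "\<bar>snd ?z - snd z'\<bar> \<le> d"
          using z'(2) dist_fst_le[of z' ?z] dist_snd_le[of z' ?z] by (auto simp: dist_real_def)
        have "(\<lambda>n. \<bar>vn (s n) ?z - vn (s n) z'\<bar>) \<longlonglongrightarrow> \<bar>v ?z - v z'\<bar>"
          by (intro tendsto_rabs tendsto_diff lim z z')
        moreover have "(\<lambda>n. c * (2 * d + (h (s n) + k (s n)))) \<longlonglongrightarrow> c * (2 * d + 0)"
          by (intro tendsto_intros hks)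
        moreover have "\<bar>vn (s n) ?z - vn (s n) z'\<bar> \<le> c * (2 * d + (h (s n) + k (s n)))" for n
        proof -
          have "\<bar>vn (s n) ?z - vn (s n) z'\<bar> \<le> c * (\<bar>fst ?z - fst z'\<bar> + \<bar>snd ?z - snd z'\<bar> + h (s n) + k (s n))"
            using c(2)[OF z'(1)] fs d_def by simp
          also have "\<dots> \<le> c * (2 * d + (h (s n) + k (s n)))" using fs c(1) by (intro mult_left_mono) auto
          finally show ?thesis .
        qed
        ultimately have "\<bar>v ?z - v z'\<bar> \<le> c * (2 * d + 0)" by (intro LIMSEQ_le) auto
        also have "\<dots> \<le> c * (2 * (e / (4 * (c + 1))))" using c(1) by (intro mult_left_mono) (auto simp: d_def)
        also have "\<dots> < e" using c(1) e by (simp add: field_simps add_pos_nonneg)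
        finally show "dist (v z') (v ?z) < e" by (simp add: dist_real_def abs_minus_commute)
      qed
    qed
  qed
qed

end

section \<open>Weak limits\<close>

text \<open>Weak derivatives are defined through \<open>lebesgue_on\<close>, while limits and
  translations are carried out over \<open>lborel\<close>; this is the passage between the
  two.\<close>

lemma integral_lebesgue_on_eq_lborel:
  fixes f :: "'a::euclidean_space \<Rightarrow> real"
  assumes "f \<in> borel_measurable borel" "S \<in> sets borel" "\<And>z. z \<notin> S \<Longrightarrow> f z = 0"
  shows "(LINT z|lebesgue_on S. f z) = (LINT z|lborel. f z)"
proof -
  have "(LINT z|lebesgue_on S. f z) = (LINT z|lebesgue. indicator S z *\<^sub>R f z)"
    using assms(2) by (intro integral_restrict_space) auto
  also have "\<dots> = (LINT z|lebesgue. f z)"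
    using assms(3) by (intro Bochner_Integration.integral_cong) (auto simp: indicator_def)
  also have "\<dots> = (LINT z|lborel. f z)" using assms(1) by (intro integral_completion) simp
  finally show ?thesis .
qed

lemma integrable_lebesgue_on_bounded:
  fixes f :: "'a::euclidean_space \<Rightarrow> real"
  assumes "f \<in> borel_measurable borel" "S \<in> lmeasurable" "\<And>z. z \<in> S \<Longrightarrow> \<bar>f z\<bar> \<le> c"
  shows "integrable (lebesgue_on S) f"
proof -
  interpret finite_measure "lebesgue_on S" using assms(2) by (rule finite_measure_lebesgue_on)
  show ?thesis
  proof (rule integrable_const_bound[where B=c])
    show "f \<in> borel_measurable (lebesgue_on S)"
      using assms(1) by (intro measurable_restrict_space1 measurable_completion) simp
  qed (use assms in \<open>auto intro!: AE_I2\<close>)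
qed

lemma AE_lebesgue_on_of_lborel:
  assumes "AE z in lborel. z \<in> S \<longrightarrow> P z" "S \<in> sets borel"
  shows "AE z in lebesgue_on S. P z"
  using AE_completion[OF assms(1)] assms(2) by (subst AE_restrict_space_iff) auto

lemma integral_translate:
  fixes f g :: "'a::euclidean_space \<Rightarrow> real"
  assumes "f \<in> borel_measurable borel" "g \<in> borel_measurable borel"
  shows "(LINT z|lborel. f (z + c) * g z) = (LINT z|lborel. f z * g (z - c))"
proof -
  note [measurable] = assms
  have "(LINT z|lborel. f z * g (z - c)) = (LINT z|distr lborel borel ((+) c). f z * g (z - c))"
    by (simp add: lborel_distr_plus)
  also have "\<dots> = (LINT z|lborel. f (c + z) * g (c + z - c))"
    by (intro integral_distr) measurable
  finally show ?thesis by (simp add: add.commute)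
qed

lemma integrable_translate:
  fixes g :: "'a::euclidean_space \<Rightarrow> real"
  assumes "integrable lborel g"
  shows "integrable lborel (\<lambda>z. g (z + c))"
proof -
  have [measurable]: "g \<in> borel_measurable borel" using assms by auto
  have "integrable (distr lborel borel ((+) c)) g" using assms by (simp add: lborel_distr_plus)
  then have "integrable lborel (\<lambda>z. g (c + z))" by (subst (asm) integrable_distr_eq) measurable
  then show ?thesis by (simp add: add.commute)
qed

lemma integrable_bounded_mult:
  fixes f g :: "'a::euclidean_space \<Rightarrow> real"
  assumes "f \<in> borel_measurable borel" "\<And>z. \<bar>f z\<bar> \<le> M" "integrable lborel g"
  shows "integrable lborel (\<lambda>z. f z * g z)"
proof (rule Bochner_Integration.integrable_bound[OF integrable_mult_right[OF assms(3), of M]])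
  show "(\<lambda>z. f z * g z) \<in> borel_measurable lborel" using assms by measurable
  have "\<bar>f z\<bar> * \<bar>g z\<bar> \<le> \<bar>M\<bar> * \<bar>g z\<bar>" for z using assms(2)[of z] by (intro mult_right_mono) auto
  then show "AE z in lborel. norm (f z * g z) \<le> norm (M * g z)" by (simp add: abs_mult)
qed

lemma integrable_bounded_compact_support:
  fixes f :: "'a::euclidean_space \<Rightarrow> real"
  assumes "f \<in> borel_measurable borel" "compact K" "\<And>z. \<bar>f z\<bar> \<le> c * indicator K z"
  shows "integrable lborel f"
proof (rule Bochner_Integration.integrable_bound)
  have "emeasure lborel K < \<infinity>" using emeasure_compact_finite[OF assms(2)] by simp
  then show "integrable lborel (\<lambda>z. c * indicator K z)"
    using assms(2) by (intro integrable_mult_right integrable_real_indicator) (auto intro: borel_compact)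
  show "AE z in lborel. norm (f z) \<le> norm (c * indicator K z)"
    using order_trans[OF assms(3) abs_ge_self] by simp
qed (use assms in auto)

lemma test_function_integrable:
  assumes "\<eta> \<in> test_functions D"
  shows "integrable lborel \<eta>" "\<eta> \<in> borel_measurable borel"
proof -
  obtain K where K: "compact K" "K \<subseteq> D"
    "\<And>z. z \<notin> K \<Longrightarrow> \<eta> z = 0 \<and> dt \<eta> z = 0 \<and> dx \<eta> z = 0 \<and> dx (dx \<eta>) z = 0"
    using test_function_support[OF assms] by blast
  show m: "\<eta> \<in> borel_measurable borel"
    using test_function_continuous[OF assms] by (rule borel_measurable_continuous_onI)
  obtain Q where "\<And>z. \<bar>\<eta> z\<bar> \<le> Q"
    using continuous_compact_support_bounded[OF test_function_continuous[OF assms] K(1)] K(3) by metis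
  then show "integrable lborel \<eta>"
    using K by (intro integrable_bounded_compact_support[OF m K(1), of Q]) (auto simp: indicator_def)
qed

text \<open>Test with the indicator of the part of \<open>A\<close> where \<open>E\<close> is
  positive: the positive parts of \<open>e n\<close> vanish eventually at each of its points and are
  dominated by \<open>w\<close>, so \<open>E\<close> has a nonpositive integral over this set, which
  is therefore null. Dominated convergence enters because the index from which
  \<open>e n z \<le> 0\<close> holds depends on \<open>z\<close>.\<close>

lemma AE_nonpos_of_weak_limit:
  fixes e :: "nat \<Rightarrow> 'a::euclidean_space \<Rightarrow> real"
  assumes [measurable]: "A \<in> sets borel" "\<And>n. e n \<in> borel_measurable borel" "E \<in> borel_measurable borel"
    and W: "integrable lborel (\<lambda>z. w z * indicator A z)" "\<And>n z. z \<in> A \<Longrightarrow> \<bar>e n z\<bar> \<le> w z" "\<And>z. z \<in> A \<Longrightarrow> \<bar>E z\<bar> \<le> w z"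
    and lim: "\<And>B. B \<in> sets borel \<Longrightarrow> B \<subseteq> A \<Longrightarrow>
       (\<lambda>n. LINT z|lborel. e n z * indicator B z) \<longlonglongrightarrow> (LINT z|lborel. E z * indicator B z)"
    and ev: "\<And>z. z \<in> A \<Longrightarrow> \<forall>\<^sub>F n in sequentially. e n z \<le> 0"
  shows "AE z in lborel. z \<in> A \<longrightarrow> E z \<le> 0"
proof -
  define B where "B = {z \<in> A. 0 < E z}"
  have [measurable]: "B \<in> sets borel" unfolding B_def by measurable
  have BA: "B \<subseteq> A" by (auto simp: B_def)
  have int: "integrable lborel (\<lambda>z. f z * indicator B z)"
    if [measurable]: "f \<in> borel_measurable borel" and "\<And>z. z \<in> A \<Longrightarrow> \<bar>f z\<bar> \<le> w z" for f
    by (rule Bochner_Integration.integrable_bound[OF W(1)])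
      (use that BA in \<open>auto simp: indicator_def intro!: AE_I2 order_trans[OF that(2) abs_ge_self]\<close>)
  have "(\<lambda>n. LINT z|lborel. max (e n z) 0 * indicator B z) \<longlonglongrightarrow> (LINT z|(lborel :: 'a measure). 0)"
  proof (rule integral_dominated_convergence[OF _ _ W(1)])
    show "AE z in lborel. (\<lambda>n. max (e n z) 0 * indicator B z) \<longlonglongrightarrow> 0"
    proof (rule AE_I2)
      fix z
      show "(\<lambda>n. max (e n z) 0 * indicator B z) \<longlonglongrightarrow> 0"
      proof (cases "z \<in> B")
        case True
        then have "\<forall>\<^sub>F n in sequentially. e n z \<le> 0" using ev BA by blast
        then have "\<forall>\<^sub>F n in sequentially. max (e n z) 0 * indicator B z = 0" by eventually_elim (simp add: max_def)
        then show ?thesis by (rule tendsto_eventually)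
      qed simp
    qed
    show "AE z in lborel. norm (max (e n z) 0 * indicator B z) \<le> w z * indicator A z" for n
    proof (rule AE_I2)
      fix z
      show "norm (max (e n z) 0 * indicator B z) \<le> w z * indicator A z"
        using W(2)[of z n] BA by (auto simp: indicator_def max_def abs_le_iff split: if_splits)
    qed
  qed auto
  moreover have "(LINT z|lborel. e n z * indicator B z) \<le> (LINT z|lborel. max (e n z) 0 * indicator B z)" for n
  proof (intro integral_mono int)
    show "\<bar>max (e n z) 0\<bar> \<le> w z" if "z \<in> A" for z
      using W(2)[OF that, of n] by (auto simp: max_def abs_le_iff)
  qed (use W(2) in \<open>auto simp: indicator_def\<close>)
  ultimately have "(LINT z|lborel. E z * indicator B z) \<le> 0"
    using LIMSEQ_le[OF lim[of B]] BA by (auto simp: \<open>B \<in> sets borel\<close>)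
  moreover have nn: "0 \<le> E z * indicator B z" for z by (auto simp: B_def indicator_def)
  ultimately have "(LINT z|lborel. E z * indicator B z) = 0"
    using Bochner_Integration.integral_nonneg[where M=lborel, OF nn] by (simp add: order_antisym)
  then have "AE z in lborel. E z * indicator B z = 0"
    using integral_nonneg_eq_0_iff_AE[OF int[of E]] nn W(3) by auto
  then show ?thesis by eventually_elim (auto simp: B_def indicator_def split: if_splits)
qed


context obstacle_data
begin

text \<open>The quotients are set to zero off \<open>D\<close>, and those in space also on cells
  whose index is not interior, such as the cell next to the left end of a bounded interval. Thus the
  bound by \<open>w\<close> holds on the whole plane.\<close>

definition ut :: "nat \<Rightarrow> real \<times> real \<Rightarrow> real" where
  "ut n z = (if z \<in> D then (vn n (z + (h n, 0)) - vn n z) / h n else 0)"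
definition ux :: "nat \<Rightarrow> real \<times> real \<Rightarrow> real" where
  "ux n z = (if z \<in> D \<and> idx n (snd z) \<in> I n
     then (vn n (z + (0, k n)) - vn n (z - (0, k n))) / (2 * k n) else 0)"
definition uxx :: "nat \<Rightarrow> real \<times> real \<Rightarrow> real" where
  "uxx n z = (if z \<in> D \<and> idx n (snd z) \<in> I n
     then (vn n (z + (0, k n)) - 2 * vn n z + vn n (z - (0, k n))) / (k n)\<^sup>2 else 0)"
definition wt :: "nat \<Rightarrow> real" where "wt R = 1 + Ct R + \<bar>Cx (nxt R)\<bar> + \<bar>Cxx (nxt R)\<bar>"
text \<open>A locally bounded majorant, piecewise constant in space, for all three quotients and, on
  \<open>D\<close>, for \<open>U\<close> at the grid points; it is the weight used in
  \<open>weak_star_compact\<close>.\<close>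

definition w :: "real \<times> real \<Rightarrow> real" where "w z = wt (rx (snd z))"

section \<open>Bounds and measurability of the difference quotients\<close>

lemma w_pos: "0 < w z" using Ct0[of "rx (snd z)"] by (simp add: w_def wt_def add_pos_nonneg)

lemma rx_window:
  assumes "x \<in> Xo"
  shows "rx x \<in> W" "- (rx x * l) < x" "x < rx x * l"
proof -
  have "rx x \<in> W \<and> - (rx x * l) < x \<and> x < rx x * l"
    using W
  proof
    assume W1: "W = {1}"
    then have "rx x = 1" unfolding rx_def by (rule if_P)
    moreover obtain R where "R \<in> W" "- (R * l) < x" "x < R * l" using assms by (auto simp: Xo_def)
    ultimately show ?thesis using W1 by simp
  next
    assume W2: "W = {1..}"
    have "0 \<in> W \<or> 2 \<in> W" using W2 by simp
    then have "W \<noteq> {1}" using W2 by auto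
    then have e: "real (rx x) = of_int \<lfloor>\<bar>x\<bar> / l\<rfloor> + 1" and "1 \<le> rx x"
      using l by (auto simp: rx_def)
    have "\<bar>x\<bar> / l < real (rx x)" unfolding e by linarith
    then have "\<bar>x\<bar> < rx x * l" using l by (simp add: pos_divide_less_eq)
    then show ?thesis using W2 \<open>1 \<le> rx x\<close> by auto
  qed
  then show "rx x \<in> W" "- (rx x * l) < x" "x < rx x * l" by auto
qed

text \<open>For \<open>W = {1..}\<close> the enlarged window gives the margin on both sides; for
  \<open>W = {1}\<close> it comes from \<open>idx n x \<in> I n\<close>.\<close>

lemma idx_interior:
  assumes "x \<in> Xo" "idx n x \<in> I n"
  shows "- int (nxt (rx x) * N n) < idx n x" "idx n x < int (nxt (rx x) * N n)"
proof -
  have "- int (rx x * N n) \<le> idx n x" "idx n x < int (rx x * N n)"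
    using idx_window(1,3)[where R="rx x" and x=x and n=n] rx_window[OF assms(1)] by auto
  moreover obtain R where R: "R \<in> W" "- int (R * N n) < idx n x" "idx n x < int (R * N n)"
    using assms(2) by (auto simp: I_def)
  ultimately have "- int (nxt (rx x) * N n) < idx n x \<and> idx n x < int (nxt (rx x) * N n)"
  proof (cases "W = {1}")
    case True
    then have "nxt (rx x) = 1" unfolding nxt_def by (rule if_P)
    then show ?thesis using R True by simp
  next
    case False
    then have "nxt (rx x) = Suc (rx x)" unfolding nxt_def by (rule if_not_P)
    then have "int (nxt (rx x) * N n) = int (rx x * N n) + int (N n)" by simp
    moreover have "0 < int (N n)" using Npos[of n] by simp
    moreover have "- int (rx x * N n) \<le> idx n x" "idx n x < int (rx x * N n)" by fact+
    ultimately show ?thesis by linarith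
  qed
  then show "- int (nxt (rx x) * N n) < idx n x" "idx n x < int (nxt (rx x) * N n)" by auto
qed

lemma D_fst: "z \<in> D \<Longrightarrow> 0 < fst z \<and> fst z < T" and D_snd: "z \<in> D \<Longrightarrow> snd z \<in> Xo"
  by (auto simp: D_def)

lemma open_D: "open D" unfolding D_def Xo_def by (intro open_Times open_UN ballI) auto

lemma D_subset_Cl: "D \<subseteq> Cl"
  unfolding D_def Cl_def Xo_def Xc_def by force

lemma vn_shift:
  "0 \<le> fst z \<Longrightarrow> vn n (z + (h n, 0)) = V n (Suc (lev n (fst z))) (idx n (snd z))"
  "vn n (z + (0, k n)) = V n (lev n (fst z)) (idx n (snd z) + 1)"
  "vn n (z - (0, k n)) = V n (lev n (fst z)) (idx n (snd z) - 1)"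
  by (auto simp: vn_def lev_shift idx_shift)

lemma lev_T: "z \<in> D \<Longrightarrow> lev n (fst z) * h n \<le> T"
  using lev_bounds(1)[of "fst z" n] D_fst[of z] by auto

lemma u_bounds: "\<bar>ut n z\<bar> \<le> w z" "\<bar>ux n z\<bar> \<le> w z" "\<bar>uxx n z\<bar> \<le> w z"
proof -
  let ?x = "snd z"
  have w: "0 \<le> w z" "Ct (rx ?x) \<le> w z" "Cx (nxt (rx ?x)) \<le> w z" "Cxx (nxt (rx ?x)) \<le> w z"
    using Ct0[of "rx ?x"] w_pos[of z] by (auto simp: w_def wt_def)
  show "\<bar>ut n z\<bar> \<le> w z"
  proof (cases "z \<in> D")
    case True
    have "\<bar>V n (Suc (lev n (fst z))) (idx n ?x) - V n (lev n (fst z)) (idx n ?x)\<bar> \<le> h n * Ct (rx ?x)"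
      using idx_window(1)[where R="rx ?x" and x="?x" and n=n] rx_window[OF D_snd[OF True]]
      by (intro V_increment lev_T True) auto
    then have "\<bar>ut n z\<bar> \<le> Ct (rx ?x)"
      using hpos[of n] True D_fst[OF True] vn_shift(1)[of z n]
      by (simp add: ut_def vn_def[of n z] divide_le_eq mult.commute)
    then show ?thesis using w by linarith
  qed (simp add: ut_def w)
  show "\<bar>ux n z\<bar> \<le> w z"
  proof (cases "z \<in> D \<and> idx n ?x \<in> I n")
    case True
    then have D: "z \<in> D" and I: "idx n ?x \<in> I n" by auto
    have "\<bar>ux n z\<bar> \<le> Cx (nxt (rx ?x))"
      unfolding ux_def if_P[OF True] vn_shift vn_def[of n z]
      by (rule central_bounds(1)[OF lev_T[OF D] nxt_W[OF rx_window(1)[OF D_snd[OF D]]] idx_interior[OF D_snd[OF D] I]])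
    then show ?thesis using w by linarith
  qed (auto simp: ux_def w)
  show "\<bar>uxx n z\<bar> \<le> w z"
  proof (cases "z \<in> D \<and> idx n ?x \<in> I n")
    case True
    then have D: "z \<in> D" and I: "idx n ?x \<in> I n" by auto
    have "\<bar>uxx n z\<bar> \<le> Cxx (nxt (rx ?x))"
      unfolding uxx_def if_P[OF True] vn_shift vn_def[of n z]
      by (rule central_bounds(2)[OF lev_T[OF D] nxt_W[OF rx_window(1)[OF D_snd[OF D]]] idx_interior[OF D_snd[OF D] I]])
    then show ?thesis using w by linarith
  qed (auto simp: uxx_def w)
qed

lemma fst_snd_borel [measurable]:
  "fst \<in> borel_measurable (borel :: (real \<times> real) measure)"
  "snd \<in> borel_measurable (borel :: (real \<times> real) measure)"
  by (intro borel_measurable_continuous_onI continuous_intros)+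

lemma idx_measurable [measurable]: "(\<lambda>z::real\<times>real. idx n (snd z)) \<in> borel \<rightarrow>\<^sub>M count_space UNIV"
  unfolding idx_def by (rule measurable_compose[OF _ measurable_real_floor]) measurable

lemma D_borel [measurable]: "D \<in> sets borel" using open_D by simp

lemma vn_translate_measurable [measurable]:
  "(\<lambda>z. vn n (z + c)) \<in> borel_measurable borel" "(\<lambda>z. vn n (z - c)) \<in> borel_measurable borel"
  by measurable

lemma u_measurable [measurable]: "ut n \<in> borel_measurable borel"
  "ux n \<in> borel_measurable borel" "uxx n \<in> borel_measurable borel"
proof -
  have [measurable]: "Measurable.pred borel (\<lambda>z::real\<times>real. idx n (snd z) \<in> I n)" by measurable
  show "ut n \<in> borel_measurable borel" unfolding ut_def[abs_def] by measurable
  show "ux n \<in> borel_measurable borel" unfolding ux_def[abs_def] by measurable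
  show "uxx n \<in> borel_measurable borel" unfolding uxx_def[abs_def] by measurable
qed

lemma w_measurable [measurable]: "w \<in> borel_measurable borel"
proof -
  have "(\<lambda>z::real\<times>real. nat \<lfloor>\<bar>snd z\<bar> / l\<rfloor> + 1) \<in> borel \<rightarrow>\<^sub>M count_space UNIV" by measurable
  then have "(\<lambda>z::real\<times>real. rx (snd z)) \<in> borel \<rightarrow>\<^sub>M count_space UNIV" unfolding rx_def by simp
  from measurable_compose[OF this, of wt borel] show ?thesis unfolding w_def[abs_def] by simp
qed

lemma w_locally_bounded:
  assumes "bounded S"
  obtains c where "0 \<le> c" "\<And>z. z \<in> S \<Longrightarrow> w z \<le> c"
proof -
  obtain b0 where b0: "\<And>z. z \<in> S \<Longrightarrow> norm z \<le> b0" using assms bounded_iff by metis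
  define m where "m = nat \<lfloor>b0 / l\<rfloor> + 1"
  define c where "c = Max (wt ` {..m})"
  have wc: "wt i \<le> c" if "i \<le> m" for i using that by (auto simp: c_def)
  have "w z \<le> c" if "z \<in> S" for z
  proof -
    have "\<bar>snd z\<bar> \<le> b0" using b0[OF that] norm_snd_le[of "snd z" "fst z"] by simp
    then have "nat \<lfloor>\<bar>snd z\<bar> / l\<rfloor> \<le> nat \<lfloor>b0 / l\<rfloor>"
      using l by (intro nat_mono floor_mono divide_right_mono) auto
    then have "rx (snd z) \<le> m" by (auto simp: rx_def m_def)
    then show ?thesis using wc by (simp add: w_def)
  qed
  moreover have "0 \<le> c" using wc[of 0] w_pos[of "(0,0)"] Ct0[of 0] by (simp add: wt_def)
  ultimately show ?thesis using that by blast
qed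

lemma integrable_w_mult:
  assumes [measurable]: "\<eta> \<in> borel_measurable borel" and S: "compact S" and Q: "\<And>z. \<bar>\<eta> z\<bar> \<le> Q * indicator S z"
  shows "integrable lborel (\<lambda>z. w z * \<eta> z)"
proof -
  obtain c where c: "0 \<le> c" "\<And>z. z \<in> S \<Longrightarrow> w z \<le> c" using w_locally_bounded[OF compact_imp_bounded[OF S]] by metis
  show ?thesis
  proof (rule integrable_bounded_compact_support[OF _ S])
    fix z
    have "\<bar>w z * \<eta> z\<bar> = w z * \<bar>\<eta> z\<bar>" using w_pos[of z] by (simp add: abs_mult)
    also have "\<dots> \<le> w z * (Q * indicator S z)" using Q w_pos[of z] by (intro mult_left_mono) auto
    also have "\<dots> \<le> c * (Q * indicator S z)"
    proof (cases "z \<in> S")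
      case True
      then show ?thesis using c(2)[OF True] order_trans[OF abs_ge_zero Q[of z]] by (intro mult_right_mono)
    qed simp
    finally show "\<bar>w z * \<eta> z\<bar> \<le> (c * Q) * indicator S z" by (simp add: mult.assoc)
  qed measurable
qed

text \<open>Only for \<open>W = {1}\<close> is a cell of the interval missing, the leftmost one; its
  width \<open>k n\<close> tends to 0 while the compact set keeps a positive distance from the left
  end.\<close>

lemma eventually_interior:
  assumes "compact S" "S \<subseteq> D"
  shows "\<forall>\<^sub>F n in sequentially. \<forall>z\<in>S. idx n (snd z) \<in> I n"
  using W
proof
  assume W2: "W = {1..}"
  have "j \<in> I n" for n j
  proof -
    have "\<bar>j\<bar> < int ((nat \<bar>j\<bar> + 1) * N n)"
    proof -
      have "int (nat \<bar>j\<bar> + 1) * 1 \<le> int (nat \<bar>j\<bar> + 1) * int (N n)"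
        using Npos[of n] by (intro mult_left_mono) auto
      then show ?thesis by (simp add: distrib_right)
    qed
    then show ?thesis unfolding I_def by (intro UN_I[of "nat \<bar>j\<bar> + 1"]) (use W2 in auto)
  qed
  then show ?thesis by simp
next
  assume W1: "W = {1}"
  show ?thesis
  proof (cases "S = {}")
    case False
    obtain z0 where z0: "z0 \<in> S" "\<And>z. z \<in> S \<Longrightarrow> snd z0 \<le> snd z"
      using continuous_attains_inf[OF assms(1) False continuous_on_snd[OF continuous_on_id]] by auto
    have rx1: "rx x = 1" for x unfolding rx_def using W1 by (rule if_P)
    have "0 < snd z0 + l" using rx_window[OF D_snd, of z0] z0 assms(2) by (auto simp: rx1)
    then have "\<forall>\<^sub>F n in sequentially. k n < snd z0 + l" using order_tendstoD(2)[OF k_lim] by simp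
    then show ?thesis
    proof eventually_elim
      case (elim n)
      show ?case
      proof
        fix z assume z: "z \<in> S"
        have "- int (1 * N n) < idx n (snd z)" "idx n (snd z) < int (1 * N n)"
          using elim z0(2)[OF z] rx_window[OF D_snd, of z] z assms(2)
          by (intro idx_window(3,4); auto simp: rx1)+
        then show "idx n (snd z) \<in> I n" unfolding I_def by (intro UN_I[of 1]) (use W1 in auto)
      qed
    qed
  qed simp
qed

end

lemma minus_pair: "- (a, b) = (- a, - b :: real)" for a :: real by simp

context obstacle_data
begin

lemma locally_integrable_of_bound:
  assumes "f \<in> borel_measurable borel" "\<And>z. \<bar>f z\<bar> \<le> c + w z"
  shows "locally_integrable S f"
  unfolding locally_integrable_def
proof (intro allI impI)
  fix S' assume S': "compact S' \<and> S' \<subseteq> S"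
  then obtain d where d: "0 \<le> d" "\<And>z. z \<in> S' \<Longrightarrow> w z \<le> d"
    using w_locally_bounded[OF compact_imp_bounded] by metis
  show "integrable (lebesgue_on S') f"
    by (rule integrable_lebesgue_on_bounded[OF assms(1), of S' "c + d"])
       (use S' d assms(2) in \<open>auto intro: lmeasurable_compact order_trans[OF assms(2)]\<close>)
qed

section \<open>Summation by parts and identification of the weak derivatives\<close>

lemma translate_test:
  assumes \<eta>: "\<eta> \<in> test_functions S"
  shows "(LINT z|lborel. vn n (z + c) * \<eta> z) = (LINT z|lborel. vn n z * \<eta> (z + - c))"
    "integrable lborel (\<lambda>z. vn n (z + c) * \<eta> z)" "integrable lborel (\<lambda>z. vn n z * \<eta> (z + c))"
    "integrable lborel (\<lambda>z. vn n z * \<eta> z)"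
proof -
  note \<eta>' = test_function_integrable[OF \<eta>]
  show "(LINT z|lborel. vn n (z + c) * \<eta> z) = (LINT z|lborel. vn n z * \<eta> (z + - c))"
    using integral_translate[OF vn_measurable \<eta>'(2), of n c] by simp
  show "integrable lborel (\<lambda>z. vn n (z + c) * \<eta> z)" "integrable lborel (\<lambda>z. vn n z * \<eta> (z + c))"
    "integrable lborel (\<lambda>z. vn n z * \<eta> z)"
    by (auto intro!: integrable_bounded_mult[where M=M] vn_abs_le \<eta>' integrable_translate)
qed

lemma test_w_integrable:
  assumes \<eta>: "\<eta> \<in> test_functions S"
  shows "integrable lborel (\<lambda>z. w z * \<eta> z)"
proof -
  obtain S' where S': "compact S'" "\<And>z. z \<notin> S' \<Longrightarrow> \<eta> z = 0"
    using test_function_support[OF \<eta>] by metis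
  obtain Q where "0 < Q" "\<And>z. \<bar>\<eta> z\<bar> \<le> Q"
    using continuous_compact_support_bounded[OF test_function_continuous[OF \<eta>] S'] by metis
  then show ?thesis using S' by (intro integrable_w_mult[OF test_function_integrable(2)[OF \<eta>] S'(1), of Q])
      (auto simp: indicator_def)
qed

lemma test_outside: "\<eta> \<in> test_functions D \<Longrightarrow> z \<notin> D \<Longrightarrow> \<eta> z = 0"
  using test_function_support[of \<eta> D] by (metis subsetD)

text \<open>Translation invariance moves the forward quotient of \<open>vn\<close> to a backward
  quotient of \<open>\<eta>\<close>. No boundary terms arise because \<open>vn\<close> is defined on
  the plane, and the truncation to \<open>D\<close> in \<open>ut\<close> is invisible to
  \<open>\<eta>\<close>.\<close>

lemma ut_test:
  assumes \<eta>: "\<eta> \<in> test_functions D"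
  shows "(LINT z|lborel. ut n z * \<eta> z)
    = - (LINT z|lborel. vn n z * ((\<eta> (z + (- h n, 0)) - \<eta> z) / (- h n)))"
proof -
  note tr = translate_test[OF \<eta>, of n]
  have "(LINT z|lborel. ut n z * \<eta> z) = (LINT z|lborel. (vn n (z + (h n, 0)) * \<eta> z - vn n z * \<eta> z) / h n)"
    by (intro Bochner_Integration.integral_cong refl)
      (auto simp: ut_def test_outside[OF \<eta>] left_diff_distrib)
  also have "\<dots> = ((LINT z|lborel. vn n z * \<eta> (z + (- h n, 0))) - (LINT z|lborel. vn n z * \<eta> z)) / h n"
    using tr(1,2)[of "(h n, 0)"] tr(4) by (simp add: minus_pair)
  also have "\<dots> = (LINT z|lborel. (vn n z * \<eta> (z + (- h n, 0)) - vn n z * \<eta> z) / h n)"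
    using tr(3)[of "(- h n, 0)"] tr(4) by simp
  also have "\<dots> = (LINT z|lborel. - (vn n z * ((\<eta> (z + (- h n, 0)) - \<eta> z) / (- h n))))"
    by (intro Bochner_Integration.integral_cong refl) (simp add: right_diff_distrib diff_divide_distrib)
  finally show ?thesis by simp
qed

text \<open>The central quotient becomes the mean of a forward and a backward quotient of
  \<open>\<eta>\<close>, both of which converge to \<open>dx \<eta>\<close>. The condition on
  indices says that the support of \<open>\<eta>\<close> avoids the cells truncated in
  \<open>ux\<close>.\<close>

lemma ux_test:
  assumes \<eta>: "\<eta> \<in> test_functions D" and int: "\<And>z. \<eta> z \<noteq> 0 \<Longrightarrow> idx n (snd z) \<in> I n"
  shows "(LINT z|lborel. ux n z * \<eta> z)
    = - ((LINT z|lborel. vn n z * ((\<eta> (z + (0, k n)) - \<eta> z) / k n))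
        + (LINT z|lborel. vn n z * ((\<eta> (z + (0, - k n)) - \<eta> z) / (- k n)))) / 2"
proof -
  note tr = translate_test[OF \<eta>, of n]
  have mp: "z - (0, k n) = z + (0, - k n)" for z :: "real \<times> real" by (cases z) simp
  have "(LINT z|lborel. ux n z * \<eta> z)
      = (LINT z|lborel. (vn n (z + (0, k n)) * \<eta> z - vn n (z + (0, - k n)) * \<eta> z) / (2 * k n))"
  proof (intro Bochner_Integration.integral_cong refl)
    fix z
    show "ux n z * \<eta> z = (vn n (z + (0, k n)) * \<eta> z - vn n (z + (0, - k n)) * \<eta> z) / (2 * k n)"
      using int[of z] test_outside[OF \<eta>, of z] by (cases "\<eta> z = 0") (auto simp: ux_def mp left_diff_distrib)
  qed
  also have "\<dots> = ((LINT z|lborel. vn n z * \<eta> (z + (0, - k n))) - (LINT z|lborel. vn n z * \<eta> (z + (0, k n)))) / (2 * k n)"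
    using tr(1,2)[of "(0, k n)"] tr(1,2)[of "(0, - k n)"] by (simp add: minus_pair)
  also have "\<dots> = - ((LINT z|lborel. (vn n z * \<eta> (z + (0, k n)) - vn n z * \<eta> z) / k n)
        + (LINT z|lborel. (vn n z * \<eta> (z + (0, - k n)) - vn n z * \<eta> z) / (- k n))) / 2"
    using tr(3)[of "(0, k n)"] tr(3)[of "(0, - k n)"] tr(4) kpos[of n] by (simp add: field_simps)
  finally show ?thesis by (simp add: right_diff_distrib)
qed

lemma uxx_test:
  assumes \<eta>: "\<eta> \<in> test_functions D" and int: "\<And>z. \<eta> z \<noteq> 0 \<Longrightarrow> idx n (snd z) \<in> I n"
  shows "(LINT z|lborel. uxx n z * \<eta> z)
    = (LINT z|lborel. vn n z * ((\<eta> (z + (0, k n)) - 2 * \<eta> z + \<eta> (z - (0, k n))) / (k n)\<^sup>2))"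
proof -
  note tr = translate_test[OF \<eta>, of n]
  have mp: "z - (0, k n) = z + (0, - k n)" for z :: "real \<times> real" by (cases z) simp
  have "(LINT z|lborel. uxx n z * \<eta> z)
      = (LINT z|lborel. (vn n (z + (0, k n)) * \<eta> z - 2 * (vn n z * \<eta> z) + vn n (z + (0, - k n)) * \<eta> z) / (k n)\<^sup>2)"
  proof (intro Bochner_Integration.integral_cong refl)
    fix z
    show "uxx n z * \<eta> z = (vn n (z + (0, k n)) * \<eta> z - 2 * (vn n z * \<eta> z) + vn n (z + (0, - k n)) * \<eta> z) / (k n)\<^sup>2"
      using int[of z] test_outside[OF \<eta>, of z] by (cases "\<eta> z = 0") (auto simp: uxx_def mp algebra_simps)
  qed
  also have "\<dots> = ((LINT z|lborel. vn n z * \<eta> (z + (0, - k n))) - 2 * (LINT z|lborel. vn n z * \<eta> z)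
       + (LINT z|lborel. vn n z * \<eta> (z + (0, k n)))) / (k n)\<^sup>2"
    using tr(1,2)[of "(0, k n)"] tr(1,2)[of "(0, - k n)"] tr(4) by (simp add: minus_pair)
  also have "\<dots> = (LINT z|lborel. (vn n z * \<eta> (z + (0, - k n)) - 2 * (vn n z * \<eta> z) + vn n z * \<eta> (z + (0, k n))) / (k n)\<^sup>2)"
    using tr(3)[of "(0, k n)"] tr(3)[of "(0, - k n)"] tr(4) by simp
  also have "\<dots> = (LINT z|lborel. vn n z * ((\<eta> (z + (0, k n)) - 2 * \<eta> z + \<eta> (z - (0, k n))) / (k n)\<^sup>2))"
    by (intro Bochner_Integration.integral_cong refl) (simp add: mp algebra_simps)
  finally show ?thesis .
qed

lemma weak_partialI:
  assumes v: "v \<in> borel_measurable borel" "\<And>z. \<bar>v z\<bar> \<le> M"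
    and g: "g \<in> borel_measurable borel" "\<And>z. \<bar>g z\<bar> \<le> w z"
    and eq: "\<And>\<eta>. \<eta> \<in> test_functions D \<Longrightarrow>
       (LINT z|lborel. v z * (dt ^^ i) ((dx ^^ j) \<eta>) z) = (- 1) ^ (i + j) * (LINT z|lborel. g z * \<eta> z)"
    and reg: "\<And>\<eta>. \<eta> \<in> test_functions D \<Longrightarrow> (dt ^^ i) ((dx ^^ j) \<eta>) \<in> borel_measurable borel"
      "\<And>\<eta> z. \<eta> \<in> test_functions D \<Longrightarrow> z \<notin> D \<Longrightarrow> (dt ^^ i) ((dx ^^ j) \<eta>) z = 0"
  shows "weak_partial i j D v g"
  unfolding weak_partial_def
proof (intro conjI ballI)
  have bd: "\<bar>v z\<bar> \<le> M + w z" "\<bar>g z\<bar> \<le> 0 + w z" for z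
    using v(2)[of z] g(2)[of z] w_pos[of z] by auto
  show "locally_integrable D v" by (rule locally_integrable_of_bound[OF v(1) bd(1)])
  show "locally_integrable D g" by (rule locally_integrable_of_bound[OF g(1) bd(2)])
  fix \<eta> assume \<eta>: "\<eta> \<in> test_functions D"
  note [measurable] = v(1) g(1) reg(1)[OF \<eta>] test_function_integrable(2)[OF \<eta>]
  show "(LINT z|lebesgue_on D. v z * (dt ^^ i) ((dx ^^ j) \<eta>) z) = (- 1) ^ (i + j) * (LINT z|lebesgue_on D. g z * \<eta> z)"
    using eq[OF \<eta>] reg(2)[OF \<eta>] test_outside[OF \<eta>]
    by (subst (1 2) integral_lebesgue_on_eq_lborel) auto
qed

lemma test_regular:
  assumes \<eta>: "\<eta> \<in> test_functions D"
  shows "dt \<eta> \<in> borel_measurable borel" "dx \<eta> \<in> borel_measurable borel" "dx (dx \<eta>) \<in> borel_measurable borel"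
    "z \<notin> D \<Longrightarrow> dt \<eta> z = 0 \<and> dx \<eta> z = 0 \<and> dx (dx \<eta>) z = 0"
proof -
  show "dt \<eta> \<in> borel_measurable borel" "dx \<eta> \<in> borel_measurable borel" "dx (dx \<eta>) \<in> borel_measurable borel"
    using test_function_Ck[OF \<eta>, of "Suc (Suc 0)"] by (auto intro: borel_measurable_continuous_onI)
  show "dt \<eta> z = 0 \<and> dx \<eta> z = 0 \<and> dx (dx \<eta>) z = 0" if "z \<notin> D"
    using test_function_support[OF \<eta>] that by (metis subsetD)
qed

lemma subseq_lim:
  assumes "strict_mono (s :: nat \<Rightarrow> nat)"
  shows "(\<lambda>n. h (s n)) \<longlonglongrightarrow> 0" "(\<lambda>n. k (s n)) \<longlonglongrightarrow> 0"
  using LIMSEQ_subseq_LIMSEQ[OF h_lim assms] LIMSEQ_subseq_LIMSEQ[OF k_lim assms] by (auto simp: o_def)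

text \<open>The integrals of the quotients against a test function have two limits that must agree:
  the integral of \<open>g\<close> against it, by the convergence premise, and up to sign that of
  \<open>v\<close> against its derivative, by summation by parts.\<close>

lemma weak_derivative_limits:
  assumes s: "strict_mono (s :: nat \<Rightarrow> nat)"
    and v: "v \<in> borel_measurable borel" "\<And>z. \<bar>v z\<bar> \<le> M" and lim: "\<And>z. z \<in> Cl \<Longrightarrow> (\<lambda>n. vn (s n) z) \<longlonglongrightarrow> v z"
    and g: "g \<in> borel_measurable borel" "\<And>z. \<bar>g z\<bar> \<le> w z"
  shows "(\<And>\<eta>. \<eta> \<in> borel_measurable borel \<Longrightarrow> integrable lborel (\<lambda>z. w z * \<eta> z) \<Longrightarrow>
       (\<lambda>n. LINT z|lborel. ut (s n) z * \<eta> z) \<longlonglongrightarrow> (LINT z|lborel. g z * \<eta> z)) \<Longrightarrow> weak_partial 1 0 D v g" (is "PROP ?Pt \<Longrightarrow> _")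
    and "(\<And>\<eta>. \<eta> \<in> borel_measurable borel \<Longrightarrow> integrable lborel (\<lambda>z. w z * \<eta> z) \<Longrightarrow>
       (\<lambda>n. LINT z|lborel. ux (s n) z * \<eta> z) \<longlonglongrightarrow> (LINT z|lborel. g z * \<eta> z)) \<Longrightarrow> weak_partial 0 1 D v g" (is "PROP ?Px \<Longrightarrow> _")
    and "(\<And>\<eta>. \<eta> \<in> borel_measurable borel \<Longrightarrow> integrable lborel (\<lambda>z. w z * \<eta> z) \<Longrightarrow>
       (\<lambda>n. LINT z|lborel. uxx (s n) z * \<eta> z) \<longlonglongrightarrow> (LINT z|lborel. g z * \<eta> z)) \<Longrightarrow> weak_partial 0 2 D v g" (is "PROP ?Pxx \<Longrightarrow> _")
proof -
  have limD: "(\<lambda>n. vn (s n) z) \<longlonglongrightarrow> v z" if "z \<in> D" for z using lim D_subset_Cl that by blast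
  have hk: "h n \<noteq> 0" "\<bar>h n\<bar> \<le> 1" "k n \<noteq> 0" "\<bar>k n\<bar> \<le> 1" for n
    using hpos[of n] h_le_1[of n] kpos[of n] k_le_1[of n] by auto
  \<comment> \<open>The mesh is eventually so fine that the support of the test function avoids the
    cells truncated in \<open>ux\<close> and \<open>uxx\<close>.\<close>
  have ev: "\<forall>\<^sub>F n in sequentially. \<forall>z. \<eta> z \<noteq> 0 \<longrightarrow> idx (s n) (snd z) \<in> I (s n)"
    if \<eta>: "\<eta> \<in> test_functions D" for \<eta>
  proof -
    obtain S where S: "compact S" "S \<subseteq> D" "\<And>z. z \<notin> S \<Longrightarrow> \<eta> z = 0"
      using test_function_support[OF \<eta>] by metis
    have "\<forall>\<^sub>F n in sequentially. \<forall>z\<in>S. idx (s n) (snd z) \<in> I (s n)"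
      by (rule eventually_subseq[OF s eventually_interior[OF S(1,2)]])
    then show ?thesis by eventually_elim (use S(3) in blast)
  qed
  {
    assume P: "PROP ?Pt"
    show "weak_partial 1 0 D v g"
    proof (rule weak_partialI[OF v g])
      fix \<eta> assume \<eta>: "\<eta> \<in> test_functions D"
      have "(\<lambda>n. LINT z|lborel. vn (s n) z * ((\<eta> (z + (- h (s n), 0)) - \<eta> z) / (- h (s n))))
          \<longlonglongrightarrow> (LINT z|lborel. v z * dt \<eta> z)"
        using subseq_lim[OF s] hk
        by (intro test_quotient_dt[OF \<eta> vn_measurable v(1) vn_abs_le limD]) (auto intro: tendsto_minus_cancel)
      from tendsto_minus[OF this]
      have "(\<lambda>n. LINT z|lborel. ut (s n) z * \<eta> z) \<longlonglongrightarrow> - (LINT z|lborel. v z * dt \<eta> z)"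
        unfolding ut_test[OF \<eta>] .
      then have "(LINT z|lborel. g z * \<eta> z) = - (LINT z|lborel. v z * dt \<eta> z)"
        using P[OF test_function_integrable(2)[OF \<eta>] test_w_integrable[OF \<eta>]] LIMSEQ_unique by blast
      then show "(LINT z|lborel. v z * (dt ^^ 1) ((dx ^^ 0) \<eta>) z) = (- 1) ^ (1 + 0) * (LINT z|lborel. g z * \<eta> z)"
        by simp
    qed (auto simp: test_regular)
  next
    assume P: "PROP ?Px"
    show "weak_partial 0 1 D v g"
    proof (rule weak_partialI[OF v g])
      fix \<eta> assume \<eta>: "\<eta> \<in> test_functions D"
      have 1: "(\<lambda>n. LINT z|lborel. vn (s n) z * ((\<eta> (z + (0, k (s n))) - \<eta> z) / k (s n)))
          \<longlonglongrightarrow> (LINT z|lborel. v z * dx \<eta> z)"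
        using subseq_lim[OF s] hk
        by (intro test_quotient_dx[OF \<eta> vn_measurable v(1) vn_abs_le limD]) auto
      have 2: "(\<lambda>n. LINT z|lborel. vn (s n) z * ((\<eta> (z + (0, - k (s n))) - \<eta> z) / (- k (s n))))
          \<longlonglongrightarrow> (LINT z|lborel. v z * dx \<eta> z)"
        using subseq_lim[OF s] hk
        by (intro test_quotient_dx[OF \<eta> vn_measurable v(1) vn_abs_le limD]) (auto intro: tendsto_minus_cancel)
      have "(\<lambda>n. LINT z|lborel. ux (s n) z * \<eta> z) \<longlonglongrightarrow> - ((LINT z|lborel. v z * dx \<eta> z) + (LINT z|lborel. v z * dx \<eta> z)) / 2"
      proof (rule Lim_transform_eventually)
        show "(\<lambda>n. - ((LINT z|lborel. vn (s n) z * ((\<eta> (z + (0, k (s n))) - \<eta> z) / k (s n)))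
          + (LINT z|lborel. vn (s n) z * ((\<eta> (z + (0, - k (s n))) - \<eta> z) / (- k (s n))))) / 2)
           \<longlonglongrightarrow> - ((LINT z|lborel. v z * dx \<eta> z) + (LINT z|lborel. v z * dx \<eta> z)) / 2"
          by (intro tendsto_intros 1 2) simp
        show "\<forall>\<^sub>F n in sequentially. - ((LINT z|lborel. vn (s n) z * ((\<eta> (z + (0, k (s n))) - \<eta> z) / k (s n)))
          + (LINT z|lborel. vn (s n) z * ((\<eta> (z + (0, - k (s n))) - \<eta> z) / (- k (s n))))) / 2
            = (LINT z|lborel. ux (s n) z * \<eta> z)"
          using ev[OF \<eta>] by eventually_elim (rule ux_test[OF \<eta>, symmetric], blast)
      qed
      then have "(LINT z|lborel. g z * \<eta> z) = - ((LINT z|lborel. v z * dx \<eta> z) + (LINT z|lborel. v z * dx \<eta> z)) / 2"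
        using P[OF test_function_integrable(2)[OF \<eta>] test_w_integrable[OF \<eta>]] LIMSEQ_unique by blast
      then show "(LINT z|lborel. v z * (dt ^^ 0) ((dx ^^ 1) \<eta>) z) = (- 1) ^ (0 + 1) * (LINT z|lborel. g z * \<eta> z)"
        by simp
    qed (auto simp: test_regular)
  next
    assume P: "PROP ?Pxx"
    show "weak_partial 0 2 D v g"
    proof (rule weak_partialI[OF v g])
      fix \<eta> assume \<eta>: "\<eta> \<in> test_functions D"
      have "(\<lambda>n. LINT z|lborel. uxx (s n) z * \<eta> z) \<longlonglongrightarrow> (LINT z|lborel. v z * dx (dx \<eta>) z)"
      proof (rule Lim_transform_eventually)
        show "(\<lambda>n. LINT z|lborel. vn (s n) z * ((\<eta> (z + (0, k (s n))) - 2 * \<eta> z + \<eta> (z - (0, k (s n)))) / (k (s n))\<^sup>2))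
            \<longlonglongrightarrow> (LINT z|lborel. v z * dx (dx \<eta>) z)"
          using subseq_lim[OF s] hk
          by (intro test_quotient_dxx[OF \<eta> vn_measurable v(1) vn_abs_le limD]) auto
        show "\<forall>\<^sub>F n in sequentially.
          (LINT z|lborel. vn (s n) z * ((\<eta> (z + (0, k (s n))) - 2 * \<eta> z + \<eta> (z - (0, k (s n)))) / (k (s n))\<^sup>2))
            = (LINT z|lborel. uxx (s n) z * \<eta> z)"
          using ev[OF \<eta>] by eventually_elim (rule uxx_test[OF \<eta>, symmetric], blast)
      qed
      then have "(LINT z|lborel. g z * \<eta> z) = (LINT z|lborel. v z * dx (dx \<eta>) z)"
        using P[OF test_function_integrable(2)[OF \<eta>] test_w_integrable[OF \<eta>]] LIMSEQ_unique by blast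
      then show "(LINT z|lborel. v z * (dt ^^ 0) ((dx ^^ 2) \<eta>) z) = (- 1) ^ (0 + 2) * (LINT z|lborel. g z * \<eta> z)"
        by (simp add: numeral_2_eq_2)
    qed (auto simp: test_regular numeral_2_eq_2)
  }
qed

text \<open>The residual of the scheme in terms of the step functions; \<open>U\<close> is evaluated
  at the grid point, as in the scheme.\<close>

definition res :: "nat \<Rightarrow> real \<times> real \<Rightarrow> real" where
  "res n z = ut n z - a * uxx n z - b * ux n z + r * vn n z - U (idx n (snd z) * k n)"

lemma U_measurable [measurable]: "U \<in> borel_measurable borel"
  using U_cont by (rule borel_measurable_continuous_onI)

lemma res_measurable [measurable]: "res n \<in> borel_measurable borel"
  unfolding res_def[abs_def] by measurable

lemma U_grid_bound: "z \<in> D \<Longrightarrow> \<bar>U (idx n (snd z) * k n)\<bar> \<le> w z"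
proof -
  assume z: "z \<in> D"
  have "- int (rx (snd z) * N n) \<le> idx n (snd z)"
    using idx_window(1)[where R="rx (snd z)" and x="snd z" and n=n] rx_window[OF D_snd[OF z]] by auto
  then have "- real (rx (snd z) * N n) \<le> idx n (snd z)"
    by (metis of_int_le_iff of_int_minus of_int_of_nat_eq)
  from mult_left_mono[OF weight_le[OF this] C] have "\<bar>U (idx n (snd z) * k n)\<bar> \<le> Ct (rx (snd z))"
    using U[of "idx n (snd z) * k n"] C_le_Ct(2)[of "rx (snd z)"] by linarith
  also have "\<dots> \<le> w z" by (simp add: w_def wt_def)
  finally show ?thesis .
qed

lemma res_bound: assumes "z \<in> D" shows "\<bar>res n z\<bar> \<le> (2 + a + \<bar>b\<bar>) * w z + r * M"
proof -
  have "\<bar>a * uxx n z\<bar> \<le> a * w z" "\<bar>b * ux n z\<bar> \<le> \<bar>b\<bar> * w z" "\<bar>r * vn n z\<bar> \<le> r * M"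
    using a r u_bounds[of n z] vn_abs_le[of n z] by (auto simp: abs_mult intro!: mult_left_mono)
  then show ?thesis
    using u_bounds(1)[of n z] U_grid_bound[OF assms, of n] unfolding res_def distrib_right by linarith
qed

lemma res_eq:
  assumes "z \<in> D" "idx n (snd z) \<in> I n"
  shows "res n z = (V n (Suc (lev n (fst z))) (idx n (snd z)) - V n (lev n (fst z)) (idx n (snd z))) / h n
     - scheme.lap n (V n (lev n (fst z))) (idx n (snd z)) + r * V n (lev n (fst z)) (idx n (snd z)) - U (idx n (snd z) * k n)"
  using assms D_fst[OF assms(1)]
  by (simp add: res_def ut_def ux_def uxx_def vn_shift vn_def[of n z] lap_eq)

text \<open>The sign of the residual is decided by the obstacle at the next level, whereas the limit
  sees the current level and the current time; both gaps are of order \<open>h n\<close>.\<close>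

lemma next_level:
  assumes "z \<in> D"
  shows "\<bar>V n (Suc (lev n (fst z))) (idx n (snd z)) - vn n z\<bar> \<le> h n * w z"
    "\<bar>real (Suc (lev n (fst z))) * h n - fst z\<bar> \<le> h n"
proof -
  have "V n (Suc (lev n (fst z))) (idx n (snd z)) - vn n z = h n * ut n z"
    using assms D_fst[OF assms] hpos[of n] by (simp add: ut_def vn_shift)
  then show "\<bar>V n (Suc (lev n (fst z))) (idx n (snd z)) - vn n z\<bar> \<le> h n * w z"
    using u_bounds(1)[of n z] hpos[of n] by (simp add: abs_mult)
  show "\<bar>real (Suc (lev n (fst z))) * h n - fst z\<bar> \<le> h n"
    using lev_bounds[of "fst z" n] D_fst[OF assms] by (simp add: distrib_right)
qed

text \<open>At a point where \<open>v\<close> is above \<open>lo\<close>, the scheme is eventually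
  strictly above the lower obstacle as well, so its residual is eventually nonpositive there;
  \<open>AE_nonpos_of_weak_limit\<close> transfers the sign to \<open>E\<close>. The upper obstacle
  is treated alike.\<close>

lemma obstacle_inequalities:
  assumes s: "strict_mono (s :: nat \<Rightarrow> nat)"
    and v [measurable]: "v \<in> borel_measurable borel" and vM: "\<And>z. \<bar>v z\<bar> \<le> M"
    and lim: "\<And>z. z \<in> Cl \<Longrightarrow> (\<lambda>n. vn (s n) z) \<longlonglongrightarrow> v z"
    and g [measurable]: "vt \<in> borel_measurable borel" "vx \<in> borel_measurable borel" "vxx \<in> borel_measurable borel"
    and gw: "\<And>z. \<bar>vt z\<bar> \<le> w z" "\<And>z. \<bar>vx z\<bar> \<le> w z" "\<And>z. \<bar>vxx z\<bar> \<le> w z"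
    and wlim: "\<And>\<eta>. \<eta> \<in> borel_measurable borel \<Longrightarrow> integrable lborel (\<lambda>z. w z * \<eta> z) \<Longrightarrow>
       (\<lambda>n. LINT z|lborel. ut (s n) z * \<eta> z) \<longlonglongrightarrow> (LINT z|lborel. vt z * \<eta> z)"
     "\<And>\<eta>. \<eta> \<in> borel_measurable borel \<Longrightarrow> integrable lborel (\<lambda>z. w z * \<eta> z) \<Longrightarrow>
       (\<lambda>n. LINT z|lborel. ux (s n) z * \<eta> z) \<longlonglongrightarrow> (LINT z|lborel. vx z * \<eta> z)"
     "\<And>\<eta>. \<eta> \<in> borel_measurable borel \<Longrightarrow> integrable lborel (\<lambda>z. w z * \<eta> z) \<Longrightarrow>
       (\<lambda>n. LINT z|lborel. uxx (s n) z * \<eta> z) \<longlonglongrightarrow> (LINT z|lborel. vxx z * \<eta> z)"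
  defines "E \<equiv> \<lambda>z. vt z - a * vxx z - b * vx z + r * v z - U (snd z)"
  shows "AE z in lborel. z \<in> D \<longrightarrow>
     (lo (fst z) < v z \<longrightarrow> E z \<le> 0) \<and> (v z < hi (fst z) \<longrightarrow> 0 \<le> E z)"
proof -
  have limD: "(\<lambda>n. vn (s n) z) \<longlonglongrightarrow> v z" if "z \<in> D" for z using lim D_subset_Cl that by blast
  have [measurable]: "E \<in> borel_measurable borel" unfolding E_def by measurable
  have Ulim: "(\<lambda>n. U (idx (s n) (snd z) * k (s n))) \<longlonglongrightarrow> U (snd z)" for z :: "real \<times> real"
  proof -
    have "(\<lambda>n. idx (s n) (snd z) * k (s n)) \<longlonglongrightarrow> snd z"
    proof (rule LIM_zero_cancel, rule Lim_null_comparison[OF always_eventually subseq_lim(2)[OF s]], rule allI)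
      fix n
      show "norm (idx (s n) (snd z) * k (s n) - snd z) \<le> k (s n)"
        using idx_bounds[where n="s n" and x="snd z"] unfolding real_norm_def by linarith
    qed
    then show ?thesis using U_cont continuous_on_eq_continuous_at[OF open_UNIV]
      by (intro isCont_tendsto_compose[where g=U]) auto
  qed
  \<comment> \<open>On the strip \<open>D\<close> is unbounded, while the majorants are known to be
    integrable on bounded pieces.\<close>
  define DR where "DR R = {z \<in> D. \<bar>snd z\<bar> \<le> real R}" for R
  have [measurable]: "DR R \<in> sets borel" for R unfolding DR_def by measurable
  have DR: "DR R \<subseteq> cbox (0, - real R) (T, real R)" for R
    using D_fst by (auto simp: DR_def cbox_Pair_eq abs_le_iff) (metis fst_conv less_imp_le)+
  \<comment> \<open>From here on \<open>W\<close> is a majorant of the residuals and of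
    \<open>E\<close>; it hides the index set of the locale.\<close>
  define W where "W z = (2 + a + \<bar>b\<bar>) * w z + r * M + \<bar>U (snd z)\<bar>" for z
  have w_int: "integrable lborel (\<lambda>z. w z * indicator B z)" if "B \<in> sets borel" "B \<subseteq> DR R" for B R
    using that DR[of R] by (intro integrable_w_mult[of _ "cbox (0, - real R) (T, real R)" 1])
      (auto simp: indicator_def)
  have [measurable]: "W \<in> borel_measurable borel" unfolding W_def by measurable
  have W_int: "integrable lborel (\<lambda>z. W z * indicator B z)" if B [measurable]: "B \<in> sets borel" and "B \<subseteq> DR R" for B R
  proof -
    obtain cU where cU: "\<And>z. z \<in> cbox (0, - real R) (T, real R) \<Longrightarrow> \<bar>U (snd z)\<bar> \<le> cU"
    proof -
      have "compact (U ` {- real R..real R})"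
        using U_cont by (intro compact_continuous_image) (auto intro: continuous_on_subset)
      then obtain cU where "\<And>x. x \<in> {- real R..real R} \<Longrightarrow> \<bar>U x\<bar> \<le> cU"
        using compact_imp_bounded bounded_iff by (metis image_eqI real_norm_def)
      then show ?thesis using that[of cU] by (auto simp: cbox_Pair_eq)
    qed
    have bdd: "integrable lborel (\<lambda>z. (r * M + \<bar>U (snd z)\<bar>) * indicator B z)"
    proof (rule integrable_bounded_compact_support[of _ "cbox (0, - real R) (T, real R)" "r * M + cU"])
      fix z
      show "\<bar>(r * M + \<bar>U (snd z)\<bar>) * indicator B z\<bar> \<le> (r * M + cU) * indicator (cbox (0, - real R) (T, real R)) z"
        using cU[of z] that(2) DR[of R] r M0 by (cases "z \<in> B") (auto simp: indicator_def)
    qed auto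
    have "integrable lborel (\<lambda>z. (2 + a + \<bar>b\<bar>) * (w z * indicator B z))"
      by (intro integrable_mult_right w_int[OF B that(2)])
    from Bochner_Integration.integrable_add[OF this bdd] show ?thesis
      by (simp add: W_def algebra_simps)
  qed
  have W_bounds: "\<bar>res n z\<bar> \<le> W z" "\<bar>E z\<bar> \<le> W z" if "z \<in> D" for n z
  proof -
    show "\<bar>res n z\<bar> \<le> W z" using res_bound[OF that, of n] unfolding W_def by linarith
    have "\<bar>a * vxx z\<bar> \<le> a * w z" "\<bar>b * vx z\<bar> \<le> \<bar>b\<bar> * w z" "\<bar>r * v z\<bar> \<le> r * M"
      using a r gw[of z] vM[of z] by (auto simp: abs_mult intro!: mult_left_mono)
    then show "\<bar>E z\<bar> \<le> W z" using gw(1)[of z] w_pos[of z] unfolding W_def E_def distrib_right by linarith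
  qed
  have res_lim: "(\<lambda>n. LINT z|lborel. res (s n) z * indicator B z) \<longlonglongrightarrow> (LINT z|lborel. E z * indicator B z)"
    if B [measurable]: "B \<in> sets borel" and BR: "B \<subseteq> DR R" for B R
  proof -
    have BD: "B \<subseteq> D" using BR by (auto simp: DR_def)
    \<comment> \<open>The zero-order part converges pointwise under a majorant; weak convergence is
      reserved for the difference quotients.\<close>
    define f where "f n z = r * vn (s n) z - U (idx (s n) (snd z) * k (s n))" for n z
    have fW: "\<bar>f n z\<bar> \<le> W z" if "z \<in> D" for n z
    proof -
      have "\<bar>r * vn (s n) z\<bar> \<le> r * M" using r vn_abs_le[of "s n" z] by (simp add: abs_mult mult_left_mono)
      moreover have "1 * w z \<le> (2 + a + \<bar>b\<bar>) * w z" using a w_pos[of z] by (intro mult_right_mono) auto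
      ultimately show ?thesis using U_grid_bound[OF that, of "s n"] unfolding f_def W_def by linarith
    qed
    have [measurable]: "f n \<in> borel_measurable borel" for n unfolding f_def by measurable
    have f_lim: "(\<lambda>n. LINT z|lborel. f n z * indicator B z)
        \<longlonglongrightarrow> (LINT z|lborel. (r * v z - U (snd z)) * indicator B z)"
    proof (rule integral_dominated_convergence[OF _ _ W_int[OF B BR]])
      show "AE z in lborel. (\<lambda>n. f n z * indicator B z) \<longlonglongrightarrow> (r * v z - U (snd z)) * indicator B z"
      proof (rule AE_I2)
        fix z
        show "(\<lambda>n. f n z * indicator B z) \<longlonglongrightarrow> (r * v z - U (snd z)) * indicator B z"
          unfolding f_def using limD[of z] BD Ulim[of z]
          by (cases "z \<in> B") (auto intro!: tendsto_intros)
      qed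
      show "AE z in lborel. norm (f n z * indicator B z) \<le> W z * indicator B z" for n
        using fW[of _ n] BD by (intro AE_I2) (auto simp: indicator_def)
    qed measurable
    have ind: "indicator B \<in> borel_measurable (borel :: (real \<times> real) measure)" by measurable
    note wl = wlim(1)[OF ind w_int[OF B BR]] wlim(2)[OF ind w_int[OF B BR]] wlim(3)[OF ind w_int[OF B BR]]
    have int: "integrable lborel (\<lambda>z. q z * indicator B z)"
      if "q \<in> borel_measurable borel" "\<And>z. \<bar>q z\<bar> \<le> w z" for q :: "real \<times> real \<Rightarrow> real"
      using that(1) by (intro Bochner_Integration.integrable_bound[OF w_int[OF B BR]])
        (use that(2) in \<open>auto simp: indicator_def intro!: AE_I2 order_trans[OF that(2) abs_ge_self]\<close>)
    have intf: "integrable lborel (\<lambda>z. q z * indicator B z)"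
      if "q \<in> borel_measurable borel" "\<And>z. z \<in> D \<Longrightarrow> \<bar>q z\<bar> \<le> W z" for q :: "real \<times> real \<Rightarrow> real"
      using that(1) by (intro Bochner_Integration.integrable_bound[OF W_int[OF B BR]])
        (use that(2) BD in \<open>auto simp: indicator_def intro!: AE_I2 order_trans[OF that(2) abs_ge_self]\<close>)
    have split: "(LINT z|lborel. (p z - a * q z - b * y z + f z) * indicator B z) =
       (LINT z|lborel. p z * indicator B z) - a * (LINT z|lborel. q z * indicator B z)
         - b * (LINT z|lborel. y z * indicator B z) + (LINT z|lborel. f z * indicator B z)"
      if "integrable lborel (\<lambda>z. p z * indicator B z)" "integrable lborel (\<lambda>z. q z * indicator B z)"
        "integrable lborel (\<lambda>z. y z * indicator B z)" "integrable lborel (\<lambda>z. f z * indicator B z)"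
      for p q y f :: "real \<times> real \<Rightarrow> real"
      using that by (simp add: left_diff_distrib distrib_right mult.assoc)
    have "(\<lambda>n. (LINT z|lborel. ut (s n) z * indicator B z) - a * (LINT z|lborel. uxx (s n) z * indicator B z)
         - b * (LINT z|lborel. ux (s n) z * indicator B z) + (LINT z|lborel. f n z * indicator B z))
       \<longlonglongrightarrow> (LINT z|lborel. vt z * indicator B z) - a * (LINT z|lborel. vxx z * indicator B z)
         - b * (LINT z|lborel. vx z * indicator B z) + (LINT z|lborel. (r * v z - U (snd z)) * indicator B z)"
      by (intro tendsto_add tendsto_diff tendsto_mult_left wl f_lim)
    moreover have "(LINT z|lborel. res (s n) z * indicator B z) = (LINT z|lborel. ut (s n) z * indicator B z)
         - a * (LINT z|lborel. uxx (s n) z * indicator B z)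
         - b * (LINT z|lborel. ux (s n) z * indicator B z) + (LINT z|lborel. f n z * indicator B z)" for n
    proof -
      have "(LINT z|lborel. res (s n) z * indicator B z)
        = (LINT z|lborel. (ut (s n) z - a * uxx (s n) z - b * ux (s n) z + f n z) * indicator B z)"
        by (simp add: res_def f_def algebra_simps)
      also have "\<dots> = (LINT z|lborel. ut (s n) z * indicator B z)
         - a * (LINT z|lborel. uxx (s n) z * indicator B z)
         - b * (LINT z|lborel. ux (s n) z * indicator B z) + (LINT z|lborel. f n z * indicator B z)"
        by (intro split int intf u_measurable u_bounds fW) measurable
      finally show ?thesis .
    qed
    moreover have "(LINT z|lborel. E z * indicator B z) = (LINT z|lborel. vt z * indicator B z)
         - a * (LINT z|lborel. vxx z * indicator B z)
         - b * (LINT z|lborel. vx z * indicator B z) + (LINT z|lborel. (r * v z - U (snd z)) * indicator B z)"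
    proof -
      have "\<bar>r * v z - U (snd z)\<bar> \<le> W z" for z
      proof -
        have "\<bar>r * v z\<bar> \<le> r * M" using r vM[of z] by (simp add: abs_mult mult_left_mono)
        moreover have "0 \<le> (2 + a + \<bar>b\<bar>) * w z" using a w_pos[of z] by simp
        ultimately show ?thesis unfolding W_def by linarith
      qed
      then have fin: "integrable lborel (\<lambda>z. (r * v z - U (snd z)) * indicator B z)" by (intro intf) measurable
      have "(LINT z|lborel. E z * indicator B z)
        = (LINT z|lborel. (vt z - a * vxx z - b * vx z + (r * v z - U (snd z))) * indicator B z)"
        by (simp add: E_def algebra_simps)
      also have "\<dots> = (LINT z|lborel. vt z * indicator B z)
         - a * (LINT z|lborel. vxx z * indicator B z)
         - b * (LINT z|lborel. vx z * indicator B z) + (LINT z|lborel. (r * v z - U (snd z)) * indicator B z)"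
        by (intro split int g gw fin)
      finally show ?thesis .
    qed
    ultimately show ?thesis by simp
  qed
  have ev_int: "\<forall>\<^sub>F n in sequentially. idx (s n) (snd z) \<in> I (s n)" if "z \<in> D" for z
    using eventually_subseq[OF s eventually_interior[of "{z}"]] that by simp
  have shift_lim: "(\<lambda>n. h (s n) * (w z + C)) \<longlonglongrightarrow> 0" for z
    using tendsto_mult_right[OF subseq_lim(1)[OF s], of "w z + C"] by simp
  have near_obst: "\<bar>q (real (Suc (lev n (fst z))) * h n) - q (fst z)\<bar> \<le> C * h n"
    if z: "z \<in> D" and q: "\<And>s t. \<bar>q s - q t\<bar> \<le> C * \<bar>s - t\<bar>" for z n and q :: "real \<Rightarrow> real"
    using q[of "real (Suc (lev n (fst z))) * h n" "fst z"] mult_left_mono[OF next_level(2)[OF z, of n] C] by linarith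
  have ev_le: "\<forall>\<^sub>F n in sequentially. res (s n) z \<le> 0" if z: "z \<in> D" and "lo (fst z) < v z" for z
  proof -
    \<comment> \<open>The margin consists of \<open>h * w\<close> for the step of \<open>V\<close>
      to the next level and \<open>h * C\<close> for the motion of the obstacle in that
      time.\<close>
    have "(\<lambda>n. vn (s n) z - h (s n) * (w z + C)) \<longlonglongrightarrow> v z - 0" by (intro tendsto_diff limD z shift_lim)
    then have "\<forall>\<^sub>F n in sequentially. lo (fst z) < vn (s n) z - h (s n) * (w z + C)"
      using that(2) by (intro order_tendstoD(1)) auto
    then show ?thesis using ev_int[OF z]
    proof eventually_elim
      case (elim n)
      have "lo (real (Suc (lev (s n) (fst z))) * h (s n)) < V (s n) (Suc (lev (s n) (fst z))) (idx (s n) (snd z))"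
        using elim(1) next_level(1)[OF z, of "s n"] near_obst[OF z lo(3), of "s n"]
        unfolding distrib_left mult.commute[of _ C] by linarith
      from scheme.residual_le[OF elim(2) this] show ?case unfolding res_eq[OF z elim(2)] .
    qed
  qed
  have ev_ge: "\<forall>\<^sub>F n in sequentially. 0 \<le> res (s n) z" if z: "z \<in> D" and "v z < hi (fst z)" for z
  proof -
    have "(\<lambda>n. vn (s n) z + h (s n) * (w z + C)) \<longlonglongrightarrow> v z + 0" by (intro tendsto_add limD z shift_lim)
    then have "\<forall>\<^sub>F n in sequentially. vn (s n) z + h (s n) * (w z + C) < hi (fst z)"
      using that(2) by (intro order_tendstoD(2)) auto
    then show ?thesis using ev_int[OF z]
    proof eventually_elim
      case (elim n)
      have "V (s n) (Suc (lev (s n) (fst z))) (idx (s n) (snd z)) < hi (real (Suc (lev (s n) (fst z))) * h (s n))"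
        using elim(1) next_level(1)[OF z, of "s n"] near_obst[OF z hi(3), of "s n"]
        unfolding distrib_left mult.commute[of _ C] by linarith
      from scheme.residual_ge[OF elim(2) this] show ?case unfolding res_eq[OF z elim(2)] .
    qed
  qed
  have lip_meas: "q \<in> borel_measurable borel" if q: "\<And>s t. \<bar>q s - q t\<bar> \<le> C * \<bar>s - t\<bar>" for q :: "real \<Rightarrow> real"
  proof (rule borel_measurable_continuous_onI, rule lipschitz_on_continuous_on[of C])
    show "C-lipschitz_on UNIV q" using q C by (auto simp: lipschitz_on_def dist_real_def)
  qed
  have [measurable]: "lo \<in> borel_measurable borel" "hi \<in> borel_measurable borel" using lip_meas lo(3) hi(3) by blast+
  have le: "AE z in lborel. z \<in> {z \<in> DR R. lo (fst z) < v z} \<longrightarrow> E z \<le> 0" for R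
  proof (rule AE_nonpos_of_weak_limit[where e="\<lambda>n. res (s n)" and w=W])
    show "integrable lborel (\<lambda>z. W z * indicator {z \<in> DR R. lo (fst z) < v z} z)"
      by (rule W_int[of _ R]) auto
    fix B assume B: "B \<in> sets borel" "B \<subseteq> {z \<in> DR R. lo (fst z) < v z}"
    then have "B \<subseteq> DR R" by auto
    then show "(\<lambda>n. LINT z|lborel. res (s n) z * indicator B z) \<longlonglongrightarrow> (LINT z|lborel. E z * indicator B z)"
      by (rule res_lim[OF B(1)])
  qed (use W_bounds ev_le in \<open>auto simp: DR_def\<close>)
  have ge: "AE z in lborel. z \<in> {z \<in> DR R. v z < hi (fst z)} \<longrightarrow> - E z \<le> 0" for R
  proof (rule AE_nonpos_of_weak_limit[where e="\<lambda>n z. - res (s n) z" and w=W])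
    show "integrable lborel (\<lambda>z. W z * indicator {z \<in> DR R. v z < hi (fst z)} z)"
      by (rule W_int[of _ R]) auto
    fix B assume B: "B \<in> sets borel" "B \<subseteq> {z \<in> DR R. v z < hi (fst z)}"
    then have "B \<subseteq> DR R" by auto
    from tendsto_minus[OF res_lim[OF B(1) this]]
    show "(\<lambda>n. LINT z|lborel. - res (s n) z * indicator B z) \<longlonglongrightarrow> (LINT z|lborel. - E z * indicator B z)" by simp
  qed (use W_bounds ev_ge in \<open>auto simp: DR_def\<close>)
  have "AE z in lborel. \<forall>R. (z \<in> {z \<in> DR R. lo (fst z) < v z} \<longrightarrow> E z \<le> 0) \<and>
        (z \<in> {z \<in> DR R. v z < hi (fst z)} \<longrightarrow> - E z \<le> 0)"
    using le ge by (auto simp: AE_all_countable AE_conj_iff)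
  then show ?thesis
  proof eventually_elim
    case (elim z)
    obtain R where "\<bar>snd z\<bar> \<le> real R" using real_arch_simple by blast
    then show ?case using elim[rule_format, of R] by (auto simp: DR_def)
  qed
qed

lemma lev_value_close:
  assumes "\<And>s t. \<bar>q s - q t\<bar> \<le> C * \<bar>s - t\<bar>" "0 \<le> \<tau>"
  shows "\<bar>q (lev n \<tau> * h n) - q \<tau>\<bar> \<le> C * h n"
proof -
  have "\<bar>lev n \<tau> * h n - \<tau>\<bar> \<le> h n" using lev_bounds[OF assms(2), of n] by linarith
  from mult_left_mono[OF this C] show ?thesis using assms(1)[of "lev n \<tau> * h n" \<tau>] by linarith
qed

lemma lev_value_lim:
  assumes "strict_mono (s :: nat \<Rightarrow> nat)" "\<And>s t. \<bar>q s - q t\<bar> \<le> C * \<bar>s - t\<bar>" "0 \<le> \<tau>"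
  shows "(\<lambda>n. q (lev (s n) \<tau> * h (s n))) \<longlonglongrightarrow> q \<tau>"
proof (rule LIM_zero_cancel, rule Lim_null_comparison[OF always_eventually])
  show "\<forall>n. norm (q (lev (s n) \<tau> * h (s n)) - q \<tau>) \<le> C * h (s n)"
    using lev_value_close[OF assms(2,3)] by simp
  show "(\<lambda>n. C * h (s n)) \<longlonglongrightarrow> 0" using tendsto_mult_left[OF subseq_lim(1)[OF assms(1)], of C] by simp
qed

text \<open>\<open>l\<close> is an exact multiple of \<open>k n\<close>, so no rounding occurs at
  the end points; their indices lie outside \<open>I n\<close>, where the scheme carries
  \<open>B\<close>.\<close>

lemma vn_boundary:
  assumes "W = {1}"
  shows "vn n (\<tau>, - l) = bl (lev n \<tau> * h n)" "vn n (\<tau>, l) = br (lev n \<tau> * h n)"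
proof -
  have "l / k n = real (N n)" using Nk[of n] kpos[of n] by (simp add: field_simps)
  then have i: "idx n l = int (N n)" "idx n (- l) = - int (N n)"
    by (simp_all add: idx_def floor_minus)
  have "\<bar>j\<bar> < int (N n)" if "j \<in> I n" for j
  proof -
    obtain R where "R \<in> W" "- int (R * N n) < j" "j < int (R * N n)" using \<open>j \<in> I n\<close> by (auto simp: I_def)
    then show ?thesis using assms by simp
  qed
  from this[of "int (N n)"] this[of "- int (N n)"] have "int (N n) \<notin> I n" "- int (N n) \<notin> I n" by auto
  moreover have "V n m j = B n m j" if "j \<notin> I n" for m j
    using that by (cases m) (auto simp: B_def bl(4) br(4))
  ultimately show "vn n (\<tau>, - l) = bl (lev n \<tau> * h n)" "vn n (\<tau>, l) = br (lev n \<tau> * h n)"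
    using Npos[of n] by (auto simp: vn_def i B_def)
qed

theorem solution_exists:
  obtains v vt vx vxx where
    "continuous_on Cl v" "weak_derivatives D v vt vx vxx"
    "{v, vt, vx, vxx} \<subseteq> borel_measurable borel"
    "\<And>S. bounded S \<Longrightarrow> \<exists>c. \<forall>z\<in>S. \<forall>u\<in>{v, vt, vx, vxx}. \<bar>u z\<bar> \<le> c"
    "AE z in lborel. z \<in> D \<longrightarrow>
       (lo (fst z) < v z \<longrightarrow> vt z - a * vxx z - b * vx z + r * v z - U (snd z) \<le> 0) \<and>
       (v z < hi (fst z) \<longrightarrow> 0 \<le> vt z - a * vxx z - b * vx z + r * v z - U (snd z))"
    "\<And>z. z \<in> Cl \<Longrightarrow> lo (fst z) \<le> v z \<and> v z \<le> hi (fst z)"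
    "\<And>x. x \<in> Xc \<Longrightarrow> v (0, x) = 0"
    "\<And>\<tau>. W = {1} \<Longrightarrow> \<tau> \<in> {0..T} \<Longrightarrow> v (\<tau>, - l) = bl \<tau> \<and> v (\<tau>, l) = br \<tau>"
proof -
  obtain s0 v where s0: "strict_mono (s0 :: nat \<Rightarrow> nat)" and v: "v \<in> borel_measurable borel"
    and lim0: "\<And>z. z \<in> Cl \<Longrightarrow> (\<lambda>n. vn (s0 n) z) \<longlonglongrightarrow> v z"
    and vM: "\<And>z. \<bar>v z\<bar> \<le> M" and v_cont: "continuous_on Cl v"
    by (rule pointwise_limit) blast
  obtain k1 vt where 1: "strict_mono (k1 :: nat \<Rightarrow> nat)" "vt \<in> borel_measurable borel" "\<And>z. \<bar>vt z\<bar> \<le> w z"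
    "\<And>\<eta>. \<eta> \<in> borel_measurable borel \<Longrightarrow> integrable lborel (\<lambda>z. w z * \<eta> z) \<Longrightarrow>
       (\<lambda>n. LINT z|lborel. ut (s0 (k1 n)) z * \<eta> z) \<longlonglongrightarrow> (LINT z|lborel. vt z * \<eta> z)"
    by (rule weak_star_compact[of "\<lambda>n. ut (s0 n)" w, OF u_measurable(1) w_measurable w_pos u_bounds(1)]) blast
  obtain k2 vx where 2: "strict_mono (k2 :: nat \<Rightarrow> nat)" "vx \<in> borel_measurable borel" "\<And>z. \<bar>vx z\<bar> \<le> w z"
    "\<And>\<eta>. \<eta> \<in> borel_measurable borel \<Longrightarrow> integrable lborel (\<lambda>z. w z * \<eta> z) \<Longrightarrow>
       (\<lambda>n. LINT z|lborel. ux (s0 (k1 (k2 n))) z * \<eta> z) \<longlonglongrightarrow> (LINT z|lborel. vx z * \<eta> z)"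
    by (rule weak_star_compact[of "\<lambda>n. ux (s0 (k1 n))" w, OF u_measurable(2) w_measurable w_pos u_bounds(2)]) blast
  obtain k3 vxx where 3: "strict_mono (k3 :: nat \<Rightarrow> nat)" "vxx \<in> borel_measurable borel" "\<And>z. \<bar>vxx z\<bar> \<le> w z"
    "\<And>\<eta>. \<eta> \<in> borel_measurable borel \<Longrightarrow> integrable lborel (\<lambda>z. w z * \<eta> z) \<Longrightarrow>
       (\<lambda>n. LINT z|lborel. uxx (s0 (k1 (k2 (k3 n)))) z * \<eta> z) \<longlonglongrightarrow> (LINT z|lborel. vxx z * \<eta> z)"
    by (rule weak_star_compact[of "\<lambda>n. uxx (s0 (k1 (k2 n)))" w, OF u_measurable(3) w_measurable w_pos u_bounds(3)]) blast
  \<comment> \<open>Each extraction refines the previous one, so the pointwise limit and the three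
    weak limits all hold along the composition.\<close>
  define s where "s n = s0 (k1 (k2 (k3 n)))" for n
  have k23: "strict_mono (\<lambda>n. k2 (k3 n))" by (rule strict_mono_compose[OF 2(1) 3(1)])
  have k123: "strict_mono (\<lambda>n. k1 (k2 (k3 n)))" by (rule strict_mono_compose[OF 1(1) k23])
  have s: "strict_mono s" unfolding s_def by (rule strict_mono_compose[OF s0 k123])
  have lim: "(\<lambda>n. vn (s n) z) \<longlonglongrightarrow> v z" if "z \<in> Cl" for z
    using LIMSEQ_subseq_LIMSEQ[OF lim0[OF that] k123] by (simp add: o_def s_def)
  have wl: "(\<lambda>n. LINT z|lborel. ut (s n) z * \<eta> z) \<longlonglongrightarrow> (LINT z|lborel. vt z * \<eta> z)"
     "(\<lambda>n. LINT z|lborel. ux (s n) z * \<eta> z) \<longlonglongrightarrow> (LINT z|lborel. vx z * \<eta> z)"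
     "(\<lambda>n. LINT z|lborel. uxx (s n) z * \<eta> z) \<longlonglongrightarrow> (LINT z|lborel. vxx z * \<eta> z)"
    if "\<eta> \<in> borel_measurable borel" "integrable lborel (\<lambda>z. w z * \<eta> z)" for \<eta>
    using LIMSEQ_subseq_LIMSEQ[OF 1(4)[OF that] k23] LIMSEQ_subseq_LIMSEQ[OF 2(4)[OF that] 3(1)] 3(4)[OF that]
    by (auto simp: o_def s_def)
  show ?thesis
  proof (rule that[of v vt vx vxx])
    show "continuous_on Cl v" by (rule v_cont)
    show "weak_derivatives D v vt vx vxx"
      unfolding weak_derivatives_def
      by (intro conjI weak_derivative_limits(1)[OF s v vM lim 1(2,3)] weak_derivative_limits(2)[OF s v vM lim 2(2,3)]
            weak_derivative_limits(3)[OF s v vM lim 3(2,3)] wl)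
    show "{v, vt, vx, vxx} \<subseteq> borel_measurable borel" using v 1(2) 2(2) 3(2) by simp
    show "\<exists>c. \<forall>z\<in>S. \<forall>u\<in>{v, vt, vx, vxx}. \<bar>u z\<bar> \<le> c" if S: "bounded S" for S
    proof -
      obtain c where c: "0 \<le> c" "\<And>z. z \<in> S \<Longrightarrow> w z \<le> c" using w_locally_bounded[OF S] by metis
      have "\<bar>u z\<bar> \<le> c + M" if "z \<in> S" "u \<in> {v, vt, vx, vxx}" for z u
        using that c(2)[OF that(1)] c(1) M0 vM[of z] 1(3)[of z] 2(3)[of z] 3(3)[of z] by auto
      then show ?thesis by blast
    qed
    show "AE z in lborel. z \<in> D \<longrightarrow>
       (lo (fst z) < v z \<longrightarrow> vt z - a * vxx z - b * vx z + r * v z - U (snd z) \<le> 0) \<and>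
       (v z < hi (fst z) \<longrightarrow> 0 \<le> vt z - a * vxx z - b * vx z + r * v z - U (snd z))"
      by (rule obstacle_inequalities[OF s v vM lim 1(2) 2(2) 3(2) 1(3) 2(3) 3(3) wl])
    show "lo (fst z) \<le> v z \<and> v z \<le> hi (fst z)" if z: "z \<in> Cl" for z
    proof -
      have t: "0 \<le> fst z" using z by (auto simp: Cl_def)
      have "lo (lev (s n) (fst z) * h (s n)) \<le> vn (s n) z" "vn (s n) z \<le> hi (lev (s n) (fst z) * h (s n))" for n
        unfolding vn_def by (rule scheme.V_bounds)+
      then show ?thesis
        using LIMSEQ_le[OF lev_value_lim[OF s lo(3) t] lim[OF z]] LIMSEQ_le[OF lim[OF z] lev_value_lim[OF s hi(3) t]]
        by blast
    qed
    show "v (0, x) = 0" if "x \<in> Xc" for x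
    proof -
      have "(0, x) \<in> Cl" using that T by (simp add: Cl_def)
      moreover have "vn (s n) (0, x) = 0" for n by (simp add: vn_def lev_def)
      ultimately show ?thesis using lim[of "(0, x)"] by (simp add: LIMSEQ_const_iff)
    qed
    show "v (\<tau>, - l) = bl \<tau> \<and> v (\<tau>, l) = br \<tau>" if W1: "W = {1}" and \<tau>: "\<tau> \<in> {0..T}" for \<tau>
    proof -
      have X: "- l \<in> Xc" "l \<in> Xc" using l unfolding Xc_def by (auto intro!: bexI[of _ 1] simp: W1)
      then have "(\<tau>, - l) \<in> Cl" "(\<tau>, l) \<in> Cl" using \<tau> by (auto simp: Cl_def)
      from this[THEN lim] show ?thesis
        unfolding vn_boundary[OF W1]
        using lev_value_lim[OF s bl(3), of \<tau>] lev_value_lim[OF s br(3), of \<tau>] \<tau> LIMSEQ_unique by (metis atLeastAtMost_iff)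
    qed
  qed
qed

end

section \<open>Comparison principle\<close>

lemma mollifier_translate: "mollifier \<epsilon> (z + t) y = mollifier \<epsilon> z (y - t)"
  by (cases y; cases z; cases t) (simp add: mollifier_def algebra_simps)

lemma mollifier_test_UNIV: "0 < \<epsilon> \<Longrightarrow> mollifier \<epsilon> z \<in> test_functions UNIV"
  by (rule mollifier_test_function) auto

lemma mollifier_integrable:
  assumes "0 < \<epsilon>"
  shows "integrable lborel (mollifier \<epsilon> z)" "mollifier \<epsilon> z \<in> borel_measurable borel"
  using test_function_integrable[OF mollifier_test_UNIV[OF assms]] by auto

text \<open>The mass does not depend on the centre by translation invariance, and it is positive
  because the mollifier is positive on an open box.\<close>

lemma mollifier_integral:
  assumes "0 < \<epsilon>"
  shows "(LINT y|lborel. mollifier \<epsilon> z y) = (LINT y|lborel. mollifier \<epsilon> 0 y)" "0 < (LINT y|lborel. mollifier \<epsilon> 0 y)"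
proof -
  have "(LINT y|lborel. 1 * mollifier \<epsilon> 0 (y - z)) = (LINT y|lborel. 1 * mollifier \<epsilon> 0 y)"
    using integral_translate[OF borel_measurable_const mollifier_integrable(2)[OF assms], of 1 0 z] by simp
  then show "(LINT y|lborel. mollifier \<epsilon> z y) = (LINT y|lborel. mollifier \<epsilon> 0 y)"
    using mollifier_translate[of \<epsilon> 0 z] by simp
  have "0 \<le> (LINT y|lborel. mollifier \<epsilon> 0 y)" by (intro Bochner_Integration.integral_nonneg mollifier_nonneg)
  moreover have "(LINT y|lborel. mollifier \<epsilon> 0 y) \<noteq> 0"
  proof
    assume "(LINT y|lborel. mollifier \<epsilon> 0 y) = 0"
    then have "AE y in lborel. mollifier \<epsilon> 0 y = 0"
      using integral_nonneg_eq_0_iff_AE[OF mollifier_integrable(1)[OF assms, of 0]] mollifier_nonneg by auto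
    then have "AE y in lborel. y \<notin> box (- (\<epsilon>, \<epsilon>)) (\<epsilon>, \<epsilon>)"
    proof eventually_elim
      case (elim y)
      show ?case
      proof
        assume "y \<in> box (- (\<epsilon>, \<epsilon>)) (\<epsilon>, \<epsilon>)"
        then have "\<bar>fst y / \<epsilon>\<bar> < 1" "\<bar>snd y / \<epsilon>\<bar> < 1"
          using assms by (auto simp: box_def Basis_prod_def inner_prod_def abs_less_iff field_simps)
        then have "0 < bump (fst y / \<epsilon>) * bump (snd y / \<epsilon>)" by (intro mult_pos_pos bump_pos)
        moreover have "mollifier \<epsilon> 0 y = bump (fst y / \<epsilon>) * bump (snd y / \<epsilon>)"
          by (simp add: mollifier_def case_prod_beta)
        ultimately show False using elim by linarith
      qed
    qed
    then have "box (- (\<epsilon>, \<epsilon>)) (\<epsilon>, \<epsilon>) \<in> null_sets (lborel :: (real \<times> real) measure)"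
      using AE_iff_null_sets[of "box (- (\<epsilon>, \<epsilon>)) (\<epsilon>, \<epsilon>)" "lborel :: (real \<times> real) measure"] by simp
    then have "emeasure lborel (box (- (\<epsilon>, \<epsilon>)) (\<epsilon>, \<epsilon>)) = 0" by auto
    then show False using assms by (auto simp: emeasure_lborel_box_eq Basis_prod_def inner_prod_def)
  qed
  ultimately show "0 < (LINT y|lborel. mollifier \<epsilon> 0 y)" by linarith
qed

lemma locally_integrable_mult_test:
  assumes u: "locally_integrable D u" and D: "open D"
    and \<zeta>: "continuous_on UNIV \<zeta>" "compact K" "K \<subseteq> D" "\<And>z. z \<notin> K \<Longrightarrow> \<zeta> z = 0"
  shows "integrable (lebesgue_on D) (\<lambda>z. u z * \<zeta> z)"
proof -
  obtain Q where Q: "0 < Q" "\<And>z. \<bar>\<zeta> z\<bar> \<le> Q" by (rule continuous_compact_support_bounded[OF \<zeta>(1,2,4)]) auto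
  have K: "K \<in> sets lebesgue" "D \<in> sets lebesgue" using borel_compact[OF \<zeta>(2)] D by simp_all
  have u': "integrable lebesgue (\<lambda>z. indicator K z *\<^sub>R u z)"
    using u \<zeta>(2,3) K by (auto simp: locally_integrable_def integrable_restrict_space)
  have "integrable lebesgue (\<lambda>z. (indicator K z *\<^sub>R u z) * \<zeta> z)"
  proof (rule Bochner_Integration.integrable_bound[OF integrable_mult_right[OF u', of Q]])
    have "\<zeta> \<in> borel_measurable lebesgue"
      using borel_measurable_continuous_onI[OF \<zeta>(1)] by (intro measurable_completion) simp
    then show "(\<lambda>z. (indicator K z *\<^sub>R u z) * \<zeta> z) \<in> borel_measurable lebesgue"
      using u' by (intro borel_measurable_times) auto
    have "\<bar>indicator K z * u z\<bar> * \<bar>\<zeta> z\<bar> \<le> \<bar>indicator K z * u z\<bar> * Q" for z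
      using Q by (intro mult_left_mono) auto
    then show "AE z in lebesgue. norm ((indicator K z *\<^sub>R u z) * \<zeta> z) \<le> norm (Q * (indicator K z *\<^sub>R u z))"
      using Q(1) by (simp add: abs_mult mult_ac)
  qed
  also have "(\<lambda>z. (indicator K z *\<^sub>R u z) * \<zeta> z) = (\<lambda>z. indicator D z *\<^sub>R (u z * \<zeta> z))"
    using \<zeta>(3,4) by (auto simp: fun_eq_iff indicator_def)
  finally show ?thesis using K by (simp add: integrable_restrict_space)
qed

text \<open>At an interior maximum of the mollified difference \<open>d * \<kappa> - \<phi>\<close> the difference quotients are
  ordered, and moved onto the mollifier they converge to the weak derivatives of \<open>d\<close>.\<close>

lemma no_strict_interior_maximum:
  fixes d gt gx gxx \<phi> \<phi>t \<phi>x \<phi>xx :: "real \<times> real \<Rightarrow> real"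
  assumes D: "open D" and \<rho>: "0 < \<rho>" and a: "0 < a" and r: "0 \<le> r"
    and B2: "cbox (z0 - (2 * \<rho>, 2 * \<rho>)) (z0 + (2 * \<rho>, 2 * \<rho>)) \<subseteq> D"
    and d: "continuous_on (cbox (z0 - (2 * \<rho>, 2 * \<rho>)) (z0 + (2 * \<rho>, 2 * \<rho>))) d" and d_pos: "\<And>z. z \<in> cbox (z0 - (2 * \<rho>, 2 * \<rho>)) (z0 + (2 * \<rho>, 2 * \<rho>)) \<Longrightarrow> 0 < d z"
    and weak: "weak_partial 1 0 D d gt" "weak_partial 0 1 D d gx" "weak_partial 0 2 D d gxx"
    and sub: "AE z in lebesgue_on D. 0 < d z \<longrightarrow> gt z - a * gxx z - b * gx z + r * d z \<le> 0"
    and \<phi>: "continuous_on (cbox (z0 - (\<rho>, \<rho>)) (z0 + (\<rho>, \<rho>))) \<phi>"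
    and top: "\<phi> z0 < d z0" and m: "0 < m"
    and strict: "\<And>z. z \<in> cbox (z0 - (\<rho>, \<rho>)) (z0 + (\<rho>, \<rho>)) \<Longrightarrow> z \<notin> box (z0 - (\<rho>, \<rho>)) (z0 + (\<rho>, \<rho>)) \<Longrightarrow>
       d z - \<phi> z \<le> d z0 - \<phi> z0 - m"
    and \<phi>t: "\<And>\<tau> x. (\<tau>, x) \<in> box (z0 - (\<rho>, \<rho>)) (z0 + (\<rho>, \<rho>)) \<Longrightarrow>
       ((\<lambda>s. \<phi> (s, x)) has_real_derivative \<phi>t (\<tau>, x)) (at \<tau>)"
    and \<phi>x: "\<And>\<tau> x. (\<tau>, x) \<in> box (z0 - (\<rho>, \<rho>)) (z0 + (\<rho>, \<rho>)) \<Longrightarrow>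
       ((\<lambda>y. \<phi> (\<tau>, y)) has_real_derivative \<phi>x (\<tau>, x)) (at x)"
    and \<phi>xx: "\<And>z k. \<phi> (z + (0, k)) - 2 * \<phi> z + \<phi> (z - (0, k)) = k\<^sup>2 * \<phi>xx z"
    and super: "\<And>z. z \<in> box (z0 - (\<rho>, \<rho>)) (z0 + (\<rho>, \<rho>)) \<Longrightarrow> 0 < \<phi>t z - a * \<phi>xx z - b * \<phi>x z + r * \<phi> z"
  shows False
proof -
  let ?B2 = "cbox (z0 - (2 * \<rho>, 2 * \<rho>)) (z0 + (2 * \<rho>, 2 * \<rho>))"
    and ?B = "cbox (z0 - (\<rho>, \<rho>)) (z0 + (\<rho>, \<rho>))" and ?Bo = "box (z0 - (\<rho>, \<rho>)) (z0 + (\<rho>, \<rho>))"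
  have z0B: "z0 \<in> ?B" "?B \<subseteq> ?B2" "?Bo \<subseteq> ?B"
    using \<rho> by (auto simp: mem_box Basis_prod_def inner_prod_def)
  \<comment> \<open>Cutting \<open>d\<close> off to the double box makes it bounded and measurable
    on the plane; mollification at points of the small box never looks beyond the double
    box.\<close>
  define dB where "dB z = indicator ?B2 z *\<^sub>R d z" for z
  have dB_meas [measurable]: "dB \<in> borel_measurable borel"
    unfolding dB_def by (rule borel_measurable_continuous_on_indicator[OF _ d]) auto
  obtain Md where Md: "\<And>z. \<bar>dB z\<bar> \<le> Md"
  proof -
    have "compact (d ` ?B2)" by (rule compact_continuous_image[OF d compact_cbox])
    then obtain c where c: "0 < c" "\<And>z. z \<in> ?B2 \<Longrightarrow> \<bar>d z\<bar> \<le> c"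
      using compact_imp_bounded bounded_pos by (metis image_eqI real_norm_def)
    then have "\<bar>dB z\<bar> \<le> c" for z by (cases "z \<in> ?B2") (auto simp: dB_def)
    then show ?thesis using that by blast
  qed
  \<comment> \<open>The mollification error is at most \<open>c * \<delta>\<close>. The condition
    \<open>2 * \<delta> < m\<close> keeps the maximum of the mollified difference off the boundary,
    and \<open>\<delta> < d z0 - \<phi> z0\<close> keeps its value positive.\<close>
  define \<delta> where "\<delta> = min (m / 4) ((d z0 - \<phi> z0) / 2)"
  have \<delta>: "0 < \<delta>" "2 * \<delta> < m" "\<delta> < d z0 - \<phi> z0" using m top by (auto simp: \<delta>_def min_def)
  have "uniformly_continuous_on ?B2 d" by (rule compact_uniformly_continuous[OF d compact_cbox])
  then obtain e0 where e0: "0 < e0" "\<And>y z. y \<in> ?B2 \<Longrightarrow> z \<in> ?B2 \<Longrightarrow> dist y z < e0 \<Longrightarrow> dist (d y) (d z) < \<delta>"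
    unfolding uniformly_continuous_on_def using \<delta>(1) by metis
  define \<epsilon> where "\<epsilon> = min \<rho> (e0 / 2)"
  have \<epsilon>: "0 < \<epsilon>" "\<epsilon> \<le> \<rho>" "2 * \<epsilon> \<le> e0" using e0(1) \<rho> by (auto simp: \<epsilon>_def)
  note mi = mollifier_integrable[OF \<epsilon>(1)]
  define c where "c = (LINT y|lborel. mollifier \<epsilon> 0 y)"
  have c: "0 < c" and cz: "(LINT y|lborel. mollifier \<epsilon> z y) = c" for z
    using mollifier_integral[OF \<epsilon>(1)] by (auto simp: c_def)
  \<comment> \<open>\<open>J\<close> is the mollification of \<open>d\<close> up to the factor
    \<open>c\<close>.\<close>
  define J where "J z = (LINT y|lborel. dB y * mollifier \<epsilon> z y)" for z
  have intJ: "integrable lborel (\<lambda>y. dB y * mollifier \<epsilon> z y)" for z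
    by (rule integrable_bounded_mult[OF dB_meas Md mi(1)])
  have supp: "y \<in> ?B2" "dist y z < e0" if "z \<in> ?B" "mollifier \<epsilon> z y \<noteq> 0" for y z
  proof -
    have yb: "y \<in> box (z - (\<epsilon>, \<epsilon>)) (z + (\<epsilon>, \<epsilon>))" by (rule mollifier_nonzero_dist[OF \<epsilon>(1) that(2)])
    then show "y \<in> ?B2" using that(1) \<epsilon>(2) by (auto simp: mem_box Basis_prod_def inner_prod_def)
    have "\<bar>fst y - fst z\<bar> < \<epsilon>" "\<bar>snd y - snd z\<bar> < \<epsilon>"
      using yb by (auto simp: mem_box Basis_prod_def inner_prod_def abs_less_iff)
    moreover have "dist y z \<le> \<bar>fst y - fst z\<bar> + \<bar>snd y - snd z\<bar>"
      by (cases y; cases z) (simp add: dist_Pair_Pair dist_real_def sqrt_sum_squares_le_sum_abs)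
    ultimately show "dist y z < e0" using \<epsilon>(3) by linarith
  qed
  have close: "\<bar>J z - c * d z\<bar> \<le> c * \<delta>" if z: "z \<in> ?B" for z
  proof -
    have "J z - c * d z = (LINT y|lborel. dB y * mollifier \<epsilon> z y - d z * mollifier \<epsilon> z y)"
      using intJ[of z] mi(1)[of z] by (simp add: J_def cz mult.commute)
    also have "\<bar>\<dots>\<bar> \<le> (LINT y|lborel. \<bar>dB y * mollifier \<epsilon> z y - d z * mollifier \<epsilon> z y\<bar>)"
      by (rule integral_abs_bound)
    also have "\<dots> \<le> (LINT y|lborel. \<delta> * mollifier \<epsilon> z y)"
    proof (rule integral_mono)
      fix y
      show "\<bar>dB y * mollifier \<epsilon> z y - d z * mollifier \<epsilon> z y\<bar> \<le> \<delta> * mollifier \<epsilon> z y"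
      proof (cases "mollifier \<epsilon> z y = 0")
        case False
        have "\<bar>d y - d z\<bar> \<le> \<delta>"
          using e0(2)[of y z] supp[OF z False] z z0B(2) by (auto simp: dist_real_def less_imp_le)
        then have "\<bar>d y - d z\<bar> * mollifier \<epsilon> z y \<le> \<delta> * mollifier \<epsilon> z y"
          using mollifier_nonneg by (intro mult_right_mono)
        then show ?thesis using supp(1)[OF z False] mollifier_nonneg[of \<epsilon> z y]
          by (simp add: dB_def abs_mult flip: left_diff_distrib)
      qed simp
    qed (use intJ mi(1) in auto)
    also have "\<dots> = c * \<delta>" by (simp add: cz mult.commute)
    finally show ?thesis .
  qed
  have J_cont: "continuous_on ?B J"
    unfolding continuous_on_sequentially
  proof (intro allI ballI impI)
    fix q and z :: "real \<times> real"
    assume q: "(\<forall>n. q n \<in> ?B) \<and> q \<longlonglongrightarrow> z"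
    have mc: "(\<lambda>n. mollifier \<epsilon> (q n) y) \<longlonglongrightarrow> mollifier \<epsilon> z y" for y
    proof -
      have eq: "mollifier \<epsilon> p y = mollifier \<epsilon> 0 (y - p)" for p using mollifier_translate[of \<epsilon> 0 p y] by simp
      have "continuous_on UNIV (mollifier \<epsilon> 0)" by (rule test_function_continuous[OF mollifier_test_UNIV[OF \<epsilon>(1)]])
      then have "isCont (mollifier \<epsilon> 0) (y - z)" using continuous_on_eq_continuous_at[OF open_UNIV] by blast
      then show ?thesis unfolding eq using q by (intro isCont_tendsto_compose[where g="mollifier \<epsilon> 0"] tendsto_intros) auto
    qed
    obtain K where K: "compact K" "\<And>y. y \<notin> K \<Longrightarrow> mollifier \<epsilon> 0 y = 0"
      using test_function_support[OF mollifier_test_UNIV[OF \<epsilon>(1), of 0]] by metis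
    obtain Q where Q: "\<And>y. \<bar>mollifier \<epsilon> 0 y\<bar> \<le> Q"
      using continuous_compact_support_bounded[OF test_function_continuous[OF mollifier_test_UNIV[OF \<epsilon>(1)]] K] by metis
    have Qz: "\<bar>mollifier \<epsilon> p y\<bar> \<le> Q" for p y using Q mollifier_translate[of \<epsilon> 0 p y] by simp
    have "(\<lambda>n. LINT y|lborel. dB y * mollifier \<epsilon> (q n) y) \<longlonglongrightarrow> (LINT y|lborel. dB y * mollifier \<epsilon> z y)"
    proof (rule integral_dominated_convergence[where w="\<lambda>y. Md * Q * indicator ?B2 y"])
      show "integrable lborel (\<lambda>y. Md * Q * indicator ?B2 y)"
        using emeasure_lborel_cbox_finite by (intro integrable_mult_right integrable_real_indicator) auto
      show "AE y in lborel. norm (dB y * mollifier \<epsilon> (q n) y) \<le> Md * Q * indicator ?B2 y" for n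
      proof (rule AE_I2)
        fix y
        have "\<bar>dB y\<bar> * \<bar>mollifier \<epsilon> (q n) y\<bar> \<le> Md * Q"
          using Md[of y] Qz[of "q n" y] by (intro mult_mono) auto
        then show "norm (dB y * mollifier \<epsilon> (q n) y) \<le> Md * Q * indicator ?B2 y"
          by (cases "y \<in> ?B2") (auto simp: dB_def abs_mult)
      qed
      show "AE y in lborel. (\<lambda>n. dB y * mollifier \<epsilon> (q n) y) \<longlonglongrightarrow> dB y * mollifier \<epsilon> z y"
        by (intro AE_I2 tendsto_mult_left mc)
    qed (use mi(2) in measurable)
    then show "(J \<circ> q) \<longlonglongrightarrow> J z" by (simp add: J_def o_def)
  qed
  define G where "G z = J z - c * \<phi> z" for z
  have "continuous_on ?B G" unfolding G_def by (intro continuous_intros J_cont \<phi>)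
  then obtain z1 where z1: "z1 \<in> ?B" "\<And>z. z \<in> ?B \<Longrightarrow> G z \<le> G z1"
    using continuous_attains_sup[OF compact_cbox, of "z0 - (\<rho>, \<rho>)" "z0 + (\<rho>, \<rho>)" G] z0B(1) by blast
  have cd: "c * (2 * \<delta>) < c * m" using c \<delta>(2) by simp
  have G0: "c * (d z0 - \<phi> z0) - c * \<delta> \<le> G z1"
    using z1(2)[OF z0B(1)] close[OF z0B(1)] unfolding G_def right_diff_distrib by linarith
  have z1o: "z1 \<in> ?Bo"
  proof (rule ccontr)
    assume "z1 \<notin> ?Bo"
    from strict[OF z1(1) this] have "c * (d z1 - \<phi> z1) \<le> c * (d z0 - \<phi> z0 - m)" using c by simp
    then have "c * d z1 - c * \<phi> z1 \<le> c * d z0 - c * \<phi> z0 - c * m" by (simp only: right_diff_distrib)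
    then show False using G0 close[OF z1(1)] cd unfolding G_def right_diff_distrib by linarith
  qed
  have "0 < c * (d z0 - \<phi> z0) - c * \<delta>" using c \<delta>(3) by (simp flip: right_diff_distrib)
  then have Jz1: "c * \<phi> z1 \<le> J z1" using G0 by (simp add: G_def)
  define \<eta> where "\<eta> = mollifier \<epsilon> z1"
  have \<eta>D: "\<eta> \<in> test_functions D" and \<eta>U: "\<eta> \<in> test_functions UNIV"
  proof -
    have "cbox (z1 - (\<epsilon>, \<epsilon>)) (z1 + (\<epsilon>, \<epsilon>)) \<subseteq> ?B2"
      using z1(1) \<epsilon>(2) by (auto simp: mem_box Basis_prod_def inner_prod_def)
    then show "\<eta> \<in> test_functions D" unfolding \<eta>_def
      using B2 by (intro mollifier_test_function[OF \<epsilon>(1)]) auto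
    show "\<eta> \<in> test_functions UNIV" unfolding \<eta>_def by (rule mollifier_test_UNIV[OF \<epsilon>(1)])
  qed
  have Jshift: "J (z1 + t) = (LINT y|lborel. dB y * \<eta> (y + - t))" for t
    by (simp add: J_def \<eta>_def mollifier_translate)
  have int\<eta>: "integrable lborel (\<lambda>y. dB y * \<eta> (y + t))" "integrable lborel (\<lambda>y. dB y * \<eta> y)" for t
    unfolding \<eta>_def by (auto intro!: integrable_bounded_mult[OF dB_meas Md] integrable_translate mi)
  have near: "\<forall>\<^sub>F n in sequentially. z1 + p n \<in> ?B" if "p \<longlonglongrightarrow> 0" for p :: "nat \<Rightarrow> real \<times> real"
  proof -
    have "(\<lambda>n. z1 + p n) \<longlonglongrightarrow> z1 + 0" by (intro tendsto_intros that)
    then have "\<forall>\<^sub>F n in sequentially. z1 + p n \<in> ?Bo" using z1o by (intro topological_tendstoD) auto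
    then show ?thesis by eventually_elim (use z0B(3) in auto)
  qed
  have inv_lim: "(\<lambda>n. 1 / (real n + 1)) \<longlonglongrightarrow> 0"
    using LIMSEQ_inverse_real_of_nat by (simp add: inverse_eq_divide add.commute)
  \<comment> \<open>First-order condition at the maximum in the direction \<open>E\<close>, one
    inequality for each sign \<open>\<sigma>\<close> of the step. Together they equate minus the
    integral of \<open>dB\<close> against the derivative of the mollifier with \<open>c\<close>
    times the derivative of \<open>\<phi>\<close>.\<close>
  have dir: "\<sigma> * (- (LINT y|lborel. dB y * D\<eta> y)) \<le> \<sigma> * (c * \<phi>')"
    if \<sigma>: "\<sigma> = 1 \<or> \<sigma> = -1"
      and lim: "\<And>h. h \<longlonglongrightarrow> 0 \<Longrightarrow> (\<And>n::nat. h n \<noteq> 0) \<Longrightarrow> (\<And>n. \<bar>h n\<bar> \<le> 1) \<Longrightarrow>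
         (\<lambda>n. LINT y|lborel. dB y * ((\<eta> (y + E (h n)) - \<eta> y) / h n)) \<longlonglongrightarrow> (LINT y|lborel. dB y * D\<eta> y)"
      and dphi: "\<And>h. h \<longlonglongrightarrow> 0 \<Longrightarrow> (\<And>n::nat. h n \<noteq> 0) \<Longrightarrow> (\<lambda>n. (\<phi> (z1 + E (h n)) - \<phi> z1) / h n) \<longlonglongrightarrow> \<phi>'"
      and E: "\<And>t. E (- t) = - E t" "\<And>h. h \<longlonglongrightarrow> 0 \<Longrightarrow> (\<lambda>n::nat. E (h n)) \<longlonglongrightarrow> 0"
    for \<sigma> \<phi>' :: real and E :: "real \<Rightarrow> real \<times> real" and D\<eta>
  proof -
    define h where "h n = \<sigma> / (real n + 1)" for n :: nat
    have h: "h \<longlonglongrightarrow> 0" "h n \<noteq> 0" "\<bar>h n\<bar> \<le> 1" for n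
      using tendsto_mult_left[OF inv_lim, of \<sigma>] \<sigma> by (auto simp: h_def[abs_def] abs_div)
    have hm: "(\<lambda>n. - h n) \<longlonglongrightarrow> 0" using tendsto_minus[OF h(1)] by simp
    have 1: "(\<lambda>n. - (LINT y|lborel. dB y * ((\<eta> (y + E (- h n)) - \<eta> y) / (- h n)))) \<longlonglongrightarrow> - (LINT y|lborel. dB y * D\<eta> y)"
      by (intro tendsto_minus lim hm) (use h in auto)
    have e: "- (LINT y|lborel. dB y * ((\<eta> (y + E (- h n)) - \<eta> y) / (- h n))) = (J (z1 + E (h n)) - J z1) / h n" for n
    proof -
      have "J (z1 + E (h n)) - J z1 = (LINT y|lborel. dB y * \<eta> (y + E (- h n)) - dB y * \<eta> y)"
        using Jshift[of "E (h n)"] Jshift[of 0] int\<eta>(1)[of "- E (h n)"] int\<eta>(2) by (simp add: E(1))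
      moreover have "(LINT y|lborel. dB y * ((\<eta> (y + E (- h n)) - \<eta> y) / (- h n)))
        = (LINT y|lborel. (dB y * \<eta> (y + E (- h n)) - dB y * \<eta> y) / (- h n))"
        by (intro Bochner_Integration.integral_cong refl) (simp add: right_diff_distrib)
      ultimately show ?thesis by simp
    qed
    have 2: "(\<lambda>n. c * ((\<phi> (z1 + E (h n)) - \<phi> z1) / h n)) \<longlonglongrightarrow> c * \<phi>'"
      by (intro tendsto_mult_left dphi h)
    have "\<sigma> * (- (LINT y|lborel. dB y * D\<eta> y)) \<le> \<sigma> * (c * \<phi>')"
    proof (rule tendsto_le[OF _ tendsto_mult_left[OF 2] tendsto_mult_left[OF 1]])
      have "\<forall>\<^sub>F n in sequentially. z1 + E (h n) \<in> ?B" by (rule near[OF E(2)[OF h(1)]])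
      then show "\<forall>\<^sub>F n in sequentially. \<sigma> * (- (LINT y|lborel. dB y * ((\<eta> (y + E (- h n)) - \<eta> y) / (- h n))))
          \<le> \<sigma> * (c * ((\<phi> (z1 + E (h n)) - \<phi> z1) / h n))"
      proof eventually_elim
        case (elim n)
        have "J (z1 + E (h n)) - J z1 \<le> c * (\<phi> (z1 + E (h n)) - \<phi> z1)"
          using z1(2)[OF elim] by (simp add: G_def right_diff_distrib)
        then have "(J (z1 + E (h n)) - J z1) / (1 / (real n + 1)) \<le> c * (\<phi> (z1 + E (h n)) - \<phi> z1) / (1 / (real n + 1))"
          by (intro divide_right_mono) auto
        then show ?case unfolding e using \<sigma> by (auto simp: h_def)
      qed
    qed simp
    then show ?thesis .
  qed
  \<comment> \<open>The quotient lemmas speak of sequences; here they are applied to the constant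
    sequence \<open>dB\<close>.\<close>
  have vconst: "\<And>n::nat. dB \<in> borel_measurable borel" "\<And>(n::nat) z. \<bar>dB z\<bar> \<le> Md" "\<And>z. z \<in> UNIV \<Longrightarrow> (\<lambda>n::nat. dB z) \<longlonglongrightarrow> dB z"
    using Md by auto
  have Jt: "- (LINT y|lborel. dB y * dt \<eta> y) = c * \<phi>t z1"
  proof -
    have "\<sigma> * (- (LINT y|lborel. dB y * dt \<eta> y)) \<le> \<sigma> * (c * \<phi>t z1)" if "\<sigma> = 1 \<or> \<sigma> = -1" for \<sigma>
    proof (rule dir[where E="\<lambda>t. (t, 0)", OF that])
      show "(\<lambda>n. LINT y|lborel. dB y * ((\<eta> (y + (h n, 0)) - \<eta> y) / h n)) \<longlonglongrightarrow> (LINT y|lborel. dB y * dt \<eta> y)"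
        if "h \<longlonglongrightarrow> 0" "\<And>n::nat. h n \<noteq> 0" "\<And>n. \<bar>h n\<bar> \<le> 1" for h
        by (rule test_quotient_dt[OF \<eta>U vconst(1) dB_meas vconst(2,3) that])
      show "(\<lambda>n. (\<phi> (z1 + (h n, 0)) - \<phi> z1) / h n) \<longlonglongrightarrow> \<phi>t z1"
        if "h \<longlonglongrightarrow> 0" "\<And>n::nat. h n \<noteq> 0" for h
        using tendsto_sequence_quotient[OF \<phi>t[of "fst z1" "snd z1"] that] z1o by (cases z1) simp
      show "(\<lambda>n::nat. (h n, 0::real)) \<longlonglongrightarrow> 0" if "h \<longlonglongrightarrow> (0::real)" for h
        using tendsto_Pair[OF that tendsto_const, of 0] by (simp add: zero_prod_def)
    qed auto
    from this[of 1] this[of "-1"] show ?thesis by simp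
  qed
  have Jx: "- (LINT y|lborel. dB y * dx \<eta> y) = c * \<phi>x z1"
  proof -
    have "\<sigma> * (- (LINT y|lborel. dB y * dx \<eta> y)) \<le> \<sigma> * (c * \<phi>x z1)" if "\<sigma> = 1 \<or> \<sigma> = -1" for \<sigma>
    proof (rule dir[where E="\<lambda>t. (0, t)", OF that])
      show "(\<lambda>n. LINT y|lborel. dB y * ((\<eta> (y + (0, h n)) - \<eta> y) / h n)) \<longlonglongrightarrow> (LINT y|lborel. dB y * dx \<eta> y)"
        if "h \<longlonglongrightarrow> 0" "\<And>n::nat. h n \<noteq> 0" "\<And>n. \<bar>h n\<bar> \<le> 1" for h
        by (rule test_quotient_dx[OF \<eta>U vconst(1) dB_meas vconst(2,3) that])
      show "(\<lambda>n. (\<phi> (z1 + (0, h n)) - \<phi> z1) / h n) \<longlonglongrightarrow> \<phi>x z1"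
        if "h \<longlonglongrightarrow> 0" "\<And>n::nat. h n \<noteq> 0" for h
        using tendsto_sequence_quotient[OF \<phi>x[of "fst z1" "snd z1"] that] z1o by (cases z1) simp
      show "(\<lambda>n::nat. (0::real, h n)) \<longlonglongrightarrow> 0" if "h \<longlonglongrightarrow> (0::real)" for h
        using tendsto_Pair[OF tendsto_const that, of 0] by (simp add: zero_prod_def)
    qed auto
    from this[of 1] this[of "-1"] show ?thesis by simp
  qed
  \<comment> \<open>Second-order condition: the symmetric second differences of
    \<open>J - c * \<phi>\<close> at the maximum are nonpositive, and those of \<open>\<phi>\<close>
    are exactly \<open>\<phi>xx\<close> times the squared step.\<close>
  have Jxx: "(LINT y|lborel. dB y * dx (dx \<eta>) y) \<le> c * \<phi>xx z1"
  proof -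
    define h where "h n = 1 / (real n + 1)" for n :: nat
    have h: "h \<longlonglongrightarrow> 0" "h n \<noteq> 0" "\<bar>h n\<bar> \<le> 1" for n using inv_lim by (auto simp: h_def[abs_def])
    have lim: "(\<lambda>n. LINT y|lborel. dB y * ((\<eta> (y + (0, h n)) - 2 * \<eta> y + \<eta> (y - (0, h n))) / (h n)\<^sup>2))
        \<longlonglongrightarrow> (LINT y|lborel. dB y * dx (dx \<eta>) y)"
      by (rule test_quotient_dxx[OF \<eta>U vconst(1) dB_meas vconst(2,3) h])
    have neg: "y - (0, h n) = y + (0, - h n)" for y :: "real \<times> real" and n by (cases y) simp
    have J2: "(LINT y|lborel. dB y * ((\<eta> (y + (0, h n)) - 2 * \<eta> y + \<eta> (y - (0, h n))) / (h n)\<^sup>2))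
       = (J (z1 + (0, h n)) - 2 * J z1 + J (z1 + (0, - h n))) / (h n)\<^sup>2" for n
    proof -
      have "J (z1 + (0, h n)) - 2 * J z1 + J (z1 + (0, - h n))
        = (LINT y|lborel. dB y * \<eta> (y + (0, - h n)) - 2 * (dB y * \<eta> y) + dB y * \<eta> (y + (0, h n)))"
        using Jshift[of "(0, h n)"] Jshift[of "(0, - h n)"] Jshift[of 0] int\<eta> by simp
      moreover have "(LINT y|lborel. dB y * ((\<eta> (y + (0, h n)) - 2 * \<eta> y + \<eta> (y - (0, h n))) / (h n)\<^sup>2))
        = (LINT y|lborel. (dB y * \<eta> (y + (0, - h n)) - 2 * (dB y * \<eta> y) + dB y * \<eta> (y + (0, h n))) / (h n)\<^sup>2)"
        by (intro Bochner_Integration.integral_cong refl) (simp add: neg algebra_simps)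
      ultimately show ?thesis by simp
    qed
    have lim': "(\<lambda>n. (J (z1 + (0, h n)) - 2 * J z1 + J (z1 + (0, - h n))) / (h n)\<^sup>2)
      \<longlonglongrightarrow> (LINT y|lborel. dB y * dx (dx \<eta>) y)" using lim unfolding J2 .
    have hp: "(\<lambda>n. (0::real, h n)) \<longlonglongrightarrow> 0" "(\<lambda>n. (0::real, - h n)) \<longlonglongrightarrow> 0"
      using tendsto_Pair[OF tendsto_const h(1), of 0] tendsto_Pair[OF tendsto_const tendsto_minus[OF h(1)], of 0]
      by (simp_all add: zero_prod_def)
    show ?thesis
    proof (rule tendsto_le[OF _ tendsto_const lim'])
      show "\<forall>\<^sub>F n in sequentially. (J (z1 + (0, h n)) - 2 * J z1 + J (z1 + (0, - h n))) / (h n)\<^sup>2 \<le> c * \<phi>xx z1"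
        using near[OF hp(1)] near[OF hp(2)]
      proof eventually_elim
        case (elim n)
        have "J (z1 + (0, h n)) - 2 * J z1 + J (z1 + (0, - h n))
          \<le> c * (\<phi> (z1 + (0, h n)) - 2 * \<phi> z1 + \<phi> (z1 - (0, h n)))"
          using z1(2)[OF elim(1)] z1(2)[OF elim(2)] unfolding G_def neg by (simp add: algebra_simps)
        also have "\<dots> = c * \<phi>xx z1 * (h n)\<^sup>2" unfolding \<phi>xx by simp
        finally show ?case using h(2)[of n] by (simp add: divide_le_eq)
      qed
    qed simp
  qed
  have \<eta>0: "\<eta> y = 0 \<and> dt \<eta> y = 0 \<and> dx \<eta> y = 0 \<and> dx (dx \<eta>) y = 0" if "y \<notin> ?B2" for y
  proof -
    have o: "open (- ?B2)" by (intro open_Compl closed_cbox)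
    have z: "\<eta> y = 0" if "y \<in> - ?B2" for y using supp(1)[OF z1(1), of y] that by (auto simp: \<eta>_def)
    have x: "dx \<eta> y = 0" if "y \<in> - ?B2" for y using dx_zero_outside[OF o that] z by blast
    show ?thesis using that z x dt_zero_outside[OF o _ z] dx_zero_outside[OF o _ x] by auto
  qed
  have conv: "(LINT z|lebesgue_on D. d z * \<zeta> z) = (LINT z|lborel. dB z * \<zeta> z)"
    if "\<zeta> \<in> borel_measurable borel" "\<And>z. z \<notin> ?B2 \<Longrightarrow> \<zeta> z = 0" for \<zeta> :: "real \<times> real \<Rightarrow> real"
  proof -
    have "(LINT z|lebesgue_on D. d z * \<zeta> z) = (LINT z|lebesgue_on D. dB z * \<zeta> z)"
      using that(2) by (intro Bochner_Integration.integral_cong refl) (auto simp: dB_def indicator_def)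
    also have "\<dots> = (LINT z|lborel. dB z * \<zeta> z)"
    proof (rule integral_lebesgue_on_eq_lborel)
      show "(\<lambda>z. dB z * \<zeta> z) \<in> borel_measurable borel" using that(1) by measurable
      show "dB z * \<zeta> z = 0" if "z \<notin> D" for z using that B2 by (auto simp: dB_def indicator_def)
    qed (use D in auto)
    finally show ?thesis .
  qed
  have reg: "continuous_on UNIV \<eta>" "dt \<eta> \<in> borel_measurable borel" "dx \<eta> \<in> borel_measurable borel" "dx (dx \<eta>) \<in> borel_measurable borel"
    "\<eta> \<in> borel_measurable borel"
    using test_function_Ck[OF \<eta>U, of "Suc (Suc 0)"] by (auto intro: borel_measurable_continuous_onI)
  have w: "(LINT z|lebesgue_on D. gt z * \<eta> z) = c * \<phi>t z1" "(LINT z|lebesgue_on D. gx z * \<eta> z) = c * \<phi>x z1"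
    "(LINT z|lebesgue_on D. gxx z * \<eta> z) \<le> c * \<phi>xx z1"
    using weak \<eta>D Jt Jx Jxx conv[OF reg(2)] conv[OF reg(3)] conv[OF reg(4)] \<eta>0
    by (auto simp: weak_partial_def numeral_2_eq_2 dest!: bspec[OF _ \<eta>D])
  have li: "locally_integrable D d" "locally_integrable D gt" "locally_integrable D gx" "locally_integrable D gxx"
    using weak by (auto simp: weak_partial_def)
  have im: "integrable (lebesgue_on D) (\<lambda>z. u z * \<eta> z)" if "locally_integrable D u" for u
    using \<eta>0 by (intro locally_integrable_mult_test[OF that D reg(1) compact_cbox B2]) auto
  have "(LINT z|lebesgue_on D. (gt z - a * gxx z - b * gx z + r * d z) * \<eta> z)
     = (LINT z|lebesgue_on D. gt z * \<eta> z) - a * (LINT z|lebesgue_on D. gxx z * \<eta> z)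
       - b * (LINT z|lebesgue_on D. gx z * \<eta> z) + r * (LINT z|lebesgue_on D. d z * \<eta> z)"
    using li[THEN im] by (simp add: left_diff_distrib distrib_right mult.assoc)
  \<comment> \<open>\<open>\<eta>\<close> is nonnegative and vanishes off the double box, on which
    \<open>d\<close> is positive; so the differential inequality is available almost everywhere on
    its support.\<close>
  moreover have "(LINT z|lebesgue_on D. (gt z - a * gxx z - b * gx z + r * d z) * \<eta> z) \<le> 0"
  proof -
    have "AE z in lebesgue_on D. 0 \<le> - ((gt z - a * gxx z - b * gx z + r * d z) * \<eta> z)"
      using sub
    proof eventually_elim
      case (elim z)
      show ?case
      proof (cases "z \<in> ?B2")
        case True
        then show ?thesis using elim d_pos[OF True] mollifier_nonneg[of \<epsilon> z1 z]
          by (auto simp: \<eta>_def mult_nonpos_nonneg)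
      qed (use \<eta>0 in auto)
    qed
    from integral_nonneg_AE[OF this] show ?thesis by simp
  qed
  moreover have "(LINT z|lebesgue_on D. d z * \<eta> z) = J z1"
    using conv[OF reg(5)] \<eta>0 by (simp add: J_def \<eta>_def)
  ultimately have "c * \<phi>t z1 - a * (LINT z|lebesgue_on D. gxx z * \<eta> z) - b * (c * \<phi>x z1) + r * J z1 \<le> 0"
    using w by simp
  moreover have "a * (LINT z|lebesgue_on D. gxx z * \<eta> z) \<le> a * (c * \<phi>xx z1)" "r * (c * \<phi> z1) \<le> r * J z1"
    using w(3) a r Jz1 by (auto intro!: mult_left_mono)
  ultimately have "c * \<phi>t z1 - a * (c * \<phi>xx z1) - b * (c * \<phi>x z1) + r * (c * \<phi> z1) \<le> 0" by linarith
  then have "c * (\<phi>t z1 - a * \<phi>xx z1 - b * \<phi>x z1 + r * \<phi> z1) \<le> 0" by (simp add: algebra_simps)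
  moreover have "0 < c * (\<phi>t z1 - a * \<phi>xx z1 - b * \<phi>x z1 + r * \<phi> z1)" using c super[OF z1o] by simp
  ultimately show False by linarith
qed


lemma cbox_pair: "(x, y) \<in> cbox ((a, b) - (c, d)) ((a, b) + (c, d)) \<longleftrightarrow> \<bar>x - a\<bar> \<le> c \<and> \<bar>y - b\<bar> \<le> (d::real)"
  "(x, y) \<in> box ((a, b) - (c, d)) ((a, b) + (c, d)) \<longleftrightarrow> \<bar>x - a\<bar> < c \<and> \<bar>y - b\<bar> < d" for x a c :: real
  by (auto simp: mem_box Basis_prod_def inner_prod_def)

text \<open>The barrier \<open>\<delta> * (exp (\<lambda> * \<tau>) * (1 + x\<^sup>2) + 1 / (T - \<tau>))\<close> keeps the maximum away from infinity and
  from the final time; the quadratic perturbation by \<open>e\<close> makes it strict.\<close>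

lemma comparison_principle:
  fixes d gt gx gxx :: "real \<times> real \<Rightarrow> real"
  assumes T: "0 < T" and a: "0 < a" and r: "0 \<le> r"
    and X: "open Xo" "closed Xc" "Xo \<subseteq> Xc"
    and cont: "continuous_on ({0..T} \<times> Xc) d" and M: "\<And>z. z \<in> {0..T} \<times> Xc \<Longrightarrow> d z \<le> M"
    and init: "\<And>x. x \<in> Xc \<Longrightarrow> d (0, x) \<le> 0"
    and lateral: "\<And>\<tau> x. \<tau> \<in> {0..T} \<Longrightarrow> x \<in> Xc - Xo \<Longrightarrow> d (\<tau>, x) \<le> 0"
    and weak: "weak_partial 1 0 ({0<..<T} \<times> Xo) d gt" "weak_partial 0 1 ({0<..<T} \<times> Xo) d gx"
      "weak_partial 0 2 ({0<..<T} \<times> Xo) d gxx"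
    and sub: "AE z in lebesgue_on ({0<..<T} \<times> Xo). 0 < d z \<longrightarrow> gt z - a * gxx z - b * gx z + r * d z \<le> 0"
    and z: "z \<in> {0..T} \<times> Xc"
  shows "d z \<le> 0"
proof (rule ccontr)
  assume "\<not> d z \<le> 0"
  let ?D = "{0<..<T} \<times> Xo"
  have oD: "open ?D" using X by (intro open_Times) auto
  \<comment> \<open>The barrier is infinite at time \<open>T\<close>, so a positive value at the
    final time is first moved to an earlier time by continuity.\<close>
  obtain zs where zs: "zs \<in> {0..<T} \<times> Xc" "0 < d zs"
  proof (cases "fst z < T")
    case True
    then show ?thesis using that[of z] z \<open>\<not> d z \<le> 0\<close> by (auto simp: mem_Times_iff)
  next
    case False
    obtain x where zx: "z = (T, x)" "x \<in> Xc" using z False by (cases z) auto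
    have "continuous_on {0..T} (\<lambda>t. d (t, x))"
      using zx by (intro continuous_on_compose2[OF cont] continuous_intros) auto
    then have "((\<lambda>t. d (t, x)) \<longlongrightarrow> d (T, x)) (at T within {0..T})"
      using T by (auto simp: continuous_on_def)
    then have "((\<lambda>t. d (t, x)) \<longlongrightarrow> d (T, x)) (at_left T)"
      using T by (simp add: at_within_Icc_at_left)
    then have "\<forall>\<^sub>F t in at_left T. 0 < d (t, x)"
      using \<open>\<not> d z \<le> 0\<close> zx by (intro order_tendstoD(1)) auto
    moreover have "\<forall>\<^sub>F t in at_left T. 0 < t \<and> t < T"
      using T by (intro eventually_conj eventually_at_left_real) (auto simp: eventually_at_left_field intro: exI[of _ 0])
    ultimately have "\<forall>\<^sub>F t in at_left T. 0 < d (t, x) \<and> 0 < t \<and> t < T" by (rule eventually_conj)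
    then obtain t where "0 < d (t, x)" "0 < t" "t < T"
      using eventually_happens'[OF trivial_limit_at_left_real] by blast
    then show ?thesis using that[of "(t, x)"] zx by auto
  qed
  \<comment> \<open>Large enough for \<open>\<Lambda> * (1 + x\<^sup>2)\<close> to dominate
    \<open>2 * a + 2 * b * x\<close>, the contribution of the second- and first-order terms of the
    barrier.\<close>
  define \<Lambda> where "\<Lambda> = 2 * a + \<bar>b\<bar>"
  have \<Lambda>0: "0 \<le> \<Lambda>" using a by (simp add: \<Lambda>_def)
  define \<phi>1 where "\<phi>1 z = exp (\<Lambda> * fst z) * (1 + (snd z)\<^sup>2) + 1 / (T - fst z)" for z :: "real \<times> real"
  have \<phi>1_pos: "0 < \<phi>1 z" if "fst z < T" for z
  proof -
    have "0 < exp (\<Lambda> * fst z) * (1 + (snd z)\<^sup>2)" by (intro mult_pos_pos add_pos_nonneg) auto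
    moreover have "0 < 1 / (T - fst z)" using that by simp
    ultimately show ?thesis unfolding \<phi>1_def by (rule add_pos_pos)
  qed
  \<comment> \<open>The factor 2 leaves \<open>d\<close> strictly above the barrier at
    \<open>zs\<close>.\<close>
  define \<delta> where "\<delta> = d zs / (2 * \<phi>1 zs)"
  have ps: "0 < \<phi>1 zs" using zs by (intro \<phi>1_pos) auto
  have \<delta>: "0 < \<delta>" "\<delta> * \<phi>1 zs < d zs" using ps zs(2) by (auto simp: \<delta>_def)
  define \<Phi> where "\<Phi> z = d z - \<delta> * \<phi>1 z" for z
  have M0: "0 < M" using zs M[of zs] by force
  \<comment> \<open>Within \<open>t0\<close> of the final time the term
    \<open>\<delta> / (T - \<tau>)\<close> is at least \<open>M\<close>; beyond \<open>R\<close> in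
    space the term \<open>\<delta> * (1 + x\<^sup>2)\<close> is. So the maximum is sought on a
    compact set.\<close>
  define t0 where "t0 = \<delta> / M"
  define R where "R = M / \<delta> + 1"
  have t0: "0 < t0" using \<delta> M0 by (simp add: t0_def)
  have R: "0 < R" using \<delta> M0 by (simp add: R_def add_pos_pos)
  define S where "S = {0..T - t0} \<times> (Xc \<inter> {-R..R})"
  have outside: "\<Phi> z \<le> 0" if zo: "z \<in> {0..<T} \<times> Xc" "z \<notin> S" for z
  proof -
    obtain \<tau> x where zz: "z = (\<tau>, x)" "0 \<le> \<tau>" "\<tau> < T" "x \<in> Xc" using zo(1) by auto
    have "M \<le> \<delta> * \<phi>1 z"
    proof (cases "\<tau> \<le> T - t0")
      case False
      then have "T - \<tau> \<le> \<delta> / M" by (simp add: t0_def)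
      then have "M * (T - \<tau>) \<le> \<delta>" using M0 by (simp add: pos_le_divide_eq mult.commute)
      then have "M \<le> \<delta> * (1 / (T - \<tau>))" using zz by (simp add: pos_le_divide_eq)
      also have "\<dots> \<le> \<delta> * \<phi>1 z" unfolding \<phi>1_def zz using \<delta>(1)
        by (intro mult_left_mono) (auto simp: add_nonneg_nonneg)
      finally show ?thesis .
    next
      case True
      then have "R < \<bar>x\<bar>" using zo(2) zz by (auto simp: S_def)
      moreover have "1 \<le> R" using divide_pos_pos[OF M0 \<delta>(1)] by (simp add: R_def)
      ultimately have "R * 1 \<le> \<bar>x\<bar> * \<bar>x\<bar>" by (intro mult_mono) auto
      then have "M / \<delta> \<le> 1 + x\<^sup>2" by (simp add: R_def power2_eq_square)
      then have "M \<le> \<delta> * (1 + x\<^sup>2)" using \<delta>(1) by (simp add: pos_divide_le_eq mult.commute)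
      also have "\<dots> \<le> \<delta> * \<phi>1 z"
      proof -
        have "1 * (1 + x\<^sup>2) \<le> exp (\<Lambda> * \<tau>) * (1 + x\<^sup>2)"
          using \<Lambda>0 zz by (intro mult_right_mono) (auto simp: add_nonneg_nonneg)
        moreover have "0 \<le> 1 / (T - \<tau>)" using zz by simp
        ultimately have "1 * (1 + x\<^sup>2) + 0 \<le> \<phi>1 z" unfolding \<phi>1_def zz(1) fst_conv snd_conv by (rule add_mono)
        then have "1 + x\<^sup>2 \<le> \<phi>1 z" by simp
        then show ?thesis using \<delta>(1) by simp
      qed
      finally show ?thesis .
    qed
    then show ?thesis using M[of z] zz by (auto simp: \<Phi>_def)
  qed
  have zsS: "zs \<in> S" using outside[OF zs(1)] \<delta>(2) by (auto simp: \<Phi>_def)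
  have "compact S" unfolding S_def using X(2) by (intro compact_Times) (auto intro: closed_Int_compact)
  moreover have "continuous_on S \<Phi>"
  proof -
    have "continuous_on S d" using t0 by (intro continuous_on_subset[OF cont]) (auto simp: S_def)
    moreover have "continuous_on S \<phi>1" unfolding \<phi>1_def
      using t0 by (intro continuous_intros) (auto simp: S_def)
    ultimately show ?thesis unfolding \<Phi>_def by (intro continuous_intros)
  qed
  ultimately obtain z0 where z0: "z0 \<in> S" "\<And>z. z \<in> S \<Longrightarrow> \<Phi> z \<le> \<Phi> z0"
    using continuous_attains_sup[of S \<Phi>] zsS by blast
  have \<Phi>0: "0 < \<Phi> z0" using z0(2)[OF zsS] \<delta>(2) by (simp add: \<Phi>_def)
  have max: "\<Phi> z \<le> \<Phi> z0" if "z \<in> {0..<T} \<times> Xc" for z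
    using z0(2)[of z] outside[OF that] \<Phi>0 by (cases "z \<in> S") auto
  obtain \<tau>0 x0 where zz: "z0 = (\<tau>0, x0)" "0 \<le> \<tau>0" "\<tau>0 < T" "x0 \<in> Xc" using z0(1) t0 by (auto simp: S_def)
  have d0: "0 < d z0" 
  proof -
    have "0 < \<phi>1 z0" using zz by (intro \<phi>1_pos) auto
    then have "0 < \<delta> * \<phi>1 z0" using \<delta>(1) by simp
    then show ?thesis using \<Phi>0 unfolding \<Phi>_def by linarith
  qed
  \<comment> \<open>Positivity of \<open>d\<close> at \<open>z0\<close> rules out time 0 and the
    lateral boundary.\<close>
  have z0D: "z0 \<in> ?D" using init[of x0] lateral[of \<tau>0 x0] d0 zz by (cases "\<tau>0 = 0") auto
  \<comment> \<open>The operator applied to \<open>\<delta> * \<phi>1\<close>. It is strictly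
    positive at \<open>z0\<close> owing to the time derivative of the term
    \<open>1 / (T - \<tau>)\<close>.\<close>
  define F where "F z = \<delta> * (\<Lambda> * exp (\<Lambda> * fst z) * (1 + (snd z)\<^sup>2) + 1 / (T - fst z)\<^sup>2)
      - a * (\<delta> * (exp (\<Lambda> * fst z) * 2)) - b * (\<delta> * (exp (\<Lambda> * fst z) * (2 * snd z))) + r * (\<delta> * \<phi>1 z)" for z
  have F0: "0 < F z0"
  proof -
    define y where "y = exp (\<Lambda> * \<tau>0)"
    have "2 * a + 2 * (b * x0) \<le> \<Lambda> * (1 + x0\<^sup>2)"
    proof -
      have "2 * (b * x0) \<le> \<bar>b\<bar> * (2 * \<bar>x0\<bar>)" by (metis abs_ge_self abs_mult mult.left_commute mult_le_cancel_left_pos zero_less_numeral)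
      also have "\<dots> \<le> \<bar>b\<bar> * (1 + x0\<^sup>2)"
        using zero_le_power2[of "\<bar>x0\<bar> - 1"] by (intro mult_left_mono) (auto simp: power2_diff)
      finally have "2 * (b * x0) \<le> \<bar>b\<bar> * (1 + x0\<^sup>2)" .
      moreover have "2 * a * 1 \<le> 2 * a * (1 + x0\<^sup>2)" using a by (intro mult_left_mono) auto
      ultimately show ?thesis by (simp add: \<Lambda>_def distrib_right)
    qed
    then have "0 \<le> y * (\<Lambda> * (1 + x0\<^sup>2) - 2 * a - 2 * (b * x0))" by (simp add: y_def)
    then have "0 \<le> \<delta> * (y * (\<Lambda> * (1 + x0\<^sup>2) - 2 * a - 2 * (b * x0)))" using \<delta>(1) by simp
    moreover have "0 \<le> r * (\<delta> * \<phi>1 z0)" using r \<delta>(1) \<phi>1_pos[of z0] zz by simp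
    moreover have "0 < \<delta> * (1 / (T - \<tau>0)\<^sup>2)" using \<delta>(1) zz by simp
    moreover have "F z0 = \<delta> * (y * (\<Lambda> * (1 + x0\<^sup>2) - 2 * a - 2 * (b * x0))) + \<delta> * (1 / (T - \<tau>0)\<^sup>2) + r * (\<delta> * \<phi>1 z0)"
      by (simp add: F_def zz y_def algebra_simps)
    ultimately show ?thesis by linarith
  qed
  \<comment> \<open>At \<open>z0\<close> the perturbation \<open>e * q\<close> and its first
    derivatives vanish, so it contributes only \<open>- 2 * a * e\<close> to the operator; this
    choice spends half of \<open>F z0\<close>.\<close>
  define e where "e = F z0 / (4 * a)"
  have e: "0 < e" "2 * a * e < F z0" using F0 a by (auto simp: e_def)
  define q where "q z = (fst z - \<tau>0)\<^sup>2 + (snd z - x0)\<^sup>2" for z :: "real \<times> real"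
  define \<phi> where "\<phi> z = \<delta> * \<phi>1 z + e * q z" for z
  define \<phi>t where "\<phi>t z = \<delta> * (\<Lambda> * exp (\<Lambda> * fst z) * (1 + (snd z)\<^sup>2) + 1 / (T - fst z)\<^sup>2) + e * (2 * (fst z - \<tau>0))" for z
  define \<phi>x where "\<phi>x z = \<delta> * (exp (\<Lambda> * fst z) * (2 * snd z)) + e * (2 * (snd z - x0))" for z
  define \<phi>xx where "\<phi>xx z = \<delta> * (exp (\<Lambda> * fst z) * 2) + e * 2" for z :: "real \<times> real"
  define H where "H z = \<phi>t z - a * \<phi>xx z - b * \<phi>x z + r * \<phi> z" for z
  have H0: "0 < H z0"
  proof -
    have "a * (\<delta> * (exp (\<Lambda> * \<tau>0) * 2) + e * 2) = a * (\<delta> * (exp (\<Lambda> * \<tau>0) * 2)) + a * (e * 2)"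
      by (rule distrib_left)
    then have H1: "a * \<phi>xx z0 = a * (\<delta> * (exp (\<Lambda> * fst z0) * 2)) + 2 * a * e"
      by (simp only: \<phi>xx_def zz(1) fst_conv mult_ac)
    have rearr: "x - (y + u) - v + w = x - y - v + w - u" for x y u v w :: real by simp
    have H2: "\<phi>t z0 = \<delta> * (\<Lambda> * exp (\<Lambda> * fst z0) * (1 + (snd z0)\<^sup>2) + 1 / (T - fst z0)\<^sup>2)"
      "\<phi>x z0 = \<delta> * (exp (\<Lambda> * fst z0) * (2 * snd z0))" "\<phi> z0 = \<delta> * \<phi>1 z0"
      by (simp_all add: \<phi>t_def \<phi>x_def \<phi>_def q_def zz(1))
    have "H z0 = F z0 - 2 * a * e" unfolding H_def F_def H1 H2 by (rule rearr)
    then show ?thesis using e by simp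
  qed
  have "isCont H z0"
    unfolding H_def \<phi>t_def \<phi>x_def \<phi>xx_def \<phi>_def \<phi>1_def q_def using zz
    by (intro continuous_intros) auto
  moreover have "isCont d z0"
    using continuous_on_subset[OF cont, of ?D] X(3) z0D continuous_on_eq_continuous_at[OF oD]
    by (metis (no_types, lifting) Sigma_mono greaterThanLessThan_subseteq_atLeastAtMost_iff order_refl)
  ultimately have "\<forall>\<^sub>F z in at z0. 0 < H z" "\<forall>\<^sub>F z in at z0. 0 < d z"
    using H0 d0 by (auto simp: isCont_def intro: order_tendstoD)
  moreover have "\<forall>\<^sub>F z in at z0. z \<in> ?D" using oD z0D by (intro eventually_at_in_open')
  ultimately have "\<forall>\<^sub>F z in at z0. 0 < H z \<and> 0 < d z \<and> z \<in> ?D" by eventually_elim auto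
  then have "\<exists>s>0. \<forall>z\<in>UNIV. z \<noteq> z0 \<and> dist z z0 < s \<longrightarrow> 0 < H z \<and> 0 < d z \<and> z \<in> ?D"
    unfolding eventually_at .
  then obtain s where s: "0 < s"
    and s1: "\<forall>z\<in>UNIV. z \<noteq> z0 \<and> dist z z0 < s \<longrightarrow> 0 < H z \<and> 0 < d z \<and> z \<in> ?D"
    by (elim exE conjE) (rule that)
  have s': "0 < H z \<and> 0 < d z \<and> z \<in> ?D" if "dist z z0 < s" for z
  proof (cases "z = z0")
    case True
    show ?thesis unfolding True using H0 d0 z0D by (intro conjI)
  next
    case False
    then show ?thesis using s1 that by (simp only: UNIV_I ball_simps simp_thms)
  qed
  \<comment> \<open>A point of the double box has distance at most \<open>4 * \<rho>\<close> from
    \<open>z0\<close>, so \<open>s / 5\<close> keeps it within distance \<open>s\<close>.\<close>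
  define \<rho> where "\<rho> = s / 5"
  have \<rho>: "0 < \<rho>" using s by (simp add: \<rho>_def)
  have cb: "z \<in> cbox (z0 - (c, c)) (z0 + (c, c)) \<longleftrightarrow> \<bar>fst z - \<tau>0\<bar> \<le> c \<and> \<bar>snd z - x0\<bar> \<le> c"
    "z \<in> box (z0 - (c, c)) (z0 + (c, c)) \<longleftrightarrow> \<bar>fst z - \<tau>0\<bar> < c \<and> \<bar>snd z - x0\<bar> < c" for z c
    unfolding zz(1) using cbox_pair[of "fst z" "snd z" \<tau>0 x0 c c] by (simp_all only: prod.collapse)
  have near: "0 < H z \<and> 0 < d z \<and> z \<in> ?D" if "z \<in> cbox (z0 - (2 * \<rho>, 2 * \<rho>)) (z0 + (2 * \<rho>, 2 * \<rho>))" for z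
  proof (rule s')
    note bz = cb(1)[THEN iffD1, OF that]
    have "dist z z0 \<le> \<bar>fst z - \<tau>0\<bar> + \<bar>snd z - x0\<bar>"
      unfolding dist_prod_def dist_real_def zz(1) fst_conv snd_conv power2_abs
      by (rule sqrt_sum_squares_le_sum_abs)
    also have "\<dots> \<le> 2 * \<rho> + 2 * \<rho>" by (rule add_mono[OF bz[THEN conjunct1] bz[THEN conjunct2]])
    also have "\<dots> < s" using s by (simp add: \<rho>_def)
    finally show "dist z z0 < s" .
  qed
  have sub2: "z \<in> cbox (z0 - (2 * \<rho>, 2 * \<rho>)) (z0 + (2 * \<rho>, 2 * \<rho>))"
    if "z \<in> cbox (z0 - (\<rho>, \<rho>)) (z0 + (\<rho>, \<rho>))" for z
    using that \<rho> unfolding cb by linarith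
  have subo: "z \<in> cbox (z0 - (\<rho>, \<rho>)) (z0 + (\<rho>, \<rho>))" if "z \<in> box (z0 - (\<rho>, \<rho>)) (z0 + (\<rho>, \<rho>))" for z
    using that box_subset_cbox by blast
  have ltT: "fst z < T" if "z \<in> cbox (z0 - (\<rho>, \<rho>)) (z0 + (\<rho>, \<rho>))" for z
    using near[OF sub2[OF that]] by (simp add: mem_Times_iff)
  \<comment> \<open>On the boundary of the small box \<open>q\<close> is at least
    \<open>\<rho>\<^sup>2\<close>; this provides the gap \<open>e * \<rho>\<^sup>2\<close> that
    makes the maximum strict.\<close>
  show False
  proof (rule no_strict_interior_maximum[OF oD \<rho> a r, where d=d and \<phi>=\<phi> and \<phi>t=\<phi>t and \<phi>x=\<phi>x and \<phi>xx=\<phi>xx and m="e * \<rho>\<^sup>2" and b=b])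
    show "cbox (z0 - (2 * \<rho>, 2 * \<rho>)) (z0 + (2 * \<rho>, 2 * \<rho>)) \<subseteq> ?D" using near by blast
    then show "continuous_on (cbox (z0 - (2 * \<rho>, 2 * \<rho>)) (z0 + (2 * \<rho>, 2 * \<rho>))) d"
      using X(3) by (intro continuous_on_subset[OF cont]) force
    show "0 < d z" if "z \<in> cbox (z0 - (2 * \<rho>, 2 * \<rho>)) (z0 + (2 * \<rho>, 2 * \<rho>))" for z using near[OF that] by simp
    show "weak_partial 1 0 ?D d gt" "weak_partial 0 1 ?D d gx" "weak_partial 0 2 ?D d gxx" by (rule weak)+
    show "AE z in lebesgue_on ?D. 0 < d z \<longrightarrow> gt z - a * gxx z - b * gx z + r * d z \<le> 0" by (rule sub)
    show "continuous_on (cbox (z0 - (\<rho>, \<rho>)) (z0 + (\<rho>, \<rho>))) \<phi>"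
      unfolding \<phi>_def \<phi>1_def q_def using ltT by (intro continuous_intros) force
    show "\<phi> z0 < d z0" using \<Phi>0 by (simp add: \<phi>_def q_def zz \<Phi>_def)
    show "0 < e * \<rho>\<^sup>2" using e \<rho> by simp
    show "d z - \<phi> z \<le> d z0 - \<phi> z0 - e * \<rho>\<^sup>2"
      if z: "z \<in> cbox (z0 - (\<rho>, \<rho>)) (z0 + (\<rho>, \<rho>))" "z \<notin> box (z0 - (\<rho>, \<rho>)) (z0 + (\<rho>, \<rho>))" for z
    proof -
      have "z \<in> {0..<T} \<times> Xc" using near[OF sub2[OF z(1)]] X(3) by (auto simp: mem_Times_iff)
      from max[OF this] have "\<Phi> z \<le> \<Phi> z0" .
      moreover have "\<rho>\<^sup>2 \<le> q z"
      proof -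
        have "\<rho> \<le> \<bar>fst z - \<tau>0\<bar> \<or> \<rho> \<le> \<bar>snd z - x0\<bar>" using z(2) unfolding cb by linarith
        then have "\<rho>\<^sup>2 \<le> (fst z - \<tau>0)\<^sup>2 \<or> \<rho>\<^sup>2 \<le> (snd z - x0)\<^sup>2"
          using \<rho> by (simp add: abs_le_square_iff[symmetric])
        then show ?thesis
          unfolding q_def using zero_le_power2[of "fst z - \<tau>0"] zero_le_power2[of "snd z - x0"] by linarith
      qed
      then have "e * \<rho>\<^sup>2 \<le> e * q z" using e by (intro mult_left_mono) auto
      ultimately show ?thesis by (simp add: \<Phi>_def \<phi>_def q_def zz)
    qed
    show "((\<lambda>s. \<phi> (s, x)) has_real_derivative \<phi>t (\<tau>, x)) (at \<tau>)"
      if "(\<tau>, x) \<in> box (z0 - (\<rho>, \<rho>)) (z0 + (\<rho>, \<rho>))" for \<tau> x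
    proof -
      have "\<tau> < T" using ltT[OF subo[OF that]] by simp
      then show ?thesis unfolding \<phi>_def \<phi>1_def q_def \<phi>t_def fst_conv snd_conv
        by (auto intro!: derivative_eq_intros simp: power2_eq_square field_simps)
    qed
    show "((\<lambda>y. \<phi> (\<tau>, y)) has_real_derivative \<phi>x (\<tau>, x)) (at x)"
      if "(\<tau>, x) \<in> box (z0 - (\<rho>, \<rho>)) (z0 + (\<rho>, \<rho>))" for \<tau> x
      unfolding \<phi>_def \<phi>1_def q_def \<phi>x_def fst_conv snd_conv
      by (auto intro!: derivative_eq_intros simp: algebra_simps)
    show "\<phi> (z + (0, k)) - 2 * \<phi> z + \<phi> (z - (0, k)) = k\<^sup>2 * \<phi>xx z" for z k
      by (cases z) (simp add: \<phi>_def \<phi>1_def q_def \<phi>xx_def power2_eq_square algebra_simps)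
    show "0 < \<phi>t z - a * \<phi>xx z - b * \<phi>x z + r * \<phi> z" if "z \<in> box (z0 - (\<rho>, \<rho>)) (z0 + (\<rho>, \<rho>))" for z
      using near[OF sub2[OF subo[OF that]]] by (simp add: H_def)
  qed
qed

section \<open>Double obstacle problems\<close>

lemma test_functions_dt: assumes "\<eta> \<in> test_functions D" shows "dt \<eta> \<in> test_functions D"
  and test_functions_dx: "dx \<eta> \<in> test_functions D"
proof -
  let ?K = "closure {z. \<eta> z \<noteq> 0}"
  have K: "compact ?K" "?K \<subseteq> D" "\<And>k. Ck (Suc k) \<eta>" using assms by (auto simp: test_functions_def)
  have o: "open (- ?K)" by (intro open_Compl closed_closure)
  have 0: "\<eta> z = 0" if "z \<in> - ?K" for z using that closure_subset[of "{z. \<eta> z \<noteq> 0}"] by auto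
  have test: "\<zeta> \<in> test_functions D" if "\<And>k. Ck k \<zeta>" "\<And>z. z \<in> - ?K \<Longrightarrow> \<zeta> z = 0" for \<zeta>
  proof -
    have "{z. \<zeta> z \<noteq> 0} \<subseteq> ?K" using that(2) by (metis (mono_tags) ComplI mem_Collect_eq subsetI)
    then have cl: "closure {z. \<zeta> z \<noteq> 0} \<subseteq> ?K" by (intro closure_minimal closed_closure)
    have "compact (?K \<inter> closure {z. \<zeta> z \<noteq> 0})" by (rule compact_Int_closed[OF K(1) closed_closure])
    then have "compact (closure {z. \<zeta> z \<noteq> 0})" using cl by (simp only: Int_absorb1)
    then show ?thesis using that(1) cl K(2) unfolding test_functions_def by blast
  qed
  have Ck: "Ck k (dt \<eta>)" "Ck k (dx \<eta>)" for k using K(3)[of k] by auto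
  show "dt \<eta> \<in> test_functions D"
  proof (rule test)
    show "dt \<eta> z = 0" if "z \<in> - ?K" for z using dt_zero_outside[of "- ?K" z \<eta>] o that 0 by blast
  qed (rule Ck)
  show "dx \<eta> \<in> test_functions D"
  proof (rule test)
    show "dx \<eta> z = 0" if "z \<in> - ?K" for z using dx_zero_outside[of "- ?K" z \<eta>] o that 0 by blast
  qed (rule Ck)
qed

text \<open>Makes the left-hand integrands of \<open>weak_partial\<close> integrable, so that the
  integral of a difference may be split.\<close>

lemma test_functions_deriv:
  assumes "\<eta> \<in> test_functions D" shows "(dt ^^ i) ((dx ^^ j) \<eta>) \<in> test_functions D"
proof -
  have "(dx ^^ j) \<eta> \<in> test_functions D" by (induction j) (auto intro: assms test_functions_dx)
  then show ?thesis by (induction i) (auto intro: test_functions_dt)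
qed

lemma weak_partial_diff:
  assumes D: "open D" and u: "weak_partial i j D u g" and v: "weak_partial i j D v g'"
  shows "weak_partial i j D (\<lambda>z. u z - v z) (\<lambda>z. g z - g' z)"
  unfolding weak_partial_def
proof (intro conjI ballI)
  have li: "locally_integrable D u" "locally_integrable D v" "locally_integrable D g" "locally_integrable D g'"
    using u v by (auto simp: weak_partial_def)
  then show "locally_integrable D (\<lambda>z. u z - v z)" "locally_integrable D (\<lambda>z. g z - g' z)"
    by (auto simp: locally_integrable_def)
  fix \<eta> assume \<eta>: "\<eta> \<in> test_functions D"
  have int: "integrable (lebesgue_on D) (\<lambda>z. f z * \<zeta> z)"
    if f: "locally_integrable D f" and \<zeta>: "\<zeta> \<in> test_functions D" for f \<zeta>
  proof -
    obtain K where "compact K" "K \<subseteq> D" "\<And>z. z \<notin> K \<Longrightarrow> \<zeta> z = 0"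
      using test_function_support[OF \<zeta>] by metis
    then show ?thesis by (rule locally_integrable_mult_test[OF f D test_function_continuous[OF \<zeta>]])
  qed
  let ?\<zeta> = "(dt ^^ i) ((dx ^^ j) \<eta>)"
  have "(LINT z|lebesgue_on D. (u z - v z) * ?\<zeta> z)
      = (LINT z|lebesgue_on D. u z * ?\<zeta> z) - (LINT z|lebesgue_on D. v z * ?\<zeta> z)"
    using int[OF li(1) test_functions_deriv[OF \<eta>]] int[OF li(2) test_functions_deriv[OF \<eta>]]
    by (simp add: left_diff_distrib)
  also have "\<dots> = (- 1) ^ (i + j) * (LINT z|lebesgue_on D. g z * \<eta> z)
      - (- 1) ^ (i + j) * (LINT z|lebesgue_on D. g' z * \<eta> z)"
    using u v \<eta> unfolding weak_partial_def by simp
  also have "\<dots> = (- 1) ^ (i + j) * (LINT z|lebesgue_on D. (g z - g' z) * \<eta> z)"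
    using int[OF li(3) \<eta>] int[OF li(4) \<eta>] by (simp add: left_diff_distrib right_diff_distrib)
  finally show "(LINT z|lebesgue_on D. (u z - v z) * ?\<zeta> z)
      = (- 1) ^ (i + j) * (LINT z|lebesgue_on D. (g z - g' z) * \<eta> z)" .
qed

text \<open>Where \<open>w\<close> exceeds \<open>v\<close>, the function \<open>w\<close> is off
  the lower obstacle and \<open>v\<close> is off the upper one; so the operator applied to
  \<open>w\<close> is at most \<open>U\<close>, applied to \<open>v\<close> at least
  \<open>U\<close>, and \<open>U\<close> cancels in the difference. The obstacles supply the upper
  bound that \<open>comparison_principle\<close> asks for.\<close>

lemma double_obstacle_comparison:
  fixes v w :: "real \<times> real \<Rightarrow> real"
  assumes T: "0 < T" and \<theta>: "\<theta> \<noteq> 0" and r: "0 < r"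
    and X: "open Xo" "closed Xc" "Xo \<subseteq> Xc" and cl: "closure ({0<..<T} \<times> Xo) = {0..T} \<times> Xc"
    and M: "\<And>t. t \<in> {0..T} \<Longrightarrow> \<psi>0 t + \<psi>1 t \<le> M"
    and v: "continuous_on ({0..T} \<times> Xc) v" "weak_derivatives ({0<..<T} \<times> Xo) v vt vx vxx"
      "double_obstacle \<theta> \<beta> r U \<psi>0 \<psi>1 ({0<..<T} \<times> Xo) v vt vx vxx"
    and w: "continuous_on ({0..T} \<times> Xc) w" "weak_derivatives ({0<..<T} \<times> Xo) w wt wx wxx"
      "double_obstacle \<theta> \<beta> r U \<psi>0 \<psi>1 ({0<..<T} \<times> Xo) w wt wx wxx"
    and init: "\<And>x. x \<in> Xc \<Longrightarrow> w (0, x) \<le> v (0, x)"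
    and lateral: "\<And>\<tau> x. \<tau> \<in> {0..T} \<Longrightarrow> x \<in> Xc - Xo \<Longrightarrow> w (\<tau>, x) \<le> v (\<tau>, x)"
    and z: "z \<in> {0..T} \<times> Xc"
  shows "w z \<le> v z"
proof -
  let ?D = "{0<..<T} \<times> Xo"
  have oD: "open ?D" using X by (intro open_Times) auto
  have obs: "- \<psi>0 (fst z) \<le> u z \<and> u z \<le> \<psi>1 (fst z)"
    if "double_obstacle \<theta> \<beta> r U \<psi>0 \<psi>1 ?D u ut ux uxx" "z \<in> {0..T} \<times> Xc" for u ut ux uxx z
    using that unfolding double_obstacle_def cl by (cases z) auto
  have "w z - v z \<le> 0"
  proof (rule comparison_principle[OF T _ less_imp_le[OF r] X, where a="\<theta>\<^sup>2 / 2" and b="\<beta> - r + \<theta>\<^sup>2 / 2" and M=M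
      and d="\<lambda>z. w z - v z" and gt="\<lambda>z. wt z - vt z" and gx="\<lambda>z. wx z - vx z" and gxx="\<lambda>z. wxx z - vxx z"])
    show "0 < \<theta>\<^sup>2 / 2" using \<theta> by simp
    show "continuous_on ({0..T} \<times> Xc) (\<lambda>z. w z - v z)" by (intro continuous_intros v w)
    show "w z - v z \<le> M" if "z \<in> {0..T} \<times> Xc" for z
      using obs[OF v(3) that] obs[OF w(3) that] M[of "fst z"] that by (auto simp: mem_Times_iff)
    show "weak_partial 1 0 ?D (\<lambda>z. w z - v z) (\<lambda>z. wt z - vt z)"
      "weak_partial 0 1 ?D (\<lambda>z. w z - v z) (\<lambda>z. wx z - vx z)"
      "weak_partial 0 2 ?D (\<lambda>z. w z - v z) (\<lambda>z. wxx z - vxx z)"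
      using v(2) w(2) by (auto simp: weak_derivatives_def intro!: weak_partial_diff oD)
    have "AE z in lebesgue_on ?D. z \<in> ?D" by (rule AE_I2) simp
    moreover have "AE (\<tau>, x) in lebesgue_on ?D. (- \<psi>0 \<tau> < v (\<tau>, x) \<and> v (\<tau>, x) < \<psi>1 \<tau> \<longrightarrow>
           vt (\<tau>, x) - L_op \<theta> \<beta> r v vx vxx (\<tau>, x) = U x) \<and>
        (v (\<tau>, x) = - \<psi>0 \<tau> \<longrightarrow> vt (\<tau>, x) - L_op \<theta> \<beta> r v vx vxx (\<tau>, x) \<ge> U x) \<and>
        (v (\<tau>, x) = \<psi>1 \<tau> \<longrightarrow> vt (\<tau>, x) - L_op \<theta> \<beta> r v vx vxx (\<tau>, x) \<le> U x)"
      using v(3) unfolding double_obstacle_def by (rule conjunct1)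
    moreover have "AE (\<tau>, x) in lebesgue_on ?D. (- \<psi>0 \<tau> < w (\<tau>, x) \<and> w (\<tau>, x) < \<psi>1 \<tau> \<longrightarrow>
           wt (\<tau>, x) - L_op \<theta> \<beta> r w wx wxx (\<tau>, x) = U x) \<and>
        (w (\<tau>, x) = - \<psi>0 \<tau> \<longrightarrow> wt (\<tau>, x) - L_op \<theta> \<beta> r w wx wxx (\<tau>, x) \<ge> U x) \<and>
        (w (\<tau>, x) = \<psi>1 \<tau> \<longrightarrow> wt (\<tau>, x) - L_op \<theta> \<beta> r w wx wxx (\<tau>, x) \<le> U x)"
      using w(3) unfolding double_obstacle_def by (rule conjunct1)
    ultimately show "AE z in lebesgue_on ?D. 0 < w z - v z \<longrightarrow>
       (wt z - vt z) - \<theta>\<^sup>2 / 2 * (wxx z - vxx z) - (\<beta> - r + \<theta>\<^sup>2 / 2) * (wx z - vx z) + r * (w z - v z) \<le> 0"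
    proof eventually_elim
      case (elim z)
      obtain \<tau> x where zz: "z = (\<tau>, x)" by fastforce
      have zc: "z \<in> {0..T} \<times> Xc" using elim(1) X(3) by (auto simp: zz)
      show ?case
      proof
        assume "0 < w z - v z"
        then have "- \<psi>0 \<tau> < w z" "v z < \<psi>1 \<tau>"
          using obs[OF v(3) zc] obs[OF w(3) zc] by (auto simp: zz)
        then have "wt z - L_op \<theta> \<beta> r w wx wxx z \<le> U x" "U x \<le> vt z - L_op \<theta> \<beta> r v vx vxx z"
          using elim(2,3) obs[OF v(3) zc] obs[OF w(3) zc] unfolding zz prod.case fst_conv by linarith+
        then have "(wt z - L_op \<theta> \<beta> r w wx wxx z) - (vt z - L_op \<theta> \<beta> r v vx vxx z) \<le> 0" by linarith
        then show "(wt z - vt z) - \<theta>\<^sup>2 / 2 * (wxx z - vxx z) - (\<beta> - r + \<theta>\<^sup>2 / 2) * (wx z - vx z) + r * (w z - v z) \<le> 0"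
          unfolding L_op_def right_diff_distrib by linarith
      qed
    qed
    show "w (0, x) - v (0, x) \<le> 0" if "x \<in> Xc" for x using init[OF that] by simp
    show "w (\<tau>, x) - v (\<tau>, x) \<le> 0" if "\<tau> \<in> {0..T}" "x \<in> Xc - Xo" for \<tau> x using lateral[OF that] by simp
    show "z \<in> {0..T} \<times> Xc" by (rule z)
  qed
  then show ?thesis by simp
qed

lemma double_obstacle_unique:
  fixes v w :: "real \<times> real \<Rightarrow> real"
  assumes T: "0 < T" "\<theta> \<noteq> 0" "0 < r"
    and X: "open Xo" "closed Xc" "Xo \<subseteq> Xc" and cl: "closure ({0<..<T} \<times> Xo) = {0..T} \<times> Xc"
    and M: "\<And>t. t \<in> {0..T} \<Longrightarrow> \<psi>0 t + \<psi>1 t \<le> M"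
    and v: "continuous_on ({0..T} \<times> Xc) v" "weak_derivatives ({0<..<T} \<times> Xo) v vt vx vxx"
      "double_obstacle \<theta> \<beta> r U \<psi>0 \<psi>1 ({0<..<T} \<times> Xo) v vt vx vxx"
    and w: "continuous_on ({0..T} \<times> Xc) w" "weak_derivatives ({0<..<T} \<times> Xo) w wt wx wxx"
      "double_obstacle \<theta> \<beta> r U \<psi>0 \<psi>1 ({0<..<T} \<times> Xo) w wt wx wxx"
    and init: "\<And>x. x \<in> Xc \<Longrightarrow> w (0, x) = v (0, x)"
    and lateral: "\<And>\<tau> x. \<tau> \<in> {0..T} \<Longrightarrow> x \<in> Xc - Xo \<Longrightarrow> w (\<tau>, x) = v (\<tau>, x)"
    and z: "z \<in> {0..T} \<times> Xc"
  shows "w z = v z"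
proof (rule antisym)
  show "w z \<le> v z"
    by (rule double_obstacle_comparison[OF T X cl M v w _ _ z]) (use init lateral in auto)
  show "v z \<le> w z"
    by (rule double_obstacle_comparison[OF T X cl M w v _ _ z]) (use init lateral in auto)
qed

lemma bounded_in_Lp:
  assumes "u \<in> borel_measurable borel" "S \<in> lmeasurable" "\<And>z. z \<in> S \<Longrightarrow> \<bar>u z\<bar> \<le> c" "0 < p"
  shows "u \<in> Lp p S"
proof -
  have "u \<in> borel_measurable (lebesgue_on S)"
    using assms(1) by (intro measurable_restrict_space1 measurable_completion) simp
  moreover have "integrable (lebesgue_on S) (\<lambda>z. \<bar>u z\<bar> powr p)"
  proof (rule integrable_lebesgue_on_bounded[OF _ assms(2)])
    show "(\<lambda>z. \<bar>u z\<bar> powr p) \<in> borel_measurable borel" using assms(1) by measurable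
    show "\<bar>\<bar>u z\<bar> powr p\<bar> \<le> c powr p" if "z \<in> S" for z
      using assms(3)[OF that] assms(4) by (simp add: powr_mono2)
  qed
  ultimately show ?thesis by (simp add: Lp_def)
qed

context obstacle_data
begin

text \<open>Since \<open>lo\<close> lies strictly below \<open>hi\<close>, contact with one obstacle
  means being strictly off the other; so the two implications of \<open>solution_exists\<close>
  yield all three obstacle conditions. Local boundedness gives every exponent
  \<open>p\<close>.\<close>

lemma double_obstacle_solution:
  assumes \<theta>: "a = \<theta>\<^sup>2 / 2" "b = \<beta> - r + \<theta>\<^sup>2 / 2"
    and obst: "\<And>t. t \<in> {0..T} \<Longrightarrow> lo t = - \<psi>0 t" "\<And>t. t \<in> {0..T} \<Longrightarrow> hi t = \<psi>1 t"
      "\<And>t. t \<in> {0..T} \<Longrightarrow> lo t < hi t"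
    and cl: "closure D = Cl"
  obtains v vt vx vxx where
    "continuous_on Cl v" "weak_derivatives D v vt vx vxx"
    "\<And>S p. S \<in> lmeasurable \<Longrightarrow> bounded S \<Longrightarrow> 0 < p \<Longrightarrow> {v, vt, vx, vxx} \<subseteq> Lp p S"
    "double_obstacle \<theta> \<beta> r U \<psi>0 \<psi>1 D v vt vx vxx"
    "\<And>x. x \<in> Xc \<Longrightarrow> v (0, x) = 0"
    "\<And>\<tau>. W = {1} \<Longrightarrow> \<tau> \<in> {0..T} \<Longrightarrow> v (\<tau>, - l) = bl \<tau> \<and> v (\<tau>, l) = br \<tau>"
proof -
  obtain v vt vx vxx where s: "continuous_on Cl v" "weak_derivatives D v vt vx vxx"
    "{v, vt, vx, vxx} \<subseteq> borel_measurable borel"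
    "\<And>S. bounded S \<Longrightarrow> \<exists>c. \<forall>z\<in>S. \<forall>u\<in>{v, vt, vx, vxx}. \<bar>u z\<bar> \<le> c"
    "AE z in lborel. z \<in> D \<longrightarrow>
       (lo (fst z) < v z \<longrightarrow> vt z - a * vxx z - b * vx z + r * v z - U (snd z) \<le> 0) \<and>
       (v z < hi (fst z) \<longrightarrow> 0 \<le> vt z - a * vxx z - b * vx z + r * v z - U (snd z))"
    "\<And>z. z \<in> Cl \<Longrightarrow> lo (fst z) \<le> v z \<and> v z \<le> hi (fst z)"
    "\<And>x. x \<in> Xc \<Longrightarrow> v (0, x) = 0"
    "\<And>\<tau>. W = {1} \<Longrightarrow> \<tau> \<in> {0..T} \<Longrightarrow> v (\<tau>, - l) = bl \<tau> \<and> v (\<tau>, l) = br \<tau>"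
    by (rule solution_exists) blast
  show ?thesis
  proof (rule that[OF s(1,2) _ _ s(7,8)])
    show "{v, vt, vx, vxx} \<subseteq> Lp p S" if S: "S \<in> lmeasurable" "bounded S" "0 < p" for S and p :: real
    proof
      fix u assume u: "u \<in> {v, vt, vx, vxx}"
      obtain c where "\<forall>z\<in>S. \<forall>u\<in>{v, vt, vx, vxx}. \<bar>u z\<bar> \<le> c" using s(4)[OF S(2)] by blast
      then have "\<bar>u z\<bar> \<le> c" if "z \<in> S" for z using that u by blast
      moreover have "u \<in> borel_measurable borel" using s(3) u by blast
      ultimately show "u \<in> Lp p S" using S by (intro bounded_in_Lp)
    qed
    show "double_obstacle \<theta> \<beta> r U \<psi>0 \<psi>1 D v vt vx vxx"
      unfolding double_obstacle_def cl
    proof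
      show "\<forall>(\<tau>, x)\<in>Cl. - \<psi>0 \<tau> \<le> v (\<tau>, x) \<and> v (\<tau>, x) \<le> \<psi>1 \<tau>"
        using s(6) obst(1,2) by (fastforce simp: Cl_def)
      have "AE z in lebesgue_on D.
       (lo (fst z) < v z \<longrightarrow> vt z - a * vxx z - b * vx z + r * v z - U (snd z) \<le> 0) \<and>
       (v z < hi (fst z) \<longrightarrow> 0 \<le> vt z - a * vxx z - b * vx z + r * v z - U (snd z))"
        by (rule AE_lebesgue_on_of_lborel[OF s(5) D_borel])
      moreover have "AE z in lebesgue_on D. z \<in> D" by (rule AE_I2) simp
      ultimately show "AE (\<tau>, x) in lebesgue_on D.
        (- \<psi>0 \<tau> < v (\<tau>, x) \<and> v (\<tau>, x) < \<psi>1 \<tau> \<longrightarrow> vt (\<tau>, x) - L_op \<theta> \<beta> r v vx vxx (\<tau>, x) = U x) \<and>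
        (v (\<tau>, x) = - \<psi>0 \<tau> \<longrightarrow> vt (\<tau>, x) - L_op \<theta> \<beta> r v vx vxx (\<tau>, x) \<ge> U x) \<and>
        (v (\<tau>, x) = \<psi>1 \<tau> \<longrightarrow> vt (\<tau>, x) - L_op \<theta> \<beta> r v vx vxx (\<tau>, x) \<le> U x)"
      proof eventually_elim
        case (elim z)
        obtain \<tau> x where zz: "z = (\<tau>, x)" by fastforce
        have \<tau>: "\<tau> \<in> {0..T}" using D_fst[OF elim(2)] by (simp add: zz)
        have L: "vt z - L_op \<theta> \<beta> r v vx vxx z - U x = vt z - a * vxx z - b * vx z + r * v z - U (snd z)"
          by (simp add: L_op_def \<theta> zz)
        show ?case
          using elim(1) obst[OF \<tau>] unfolding L[symmetric] unfolding zz prod.case fst_conv by auto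
      qed
    qed
  qed
qed

end

section \<open>Reduction of the theorem to obstacle data\<close>

lemma C11_on_lipschitz:
  assumes "C11_on {0..T} f f'" "0 < T"
  obtains L where "0 \<le> L" "\<And>s t. s \<in> {0..T} \<Longrightarrow> t \<in> {0..T} \<Longrightarrow> \<bar>f s - f t\<bar> \<le> L * \<bar>s - t\<bar>"
proof -
  obtain K where K: "K-lipschitz_on {0..T} f'" using assms(1) by (auto simp: C11_on_def)
  have der: "(f has_real_derivative f' t) (at t within {0..T})" if "t \<in> {0..T}" for t
    using assms(1) that by (auto simp: C11_on_def)
  have K0: "0 \<le> K" using K by (rule lipschitz_on_nonneg)
  have b: "\<bar>f' t\<bar> \<le> \<bar>f' 0\<bar> + K * T" if "t \<in> {0..T}" for t
  proof -
    have "\<bar>f' t - f' 0\<bar> \<le> K * \<bar>t - 0\<bar>" using lipschitz_onD[OF K that, of 0] assms(2) by (simp add: dist_real_def)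
    also have "\<dots> \<le> K * T" using that K0 by (intro mult_left_mono) auto
    finally show ?thesis by linarith
  qed
  show ?thesis
  proof (rule that[of "\<bar>f' 0\<bar> + K * T"])
    show "0 \<le> \<bar>f' 0\<bar> + K * T" using K0 assms(2) by simp
    fix s t assume "s \<in> {0..T}" "t \<in> {0..T}"
    then have "norm (f s - f t) \<le> (\<bar>f' 0\<bar> + K * T) * norm (s - t)"
      using der b by (intro field_differentiable_bound[of "{0..T}" f f']) auto
    then show "\<bar>f s - f t\<bar> \<le> (\<bar>f' 0\<bar> + K * T) * \<bar>s - t\<bar>" by simp
  qed
qed

text \<open>The scheme may take its last step beyond time \<open>T\<close>, and
  \<open>obstacle_data\<close> asks for data at all times; so the data are frozen outside
  \<open>{0..T}\<close>, which does not enlarge the Lipschitz constant.\<close>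

lemma clamp_lipschitz:
  fixes f :: "real \<Rightarrow> real"
  assumes "0 \<le> T" "\<And>s t. s \<in> {0..T} \<Longrightarrow> t \<in> {0..T} \<Longrightarrow> \<bar>f s - f t\<bar> \<le> C * \<bar>s - t\<bar>" "0 \<le> C"
  shows "\<bar>f (max 0 (min T s)) - f (max 0 (min T t))\<bar> \<le> C * \<bar>s - t\<bar>"
proof -
  have "\<bar>f (max 0 (min T s)) - f (max 0 (min T t))\<bar> \<le> C * \<bar>max 0 (min T s) - max 0 (min T t)\<bar>"
    using assms(1) by (intro assms(2)) auto
  also have "\<dots> \<le> C * \<bar>s - t\<bar>" using assms(3) by (intro mult_left_mono) auto
  finally show ?thesis .
qed

theorem lemma4p2:
  fixes T r \<beta> \<sigma> \<mu> \<theta> \<alpha> \<gamma> \<gamma>1 \<epsilon>0 \<epsilon>1 L0 L1 A p :: real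
    and \<phi>0 \<phi>0' \<phi>1 \<phi>1' \<psi>0 \<psi>1 U \<E> :: "real \<Rightarrow> real"
    and \<G> \<rho>0 \<rho>1 :: "nat \<Rightarrow> real \<Rightarrow> real"
  assumes "T > 0" "r > 0" "\<beta> > 0" "\<sigma> > 0" "\<mu> \<noteq> r"
    and theta: "\<theta> = (\<mu> - r) / \<sigma>"
    and "0 < \<alpha>" "\<alpha> < 1" "\<gamma> > 0" "\<gamma> \<noteq> 1"
    and gamma1: "\<gamma>1 = 1 - \<alpha> * (1 - \<gamma>)"
    and "0 \<le> \<epsilon>1" "\<epsilon>1 < \<epsilon>0" "0 < L0" "L0 < L1"
    and A: "A = \<gamma>1 / (1 - \<gamma>1) * (L1 powr ((\<gamma>1 - \<gamma>) / \<gamma>1) - L0 powr ((\<gamma>1 - \<gamma>) / \<gamma>1))"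
    and K1: "r + (\<beta> - r) / \<gamma>1 + (\<gamma>1 - 1) / \<gamma>1\<^sup>2 * (\<theta>\<^sup>2 / 2) > 0"
    and "C11_on {0..T} \<phi>0 \<phi>0'" "C11_on {0..T} \<phi>1 \<phi>1'"
    and "\<forall>t\<in>{0..T}. \<phi>0 t > 0" "\<forall>t\<in>{0..T}. \<phi>1 t > 0"
    and cond_i: "\<forall>t\<in>{0..T}. \<phi>0' t - r * \<phi>0 t < - \<phi>1' t + r * \<phi>1 t"
    and cond_ii: "\<phi>1 0 < (\<epsilon>0 - \<epsilon>1) * ((1 - exp (- r * T)) / r)"
      "\<forall>t\<in>{0..T}. - \<phi>1' t + r * \<phi>1 t < \<epsilon>0 - \<epsilon>1"
    and psi: "\<forall>\<tau>. \<psi>0 \<tau> = \<phi>0 (T - \<tau>)" "\<forall>\<tau>. \<psi>1 \<tau> = \<phi>1 (T - \<tau>)"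
    and U: "\<forall>x. U x = (\<epsilon>0 - \<epsilon>1) - A * exp (- x / \<gamma>1)"
    and E: "\<forall>\<tau>. \<E> \<tau> = (\<epsilon>0 - \<epsilon>1) * ((1 - exp (- r * \<tau>)) / r)"
    and G: "\<forall>n \<tau>. \<G> n \<tau> = A * exp (real n / \<gamma>1) * \<tau>"
    and rho: "\<forall>n \<tau>. \<rho>0 n \<tau> = max (- \<G> n \<tau>) (- \<psi>0 \<tau>)"
      "\<forall>n \<tau>. \<rho>1 n \<tau> = min (\<E> \<tau>) (\<psi>1 \<tau>)"
    and p: "1 < p"
  shows "(\<forall>n\<ge>1. exists_unique_on (closure (dom_Tn T n))
            (solves_on_rectangle p T n \<theta> \<beta> r U \<psi>0 \<psi>1 (\<rho>0 n) (\<rho>1 n))) \<and>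
         exists_unique_on (closure (dom_T T)) (solves_on_strip p T \<theta> \<beta> r U \<psi>0 \<psi>1)"
proof -
  have \<theta>0: "\<theta> \<noteq> 0" using \<open>\<mu> \<noteq> r\<close> \<open>\<sigma> > 0\<close> by (simp add: theta)
  have \<gamma>1_pos: "0 < \<gamma>1"
  proof -
    \<comment> \<open>A convex combination of 1 and \<open>\<gamma>\<close>.\<close>
    have "\<gamma>1 = (1 - \<alpha>) + \<alpha> * \<gamma>" by (simp add: gamma1 algebra_simps)
    then show ?thesis using \<open>0 < \<alpha>\<close> \<open>\<alpha> < 1\<close> \<open>\<gamma> > 0\<close> by (simp add: add_pos_pos)
  qed
  have A_pos: "0 < A"
  proof -
    \<comment> \<open>The exponent of \<open>L0\<close> and \<open>L1\<close> and the denominator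
      \<open>1 - \<gamma>1\<close> both have the sign of \<open>1 - \<gamma>\<close>, so the two
      factors of \<open>A\<close> have equal signs in either case.\<close>
    have e: "\<gamma>1 - \<gamma> = (1 - \<alpha>) * (1 - \<gamma>)" "1 - \<gamma>1 = \<alpha> * (1 - \<gamma>)" by (auto simp: gamma1 algebra_simps)
    consider "\<gamma> < 1" | "\<gamma> > 1" using \<open>\<gamma> \<noteq> 1\<close> by linarith
    then show ?thesis
    proof cases
      case 1
      then have "0 < (\<gamma>1 - \<gamma>) / \<gamma>1" "0 < 1 - \<gamma>1" using e \<gamma>1_pos \<open>0 < \<alpha>\<close> \<open>\<alpha> < 1\<close> by simp_all
      moreover from this have "L0 powr ((\<gamma>1 - \<gamma>) / \<gamma>1) < L1 powr ((\<gamma>1 - \<gamma>) / \<gamma>1)"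
        using \<open>0 < L0\<close> \<open>L0 < L1\<close> by (intro powr_less_mono2) auto
      ultimately show ?thesis unfolding A using \<gamma>1_pos by simp
    next
      case 2
      then have "(\<gamma>1 - \<gamma>) / \<gamma>1 < 0" "1 - \<gamma>1 < 0"
        using e \<gamma>1_pos \<open>0 < \<alpha>\<close> \<open>\<alpha> < 1\<close> by (auto simp: divide_less_0_iff mult_less_0_iff)
      moreover from this have "L1 powr ((\<gamma>1 - \<gamma>) / \<gamma>1) < L0 powr ((\<gamma>1 - \<gamma>) / \<gamma>1)"
        using \<open>0 < L0\<close> \<open>L0 < L1\<close> by (intro powr_less_mono2_neg) auto
      ultimately show ?thesis unfolding A using \<gamma>1_pos
        by (intro mult_neg_neg) (auto simp: divide_pos_neg)
    qed
  qed
  have U_eq: "U = (\<lambda>x. (\<epsilon>0 - \<epsilon>1) - A * exp (- x / \<gamma>1))" using U by auto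
  obtain K0 where K0: "0 \<le> K0" "\<And>s t. s \<in> {0..T} \<Longrightarrow> t \<in> {0..T} \<Longrightarrow> \<bar>\<phi>0 s - \<phi>0 t\<bar> \<le> K0 * \<bar>s - t\<bar>"
    using C11_on_lipschitz[OF \<open>C11_on {0..T} \<phi>0 \<phi>0'\<close> \<open>T > 0\<close>] by blast
  obtain K1 where K1: "0 \<le> K1" "\<And>s t. s \<in> {0..T} \<Longrightarrow> t \<in> {0..T} \<Longrightarrow> \<bar>\<phi>1 s - \<phi>1 t\<bar> \<le> K1 * \<bar>s - t\<bar>"
    using C11_on_lipschitz[OF \<open>C11_on {0..T} \<phi>1 \<phi>1'\<close> \<open>T > 0\<close>] by blast
  have \<psi>_lip: "\<bar>\<psi>0 s - \<psi>0 t\<bar> \<le> K0 * \<bar>s - t\<bar>" "\<bar>\<psi>1 s - \<psi>1 t\<bar> \<le> K1 * \<bar>s - t\<bar>"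
    if "s \<in> {0..T}" "t \<in> {0..T}" for s t
    using K0(2)[of "T - s" "T - t"] K1(2)[of "T - s" "T - t"] that psi by (auto simp: abs_minus_commute)
  have \<psi>_pos: "0 < \<psi>0 t" "0 < \<psi>1 t" if "t \<in> {0..T}" for t
    using that psi \<open>\<forall>t\<in>{0..T}. \<phi>0 t > 0\<close> \<open>\<forall>t\<in>{0..T}. \<phi>1 t > 0\<close> by auto
  define M where "M = \<psi>0 0 + \<psi>1 0 + (K0 + K1) * T"
  have \<psi>_le: "\<psi>0 t \<le> M" "\<psi>1 t \<le> M" if t: "t \<in> {0..T}" for t
  proof -
    have "K0 * \<bar>t - 0\<bar> \<le> K0 * T" "K1 * \<bar>t - 0\<bar> \<le> K1 * T"
      using K0(1) K1(1) t by (auto intro!: mult_left_mono)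
    moreover have "\<bar>\<psi>0 t - \<psi>0 0\<bar> \<le> K0 * \<bar>t - 0\<bar>" "\<bar>\<psi>1 t - \<psi>1 0\<bar> \<le> K1 * \<bar>t - 0\<bar>"
      using t \<open>T > 0\<close> by (intro \<psi>_lip; simp)+
    moreover have "0 \<le> K0 * T" "0 \<le> K1 * T" using K0(1) K1(1) \<open>T > 0\<close> by simp_all
    moreover have "0 < \<psi>0 0" "0 < \<psi>1 0" using \<psi>_pos[of 0] \<open>T > 0\<close> by simp_all
    ultimately show "\<psi>0 t \<le> M" "\<psi>1 t \<le> M" unfolding M_def distrib_right by linarith+
  qed
  define cl where "cl t = max 0 (min T t)" for t
  have cl: "cl t \<in> {0..T}" for t using \<open>T > 0\<close> by (auto simp: cl_def)
  have cl_id: "cl t = t" if "t \<in> {0..T}" for t using that by (auto simp: cl_def)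
  \<comment> \<open>One constant for the Lipschitz bounds of the obstacles and of both lateral
    functions and for the growth bound of \<open>U\<close>. The dependence on \<open>n\<close> stems
    from the slope of \<open>\<G> n\<close>.\<close>
  define C where "C n = K0 + K1 + (\<epsilon>0 - \<epsilon>1) + A * exp (real n / \<gamma>1) + A" for n :: nat
  have C: "0 \<le> C n" "K0 \<le> C n" "K1 \<le> C n" "\<epsilon>0 - \<epsilon>1 \<le> C n" "A * exp (real n / \<gamma>1) \<le> C n" "(\<epsilon>0 - \<epsilon>1) + A \<le> C n" for n
  proof -
    have "0 \<le> A * exp (real n / \<gamma>1)" using A_pos by simp
    then show "0 \<le> C n" "K0 \<le> C n" "K1 \<le> C n" "\<epsilon>0 - \<epsilon>1 \<le> C n" "A * exp (real n / \<gamma>1) \<le> C n" "(\<epsilon>0 - \<epsilon>1) + A \<le> C n"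
      using K0(1) K1(1) \<open>\<epsilon>1 < \<epsilon>0\<close> A_pos unfolding C_def by linarith+
  qed
  have lipC: "\<bar>f (cl s) - f (cl t)\<bar> \<le> C n * \<bar>s - t\<bar>"
    if "\<And>s t. s \<in> {0..T} \<Longrightarrow> t \<in> {0..T} \<Longrightarrow> \<bar>f s - f t\<bar> \<le> K * \<bar>s - t\<bar>" "K \<le> C n" for f K n s t
  proof -
    have "\<bar>f s - f t\<bar> \<le> C n * \<bar>s - t\<bar>" if "s \<in> {0..T}" "t \<in> {0..T}" for s t
      by (rule order_trans[OF \<open>\<And>s t. s \<in> {0..T} \<Longrightarrow> t \<in> {0..T} \<Longrightarrow> \<bar>f s - f t\<bar> \<le> K * \<bar>s - t\<bar>\<close>[OF that]])
        (intro mult_right_mono \<open>K \<le> C n\<close> abs_ge_zero)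
    then show ?thesis unfolding cl_def using clamp_lipschitz[of T f "C n"] C(1) \<open>T > 0\<close> by simp
  qed
  have U_bound: "\<bar>U x\<bar> \<le> C n * (1 + exp (- (1 / \<gamma>1) * x))" for x n
  proof -
    have "\<bar>U x\<bar> \<le> (\<epsilon>0 - \<epsilon>1) + A * exp (- (1 / \<gamma>1) * x)"
      using A_pos \<open>\<epsilon>1 < \<epsilon>0\<close> by (simp add: U_eq abs_le_iff)
    also have "\<dots> \<le> C n * 1 + C n * exp (- (1 / \<gamma>1) * x)"
      using C[of n] A_pos \<open>\<epsilon>1 < \<epsilon>0\<close> by (intro add_mono mult_right_mono) auto
    finally show ?thesis by (simp add: distrib_left)
  qed
  have data: "obstacle_data (\<theta>\<^sup>2 / 2) r T l (1 / \<gamma>1) (C n) M W U (\<lambda>t. - \<psi>0 (cl t)) (\<lambda>t. \<psi>1 (cl t))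
      (\<lambda>t. bl (cl t)) (\<lambda>t. br (cl t))"
    if "0 < l" "W = {1} \<or> W = {1..}"
      and b: "\<And>t. t \<in> {0..T} \<Longrightarrow> - \<psi>0 t \<le> bl t \<and> bl t \<le> \<psi>1 t" "\<And>t. t \<in> {0..T} \<Longrightarrow> - \<psi>0 t \<le> br t \<and> br t \<le> \<psi>1 t"
      and b_lip: "\<And>s t. s \<in> {0..T} \<Longrightarrow> t \<in> {0..T} \<Longrightarrow> \<bar>bl s - bl t\<bar> \<le> C n * \<bar>s - t\<bar>"
        "\<And>s t. s \<in> {0..T} \<Longrightarrow> t \<in> {0..T} \<Longrightarrow> \<bar>br s - br t\<bar> \<le> C n * \<bar>s - t\<bar>"
      and b0: "bl 0 = 0" "br 0 = 0" for l W bl br n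
  proof
    show "\<bar>- \<psi>0 (cl s) - - \<psi>0 (cl t)\<bar> \<le> C n * \<bar>s - t\<bar>" for s t
      using lipC[OF \<psi>_lip(1) C(2), of s t] by (simp add: abs_minus_commute)
    show "\<bar>\<psi>1 (cl s) - \<psi>1 (cl t)\<bar> \<le> C n * \<bar>s - t\<bar>" for s t by (rule lipC[OF \<psi>_lip(2) C(3)])
    show "\<bar>bl (cl s) - bl (cl t)\<bar> \<le> C n * \<bar>s - t\<bar>" for s t by (rule lipC[OF b_lip(1) order_refl])
    show "\<bar>br (cl s) - br (cl t)\<bar> \<le> C n * \<bar>s - t\<bar>" for s t by (rule lipC[OF b_lip(2) order_refl])
    show "\<bar>U x\<bar> \<le> C n * (1 + exp (- (1 / \<gamma>1) * x))" for x by (rule U_bound)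
    show "continuous_on UNIV U" unfolding U_eq using \<gamma>1_pos by (intro continuous_intros) auto
    show "bl (cl 0) = 0" "br (cl 0) = 0" using b0 cl_id[of 0] \<open>T > 0\<close> by simp_all
  qed (use that \<theta>0 \<open>T > 0\<close> \<open>r > 0\<close> \<gamma>1_pos C(1) \<psi>_pos[OF cl] \<psi>_le[OF cl] b[OF cl] in \<open>auto intro: less_imp_le\<close>)
  have MM: "\<psi>0 t + \<psi>1 t \<le> 2 * M" if "t \<in> {0..T}" for t using \<psi>_le[OF that] by simp
  have obst: "- \<psi>0 (cl t) = - \<psi>0 t" "\<psi>1 (cl t) = \<psi>1 t" "- \<psi>0 (cl t) < \<psi>1 (cl t)" if "t \<in> {0..T}" for t
    using \<psi>_pos[OF cl[of t]] cl_id[OF that] by simp_all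
  have part1: "exists_unique_on (closure (dom_Tn T n)) (solves_on_rectangle p T n \<theta> \<beta> r U \<psi>0 \<psi>1 (\<rho>0 n) (\<rho>1 n))"
    if n: "1 \<le> n" for n
  proof -
    have n0: "0 < real n" using n by simp
    have G_nonneg: "0 \<le> \<G> n t" if "t \<in> {0..T}" for t using that A_pos G by simp
    have E_nonneg: "0 \<le> \<E> t" if "t \<in> {0..T}" for t using that \<open>r > 0\<close> \<open>\<epsilon>1 < \<epsilon>0\<close> E by simp
    have G_lip: "\<bar>\<G> n s - \<G> n t\<bar> \<le> C n * \<bar>s - t\<bar>" for s t
    proof -
      have "\<bar>\<G> n s - \<G> n t\<bar> = A * exp (real n / \<gamma>1) * \<bar>s - t\<bar>"
        using G A_pos by (simp add: abs_mult flip: right_diff_distrib)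
      also have "\<dots> \<le> C n * \<bar>s - t\<bar>" using C(5) by (intro mult_right_mono) auto
      finally show ?thesis .
    qed
    have E_lip: "\<bar>\<E> s - \<E> t\<bar> \<le> C n * \<bar>s - t\<bar>" if "s \<in> {0..T}" "t \<in> {0..T}" for s t
    proof -
      have E': "\<E> = (\<lambda>\<tau>. (\<epsilon>0 - \<epsilon>1) * ((1 - exp (- r * \<tau>)) / r))" using E by auto
      have "norm (\<E> s - \<E> t) \<le> (\<epsilon>0 - \<epsilon>1) * norm (s - t)"
      proof (rule field_differentiable_bound[of "{0..T}" \<E> "\<lambda>\<tau>. (\<epsilon>0 - \<epsilon>1) * exp (- r * \<tau>)"])
        show "(\<E> has_field_derivative (\<epsilon>0 - \<epsilon>1) * exp (- r * \<tau>)) (at \<tau> within {0..T})" for \<tau>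
          unfolding E' using \<open>r > 0\<close> by (auto intro!: derivative_eq_intros)
        show "norm ((\<epsilon>0 - \<epsilon>1) * exp (- r * \<tau>)) \<le> \<epsilon>0 - \<epsilon>1" if "\<tau> \<in> {0..T}" for \<tau>
          using that \<open>r > 0\<close> \<open>\<epsilon>1 < \<epsilon>0\<close> by (simp add: abs_mult mult_left_le)
      qed (use that in auto)
      also have "\<dots> \<le> C n * \<bar>s - t\<bar>" unfolding real_norm_def by (rule mult_right_mono[OF C(4) abs_ge_zero])
      finally show ?thesis by simp
    qed
    have \<psi>C: "\<bar>\<psi>0 s - \<psi>0 t\<bar> \<le> C n * \<bar>s - t\<bar>" "\<bar>\<psi>1 s - \<psi>1 t\<bar> \<le> C n * \<bar>s - t\<bar>"
      if "s \<in> {0..T}" "t \<in> {0..T}" for s t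
      using \<psi>_lip[OF that] mult_right_mono[OF C(2)[of n] abs_ge_zero[of "s - t"]] mult_right_mono[OF C(3)[of n] abs_ge_zero[of "s - t"]]
      by linarith+
    interpret R: obstacle_data "\<theta>\<^sup>2 / 2" "\<beta> - r + \<theta>\<^sup>2 / 2" r T "real n" "1 / \<gamma>1" "C n" M "{1}" U
      "\<lambda>t. - \<psi>0 (cl t)" "\<lambda>t. \<psi>1 (cl t)" "\<lambda>t. \<rho>0 n (cl t)" "\<lambda>t. \<rho>1 n (cl t)"
    proof (rule data[OF n0])
      show "- \<psi>0 t \<le> \<rho>0 n t \<and> \<rho>0 n t \<le> \<psi>1 t" if "t \<in> {0..T}" for t
        using rho(1) G_nonneg[OF that] \<psi>_pos[OF that] by simp
      show "- \<psi>0 t \<le> \<rho>1 n t \<and> \<rho>1 n t \<le> \<psi>1 t" if "t \<in> {0..T}" for t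
        using rho(2) E_nonneg[OF that] \<psi>_pos[OF that] by simp
      show "\<bar>\<rho>0 n s - \<rho>0 n t\<bar> \<le> C n * \<bar>s - t\<bar>" if "s \<in> {0..T}" "t \<in> {0..T}" for s t
        using G_lip[of s t] \<psi>C(1)[OF that] rho(1) by (auto simp: max_def abs_le_iff)
      show "\<bar>\<rho>1 n s - \<rho>1 n t\<bar> \<le> C n * \<bar>s - t\<bar>" if "s \<in> {0..T}" "t \<in> {0..T}" for s t
        using E_lip[OF that] \<psi>C(2)[OF that] rho(2) by (auto simp: min_def abs_le_iff)
      \<comment> \<open>Compatibility at the corners: \<open>\<G> n\<close> and \<open>\<E>\<close>
        vanish at time 0, where the obstacles lie strictly on either side of 0.\<close>
      show "\<rho>0 n 0 = 0" "\<rho>1 n 0 = 0"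
        using rho G E \<psi>_pos[of 0] \<open>T > 0\<close> by auto
    qed simp
    have X: "R.Xo = {- real n<..<real n}" "R.Xc = {- real n..real n}" unfolding R.Xo_def R.Xc_def by auto
    have D: "R.D = dom_Tn T n" unfolding R.D_def dom_Tn_def X ..
    have Cl: "R.Cl = {0..T} \<times> {- real n..real n}" unfolding R.Cl_def X ..
    have cls: "closure (dom_Tn T n) = {0..T} \<times> {- real n..real n}"
      using \<open>T > 0\<close> n0 by (simp add: dom_Tn_def closure_Times closure_greaterThanLessThan)
    obtain v vt vx vxx where s: "continuous_on R.Cl v" "weak_derivatives R.D v vt vx vxx"
      "\<And>S p. S \<in> lmeasurable \<Longrightarrow> bounded S \<Longrightarrow> 0 < p \<Longrightarrow> {v, vt, vx, vxx} \<subseteq> Lp p S"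
      "double_obstacle \<theta> \<beta> r U \<psi>0 \<psi>1 R.D v vt vx vxx"
      "\<And>x. x \<in> R.Xc \<Longrightarrow> v (0, x) = 0"
      "\<And>\<tau>. {1::nat} = {1} \<Longrightarrow> \<tau> \<in> {0..T} \<Longrightarrow> v (\<tau>, - real n) = \<rho>0 n (cl \<tau>) \<and> v (\<tau>, real n) = \<rho>1 n (cl \<tau>)"
      by (rule R.double_obstacle_solution[OF refl refl obst cls[folded D, folded Cl]], assumption, assumption, assumption)
        (rule that)
    have bdd: "bounded (dom_Tn T n)" "dom_Tn T n \<in> lmeasurable"
    proof -
      show b: "bounded (dom_Tn T n)" unfolding dom_Tn_def by (intro bounded_Times) auto
      have "open (dom_Tn T n)" unfolding dom_Tn_def by (intro open_Times) auto
      then show "dom_Tn T n \<in> lmeasurable" using b by (intro lmeasurable_open)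
    qed
    show ?thesis
      unfolding exists_unique_on_def
    proof (intro exI[of _ v] conjI allI impI ballI)
      show "solves_on_rectangle p T n \<theta> \<beta> r U \<psi>0 \<psi>1 (\<rho>0 n) (\<rho>1 n) v"
        unfolding solves_on_rectangle_def in_W12_def
      proof (intro conjI exI)
        show "continuous_on (closure (dom_Tn T n)) v" using s(1) unfolding Cl cls .
        show "weak_derivatives (dom_Tn T n) v vt vx vxx" using s(2) unfolding D .
        show "{v, vt, vx, vxx} \<subseteq> Lp p (dom_Tn T n)" using p by (intro s(3) bdd) simp
        show "double_obstacle \<theta> \<beta> r U \<psi>0 \<psi>1 (dom_Tn T n) v vt vx vxx" using s(4) unfolding D .
        show "\<forall>x\<in>{- real n..real n}. v (0, x) = 0" using s(5) unfolding X by (rule ballI)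
        show "\<forall>\<tau>\<in>{0..T}. v (\<tau>, - real n) = \<rho>0 n \<tau> \<and> v (\<tau>, real n) = \<rho>1 n \<tau>"
        proof
          fix \<tau> assume \<tau>: "\<tau> \<in> {0..T}"
          show "v (\<tau>, - real n) = \<rho>0 n \<tau> \<and> v (\<tau>, real n) = \<rho>1 n \<tau>"
            using s(6)[OF refl \<tau>] unfolding cl_id[OF \<tau>] .
        qed
      qed
      fix w z assume w: "solves_on_rectangle p T n \<theta> \<beta> r U \<psi>0 \<psi>1 (\<rho>0 n) (\<rho>1 n) w" and z: "z \<in> closure (dom_Tn T n)"
      then obtain wt wx wxx where w': "continuous_on (closure (dom_Tn T n)) w" "weak_derivatives (dom_Tn T n) w wt wx wxx"
        "double_obstacle \<theta> \<beta> r U \<psi>0 \<psi>1 (dom_Tn T n) w wt wx wxx"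
        "\<And>x. x \<in> {- real n..real n} \<Longrightarrow> w (0, x) = 0"
        "\<And>\<tau>. \<tau> \<in> {0..T} \<Longrightarrow> w (\<tau>, - real n) = \<rho>0 n \<tau> \<and> w (\<tau>, real n) = \<rho>1 n \<tau>"
        unfolding solves_on_rectangle_def in_W12_def by blast
      show "w z = v z"
      proof (rule double_obstacle_unique[OF \<open>T > 0\<close> \<theta>0 \<open>r > 0\<close>, where Xo="{- real n<..<real n}" and Xc="{- real n..real n}" and M="2 * M"])
        show "w (0, x) = v (0, x)" if "x \<in> {- real n..real n}" for x using w'(4) s(5)[unfolded X] that by simp
        show "w (\<tau>, x) = v (\<tau>, x)" if "\<tau> \<in> {0..T}" "x \<in> {- real n..real n} - {- real n<..<real n}" for \<tau> x
        proof -
          have "x = - real n \<or> x = real n" using that(2) by auto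
          then show ?thesis using w'(5)[OF that(1)] s(6)[OF refl that(1)] cl_id[OF that(1)] by auto
        qed
        show "{- real n<..<real n} \<subseteq> {- real n..real n}" by auto
      qed (rule MM s(1,2,4)[unfolded D Cl dom_Tn_def] w'(1-3)[unfolded cls, unfolded dom_Tn_def]
            z[unfolded cls] cls[unfolded dom_Tn_def] open_greaterThanLessThan closed_atLeastAtMost, assumption?)+
    qed
  qed
  have part2: "exists_unique_on (closure (dom_T T)) (solves_on_strip p T \<theta> \<beta> r U \<psi>0 \<psi>1)"
  proof -
    \<comment> \<open>With \<open>W = {1..}\<close> every integer is an interior index, so the
      lateral data are placeholders; 0 is a Lipschitz choice between the obstacles.\<close>
    interpret R: obstacle_data "\<theta>\<^sup>2 / 2" "\<beta> - r + \<theta>\<^sup>2 / 2" r T 1 "1 / \<gamma>1" "C 0" M "{1..}" U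
      "\<lambda>t. - \<psi>0 (cl t)" "\<lambda>t. \<psi>1 (cl t)" "\<lambda>_. 0" "\<lambda>_. 0"
    proof (rule data[where bl="\<lambda>_. 0" and br="\<lambda>_. 0" and l=1 and W="{1..}" and n=0])
      show "{1..} = {1} \<or> {1..} = {1::nat..}" by (rule disjI2) (rule refl)
      show "- \<psi>0 t \<le> 0 \<and> 0 \<le> \<psi>1 t" if "t \<in> {0..T}" for t using \<psi>_pos[OF that] by simp
      then show "- \<psi>0 t \<le> 0 \<and> 0 \<le> \<psi>1 t" if "t \<in> {0..T}" for t using that .
      show "\<bar>0 - 0\<bar> \<le> C 0 * \<bar>s - t\<bar>" for s t :: real using C(1)[of 0] by simp
      then show "\<bar>0 - 0\<bar> \<le> C 0 * \<bar>s - t\<bar>" for s t :: real .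
    qed simp_all
    have "x \<in> R.Xo \<and> x \<in> R.Xc" for x
    proof -
      obtain k where "\<bar>x\<bar> < real k" using reals_Archimedean2 by blast
      then have "k \<in> {1..}" "x \<in> {- (real k * 1)<..<real k * 1}" "x \<in> {- (real k * 1)..real k * 1}"
        by (cases k; simp add: abs_less_iff; linarith)+
      then show ?thesis unfolding R.Xo_def R.Xc_def by blast
    qed
    then have X: "R.Xo = UNIV" "R.Xc = UNIV" by auto
    have D: "R.D = dom_T T" unfolding R.D_def dom_T_def X ..
    have Cl: "R.Cl = {0..T} \<times> UNIV" unfolding R.Cl_def X ..
    have cls: "closure (dom_T T) = {0..T} \<times> UNIV"
      using \<open>T > 0\<close> by (simp add: dom_T_def closure_Times closure_greaterThanLessThan)
    obtain v vt vx vxx where s: "continuous_on R.Cl v" "weak_derivatives R.D v vt vx vxx"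
      "\<And>S p. S \<in> lmeasurable \<Longrightarrow> bounded S \<Longrightarrow> 0 < p \<Longrightarrow> {v, vt, vx, vxx} \<subseteq> Lp p S"
      "double_obstacle \<theta> \<beta> r U \<psi>0 \<psi>1 R.D v vt vx vxx"
      "\<And>x. x \<in> R.Xc \<Longrightarrow> v (0, x) = 0"
      by (rule R.double_obstacle_solution[OF refl refl obst cls[folded D, folded Cl]], assumption, assumption, assumption)
        (rule that)
    show ?thesis
      unfolding exists_unique_on_def
    proof (intro exI[of _ v] conjI allI impI ballI)
      have "{v, vt, vx, vxx} \<subseteq> Lp p S" if "compact S" for S
        using that p by (intro s(3)) (auto intro: lmeasurable_compact compact_imp_bounded)
      then have "in_W12_loc p (dom_T T) v vt vx vxx"
        unfolding in_W12_loc_def using s(2) unfolding D by simp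
      then show "solves_on_strip p T \<theta> \<beta> r U \<psi>0 \<psi>1 v"
        unfolding solves_on_strip_def
      proof (intro conjI exI)
        show "continuous_on (closure (dom_T T)) v" using s(1) unfolding Cl cls .
        show "double_obstacle \<theta> \<beta> r U \<psi>0 \<psi>1 (dom_T T) v vt vx vxx" using s(4) unfolding D .
        show "\<forall>x. v (0, x) = 0" using s(5) unfolding X by simp
      qed
      fix w z assume w: "solves_on_strip p T \<theta> \<beta> r U \<psi>0 \<psi>1 w" and z: "z \<in> closure (dom_T T)"
      note wd = w[unfolded solves_on_strip_def]
      note w0 = conjunct1[OF wd] conjunct2[OF conjunct2[OF wd]] conjunct1[OF conjunct2[OF wd]]
      from w0(3) obtain wt wx wxx where w1: "in_W12_loc p (dom_T T) w wt wx wxx"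
        "double_obstacle \<theta> \<beta> r U \<psi>0 \<psi>1 (dom_T T) w wt wx wxx" by (elim exE conjE) (rule that)
      note w' = w0(1) conjunct1[OF w1(1)[unfolded in_W12_loc_def]] w1(2) w0(2)[rule_format]
      show "w z = v z"
      proof (rule double_obstacle_unique[OF \<open>T > 0\<close> \<theta>0 \<open>r > 0\<close>, where Xo=UNIV and Xc=UNIV and M="2 * M"])
        show "w (0, x) = v (0, x)" for x using w'(4)[of x] s(5)[of x] unfolding X by simp
        show "w (\<tau>, x) = v (\<tau>, x)" if "x \<in> UNIV - UNIV" for \<tau> x using that by simp
        show "continuous_on ({0..T} \<times> UNIV) v" using s(1) unfolding Cl .
        show "weak_derivatives ({0<..<T} \<times> UNIV) v vt vx vxx" using s(2) unfolding D dom_T_def .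
        show "double_obstacle \<theta> \<beta> r U \<psi>0 \<psi>1 ({0<..<T} \<times> UNIV) v vt vx vxx" using s(4) unfolding D dom_T_def .
        show "continuous_on ({0..T} \<times> UNIV) w" using w'(1) unfolding cls .
        show "weak_derivatives ({0<..<T} \<times> UNIV) w wt wx wxx" using w'(2) unfolding dom_T_def .
        show "double_obstacle \<theta> \<beta> r U \<psi>0 \<psi>1 ({0<..<T} \<times> UNIV) w wt wx wxx" using w'(3) unfolding dom_T_def .
        show "closure ({0<..<T} \<times> UNIV) = {0..T} \<times> (UNIV :: real set)" using cls unfolding dom_T_def .
        show "z \<in> {0..T} \<times> UNIV" using z unfolding cls .
      qed (use MM in auto)
    qed
  qed
  show ?thesis using part1 part2 by blast
qed

end
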